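(* Let $G=(V,E)$ be a finite directed acyclic network with source $s$ and sink set $T$, let $\omega\ge1$, $r\ge0$ be integers with $n=\omega+r\le C_{\min}$, and let $\mathbb{F}_q$ be a finite field of order $q>|\mathscr{A}_r|$, where $\mathscr{A}_r$ is the set of primary edge subsets of $G$ of size $r$. Let $\mathcal{C}_n$ be an $n$-dimensional decodable linear network code over $\mathbb{F}_q$ on $G$ with local encoding kernel $K_s$ at $s$ and global encoding kernels $\vec f_e^{\,(n)}$, $e\in E$, and let $Q^{(n)}=[\vec b_1^{\,(n)}\ \cdots\ \vec b_n^{\,(n)}]$ be an invertible $n\times n$ matrix over $\mathbb{F}_q$ with $$\langle \vec b_i^{\,(n)}:1\le i\le\omega\rangle\cap\langle \vec f_e^{\,(n)}:e\in A\rangle=\{\vec 0\}\quad\text{for all }A\in\mathscr{A}_r,$$ so that $(Q^{(n)})^{-1}\cdot\mathcal{C}_n$ is a secure linear network code with rate $\omega$ and security level $r$. Then there is an algorithm which, given $\mathcal{C}_n$ (with its global encoding kernels), $Q^{(n)}$ and $\mathscr{A}_r$, computes a column vector $\vec\ell\in\mathbb{F}_q^{n-1}$, the matrix $K_s^{(n-1)}(\vec\ell)=[I_{n-1}\ \ \vec\ell\,]K_s$, and an invertible $(n-1)\times(n-1)$ matrix $Q^{(n-1)}$ whose columns are $n-1$ of the $n$ columns of $[I_{n-1}\ \ \vec\ell\,]Q^{(n)}$, such that, with $\mathcal{C}_{n-1}=[I_{n-1}\ \ \vec\ell\,]\cdot\mathcal{C}_n$, the code $(Q^{(n-1)})^{-1}\cdot\mathcal{C}_{n-1}$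 is an $(n-1)$-dimensional secure linear network code over $\mathbb{F}_q$ on $G$ with rate $\omega-1$ and security level $r$, having the same local encoding kernels as $(Q^{(n)})^{-1}\cdot\mathcal{C}_n$ at all intermediate nodes. The algorithm uses at most $$O\big((n-1)^3|\mathscr{A}_r|+(n-1)|\mathscr{A}_r'|^2\big)$$ operations, where $\mathscr{A}_r'$ is the set of $A\in\mathscr{A}_r$ for which the $n-1$ vectors consisting of the $\omega-1$ chosen vectors and the truncated kernels $\vec f_e^{\,(n-1)}$, $e\in A$, are linearly dependent; here the $\omega-1$ chosen vectors are linearly independent vectors selected by the algorithm among $\vec b_1^{\,(n-1)},\dots,\vec b_\omega^{\,(n-1)}$.
   Context: Network. $G=(V,E)$ is a finite directed acyclic graph (parallel edges allowed, each edge of capacity 1) with a single source $s$ having no incoming edges in $E$, and a nonempty set of sink nodes $T\subseteq V\setminus\{s\}$ having no outgoing edges. $\mathrm{In}(v)$, $\mathrm{Out}(v)$ are the sets of incoming and outgoing edges of $v$. For an $n$-dimensional code, $\mathrm{In}(s)=\{d_1,\dots,d_n\}$ is a set of $n$ imaginary incoming edges of $s$ (not in $E$). $C_t$ is the minimum cut capacity between $s$ and $t$, and $C_{\min}=\min_{t\in T}C_t$. Intermediate nodes are those in $V\setminus(\{s\}\cup T)$. Linear network code. An $n$-dimensional $\mathbb{F}_q$-valued linear network code on $G$ is a collection $\mathcal{C}_n=\{K_v: v\in V\setminus T\}$ where $K_v=[k_{d,e}]_{d\in \mathrm{In}(v),e\in \mathrm{Out}(v)}$ is a matrix over $\mathbb{F}_q$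 (the local encoding kernel at $v$). Its global encoding kernels $\vec f_e^{\,(n)}\in\mathbb{F}_q^n$ are defined recursively by $\vec f_e^{\,(n)}=\sum_{d\in\mathrm{In}(\mathrm{tail}(e))}k_{d,e}\vec f_d^{\,(n)}$, where $\vec f_{d_1}^{\,(n)},\dots,\vec f_{d_n}^{\,(n)}$ is the standard basis of $\mathbb{F}_q^n$. With row-vector input $\mathbf{x}\in\mathbb{F}_q^n$, the symbol transmitted on $e$ is $\mathbf{x}\cdot\vec f_e^{\,(n)}$. The code is decodable if for every $t\in T$ the matrix $[\vec f_e^{\,(n)}:e\in\mathrm{In}(t)]$ has rank $n$. For an $m\times n$ matrix $Q$ over $\mathbb{F}_q$, $Q\cdot\mathcal{C}_n$ denotes the $m$-dimensional code with local encoding kernel $Q K_s$ at $s$ and $K_v$ at every other non-sink node $v$. Secure linear network code (SLNC). Let $n=\omega+r$. The source message $M$ is uniform on $\mathbb{F}_q^{\omega}$, the key $K$ is uniform on $\mathbb{F}_q^r$ and independent of $M$, and the input is $\mathbf{x}=(M\ \ K)$. Let $Y_e$ be the random symbol on edge $e$ and $Y_A=(Y_e:e\in A)$. An $n$-dimensional linear network code is an SLNC with rate $\omega$ and security level $r$ if every sink $t$ can recover $M$ from $(Y_e:e\in\mathrm{In}(t))$ with zero error, and $I(Y_A;M)=0$ for every $A\subseteq E$ with $|A|\le r$. Primary edge subsets. For $A\subseteq E$, a cut between $s$ and $A$ is a set of edges $C\subseteq E$ such that every directed path starting at $s$ whose last edge belongs to $A$ contains an edge of $C$ (edges of $A$ may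 be used in $C$); a minimum cut is one with the smallest number of edges. A minimum cut between $s$ and $A$ is primary if it is also a cut between $s$ and every minimum cut between $s$ and $A$ (such a minimum cut is unique). An edge subset $A$ is primary if $A$ is the primary minimum cut between $s$ and $A$ itself. $\mathscr{A}_r=\{A\subseteq E: A\text{ is primary and }|A|=r\}$. Truncation. $\vec b_i^{\,(n-1)}$, $\vec f_e^{\,(n-1)}$ denote the vectors of the first $n-1$ components of $\vec b_i^{\,(n)}$, $\vec f_e^{\,(n)}$. $\langle\cdot\rangle$ denotes linear span. Complexity convention. Each addition or multiplication in the finite field counts as one operation of cost $O(1)$ regardless of the field, and $|\mathrm{Out}(s)|$ is regarded as a fixed constant. *)

theory Defs
  imports
    "Graph_Theory.Arc_Walk"
    "Jordan_Normal_Form.Missing_VectorSpace"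
    "HOL-Probability.Probability"
begin

section \<open>Vectors and matrices over a field given by its carrier\<close>

text \<open>
  Fields are records of \<^theory>\<open>HOL-Algebra.Ring\<close>, not instances of the type class. A statement
  about all \<^typ>\<open>'f ring\<close> with infinite \<^typ>\<open>'f\<close> then speaks about all finite fields
  simultaneously, so that an algorithm and a hidden constant can be chosen before the field.
  Indices start at 0. A vector of length \<open>n\<close> is an element of \<open>{..<n} \<rightarrow>\<^sub>E carrier F\<close>, an
  \<open>m \<times> n\<close> matrix an element of \<open>{..<m} \<times> {..<n} \<rightarrow>\<^sub>E carrier F\<close>.
\<close>

abbreviation vec_sp :: "'f ring \<Rightarrow> nat \<Rightarrow> ('f, nat \<Rightarrow> 'f) module" where
  "vec_sp F n \<equiv> ring.func_space F {..<n}"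

abbreviation vecs :: "'f ring \<Rightarrow> nat \<Rightarrow> (nat \<Rightarrow> 'f) set" where
  "vecs F n \<equiv> {..<n} \<rightarrow>\<^sub>E carrier F"

definition unit_vector :: "'f ring \<Rightarrow> nat \<Rightarrow> nat \<Rightarrow> nat \<Rightarrow> 'f" where
  "unit_vector F n j = (\<lambda>i\<in>{..<n}. if i = j then \<one>\<^bsub>F\<^esub> else \<zero>\<^bsub>F\<^esub>)"

text \<open>Linear dependence of an indexed family; repeated vectors make a family dependent, which
  dependence of the underlying set would not see.\<close>

definition lin_dep_family :: "'f ring \<Rightarrow> nat \<Rightarrow> ('i \<Rightarrow> nat \<Rightarrow> 'f) \<Rightarrow> 'i set \<Rightarrow> bool" where
  "lin_dep_family F n v I \<longleftrightarrow>
     (\<exists>a\<in>I \<rightarrow> carrier F. (\<Oplus>\<^bsub>vec_sp F n\<^esub>i\<in>I. a i \<odot>\<^bsub>vec_sp F n\<^esub> v i) = \<zero>\<^bsub>vec_sp F n\<^esub>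
        \<and> (\<exists>i\<in>I. a i \<noteq> \<zero>\<^bsub>F\<^esub>))"

definition rank_of :: "'f ring \<Rightarrow> nat \<Rightarrow> (nat \<Rightarrow> 'f) set \<Rightarrow> nat" where
  "rank_of F n S = vectorspace.dim F ((vec_sp F n)\<lparr>carrier := module.span F (vec_sp F n) S\<rparr>)"

definition mat_col :: "nat \<Rightarrow> (nat \<times> nat \<Rightarrow> 'f) \<Rightarrow> nat \<Rightarrow> nat \<Rightarrow> 'f" where
  "mat_col m A j = (\<lambda>i\<in>{..<m}. A (i, j))"

definition mat_mult ::
  "'f ring \<Rightarrow> nat \<Rightarrow> nat \<Rightarrow> nat \<Rightarrow> (nat \<times> nat \<Rightarrow> 'f) \<Rightarrow> (nat \<times> nat \<Rightarrow> 'f) \<Rightarrow> nat \<times> nat \<Rightarrow> 'f" where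
  "mat_mult F m k n A B =
     (\<lambda>(i, j)\<in>{..<m} \<times> {..<n}. \<Oplus>\<^bsub>F\<^esub>l\<in>{..<k}. A (i, l) \<otimes>\<^bsub>F\<^esub> B (l, j))"

definition mat_monoid :: "'f ring \<Rightarrow> nat \<Rightarrow> (nat \<times> nat \<Rightarrow> 'f) monoid" where
  "mat_monoid F n =
     \<lparr>carrier = {..<n} \<times> {..<n} \<rightarrow>\<^sub>E carrier F,
      monoid.mult = mat_mult F n n n,
      one = (\<lambda>(i, j)\<in>{..<n} \<times> {..<n}. if i = j then \<one>\<^bsub>F\<^esub> else \<zero>\<^bsub>F\<^esub>)\<rparr>"

text \<open>The \<open>m \<times> (m + 1)\<close> matrix \<open>[I\<^sub>m \<ell>]\<close>.\<close>

definition id_append :: "'f ring \<Rightarrow> nat \<Rightarrow> (nat \<Rightarrow> 'f) \<Rightarrow> nat \<times> nat \<Rightarrow> 'f" where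
  "id_append F m l =
     (\<lambda>(i, j)\<in>{..<m} \<times> {..<Suc m}. if j = m then l i else if i = j then \<one>\<^bsub>F\<^esub> else \<zero>\<^bsub>F\<^esub>)"


section \<open>Networks and linear network codes\<close>

datatype 'e channel = Imag nat | Edge 'e

text \<open>\<open>C v d e\<close> is the entry \<open>k\<^sub>d\<^sub>,\<^sub>e\<close> of the local encoding kernel at \<open>v\<close>; only non-sink nodes \<open>v\<close>,
  \<open>d\<close> entering \<open>v\<close> and \<open>e\<close> leaving \<open>v\<close> matter.\<close>

type_synonym ('v, 'e, 'f) code = "'v \<Rightarrow> 'e channel \<Rightarrow> 'e \<Rightarrow> 'f"

lemma finsum_fundef_cong [fundef_cong]:
  assumes "A = B" "\<And>x. x \<in> B \<Longrightarrow> f x = g x" "M = N"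
  shows "finsum M f A = finsum N g B"
proof -
  have *: "(S, y) \<in> foldSetD D (h \<circ> k2) z"
    if "(S, y) \<in> foldSetD D (h \<circ> k1) z" "\<And>x. x \<in> S \<Longrightarrow> k1 x = k2 x"
    for S y and D :: "'b set" and h :: "'b \<Rightarrow> 'b \<Rightarrow> 'b" and k1 k2 :: "'a \<Rightarrow> 'b" and z
    using that
  proof (induction rule: foldSetD.induct)
    case emptyI
    then show ?case by (blast intro: foldSetD.emptyI)
  next
    case (insertI x S y)
    then have eq: "(h \<circ> k1) x y = (h \<circ> k2) x y" by simp
    then show ?case
      using insertI by (auto simp del: o_apply intro: foldSetD.insertI)
  qed
  have "(S, y) \<in> foldSetD D (h \<circ> f) z \<longleftrightarrow> (S, y) \<in> foldSetD D (h \<circ> g) z"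
    if "S = B" for S y and D :: "'b set" and h :: "'b \<Rightarrow> 'b \<Rightarrow> 'b" and z
    using *[of S y D h f z g] *[of S y D h g z f] assms(2) that by metis
  then show ?thesis
    using assms(1,3) by (simp add: finsum_def finprod_def foldD_def)
qed

locale network = fin_digraph G
  for G :: "('v, 'e) pre_digraph" +
  fixes s :: 'v and T :: "'v set"
  assumes source_vert: "s \<in> verts G"
    and source_in: "in_arcs G s = {}"
    and sinks_nonempty: "T \<noteq> {}"
    and sinks_verts: "T \<subseteq> verts G - {s}"
    and sinks_out: "\<And>t. t \<in> T \<Longrightarrow> out_arcs G t = {}"
    and acyclic_arcs: "acyclic (arcs_ends G)"
begin

definition In :: "nat \<Rightarrow> 'v \<Rightarrow> 'e channel set" where
  "In n v = (if v = s then Imag ` {..<n} else Edge ` in_arcs G v)"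

definition linear_code :: "'f ring \<Rightarrow> nat \<Rightarrow> ('v, 'e, 'f) code \<Rightarrow> bool" where
  "linear_code F n C \<longleftrightarrow>
     (\<forall>v\<in>verts G - T. \<forall>d\<in>In n v. \<forall>e\<in>out_arcs G v. C v d e \<in> carrier F)"

text \<open>The global encoding kernels; the guard \<open>e \<in> arcs G\<close> only serves termination.\<close>

function global_kernel :: "'f ring \<Rightarrow> nat \<Rightarrow> ('v, 'e, 'f) code \<Rightarrow> 'e \<Rightarrow> nat \<Rightarrow> 'f" where
  "global_kernel F n C e =
     (if e \<in> arcs G then
        (\<Oplus>\<^bsub>vec_sp F n\<^esub>d\<in>In n (tail G e).
           C (tail G e) d e \<odot>\<^bsub>vec_sp F n\<^esub>
             (case d of Imag j \<Rightarrow> unit_vector F n j | Edge d' \<Rightarrow> global_kernel F n C d'))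
      else \<zero>\<^bsub>vec_sp F n\<^esub>)"
  by pat_completeness auto
termination
proof (relation "inv_image (arcs_ends G) (\<lambda>(F, n, C, e). tail G e)")
  have "finite (arcs_ends G)"
    by (simp add: arcs_ends_def)
  then show "wf (inv_image (arcs_ends G) (\<lambda>(F, n, C, e). tail G e))"
    by (intro wf_inv_image finite_acyclic_wf acyclic_arcs)
qed (auto simp: In_def arcs_ends_conv in_arcs_def split: if_splits)

declare global_kernel.simps [simp del]

text \<open>The rank condition on \<open>[f\<^sub>e : e \<in> In(t)]\<close> at each sink.\<close>

definition decodable :: "'f ring \<Rightarrow> nat \<Rightarrow> ('v, 'e, 'f) code \<Rightarrow> bool" where
  "decodable F n C \<longleftrightarrow> (\<forall>t\<in>T. rank_of F n (global_kernel F n C ` in_arcs G t) = n)"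

text \<open>\<open>Q \<cdot> C\<close> for a matrix \<open>Q\<close> with \<open>n\<close> columns.\<close>

definition code_mult ::
  "'f ring \<Rightarrow> nat \<Rightarrow> (nat \<times> nat \<Rightarrow> 'f) \<Rightarrow> ('v, 'e, 'f) code \<Rightarrow> ('v, 'e, 'f) code" where
  "code_mult F n Q C = (\<lambda>v d e.
     if v = s then
       (case d of
          Imag i \<Rightarrow> (\<Oplus>\<^bsub>F\<^esub>j\<in>{..<n}. Q (i, j) \<otimes>\<^bsub>F\<^esub> C s (Imag j) e)
        | Edge d' \<Rightarrow> C v d e)
     else C v d e)"


subsection \<open>Secure linear network codes\<close>

definition source_input :: "nat \<Rightarrow> nat \<Rightarrow> (nat \<Rightarrow> 'f) \<times> (nat \<Rightarrow> 'f) \<Rightarrow> nat \<Rightarrow> 'f" where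
  "source_input w r = (\<lambda>(M, K). \<lambda>i\<in>{..<w + r}. if i < w then M i else K (i - w))"

definition symbols ::
  "'f ring \<Rightarrow> nat \<Rightarrow> nat \<Rightarrow> ('v, 'e, 'f) code \<Rightarrow> 'e set \<Rightarrow> (nat \<Rightarrow> 'f) \<times> (nat \<Rightarrow> 'f) \<Rightarrow> 'e \<Rightarrow> 'f" where
  "symbols F w r C A MK =
     (\<lambda>e\<in>A. \<Oplus>\<^bsub>F\<^esub>i\<in>{..<w + r}. source_input w r MK i \<otimes>\<^bsub>F\<^esub> global_kernel F (w + r) C e i)"

text \<open>The message and the key are the two projections of this probability space.\<close>

definition source_space :: "'f ring \<Rightarrow> nat \<Rightarrow> nat \<Rightarrow> ((nat \<Rightarrow> 'f) \<times> (nat \<Rightarrow> 'f)) measure" where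
  "source_space F w r =
     uniform_count_measure (vecs F w) \<Otimes>\<^sub>M uniform_count_measure (vecs F r)"

definition slnc :: "'f ring \<Rightarrow> nat \<Rightarrow> nat \<Rightarrow> ('v, 'e, 'f) code \<Rightarrow> bool" where
  "slnc F w r C \<longleftrightarrow>
     linear_code F (w + r) C \<and>
     (\<forall>t\<in>T. \<exists>decoder. \<forall>M\<in>vecs F w. \<forall>K\<in>vecs F r.
        decoder (symbols F w r C (in_arcs G t) (M, K)) = M) \<and>
     (\<forall>A\<subseteq>arcs G. card A \<le> r \<longrightarrow>
        prob_space.mutual_information (source_space F w r) 2
          (count_space (symbols F w r C A ` space (source_space F w r)))
          (count_space (fst ` space (source_space F w r)))
          (symbols F w r C A) fst = 0)"


subsection \<open>Cuts and primary edge subsets\<close>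

definition sink_cut :: "'v \<Rightarrow> 'e set \<Rightarrow> bool" where
  "sink_cut t X \<longleftrightarrow> X \<subseteq> arcs G \<and> (\<forall>p. awalk s p t \<longrightarrow> set p \<inter> X \<noteq> {})"

definition min_cut_capacity :: "'v \<Rightarrow> nat" where
  "min_cut_capacity t = (LEAST k. \<exists>X. sink_cut t X \<and> card X = k)"

definition C_min :: nat where
  "C_min = Min (min_cut_capacity ` T)"

definition edge_cut :: "'e set \<Rightarrow> 'e set \<Rightarrow> bool" where
  "edge_cut A X \<longleftrightarrow> X \<subseteq> arcs G \<and>
     (\<forall>p v. awalk s p v \<and> p \<noteq> [] \<and> last p \<in> A \<longrightarrow> set p \<inter> X \<noteq> {})"

definition min_edge_cut :: "'e set \<Rightarrow> 'e set \<Rightarrow> bool" where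
  "min_edge_cut A X \<longleftrightarrow> edge_cut A X \<and> (\<forall>Y. edge_cut A Y \<longrightarrow> card X \<le> card Y)"

definition primary_min_cut :: "'e set \<Rightarrow> 'e set \<Rightarrow> bool" where
  "primary_min_cut A X \<longleftrightarrow>
     min_edge_cut A X \<and> (\<forall>Y. min_edge_cut A Y \<longrightarrow> edge_cut Y X)"

definition primary_sets :: "nat \<Rightarrow> 'e set set" where
  "primary_sets r = {A. A \<subseteq> arcs G \<and> primary_min_cut A A \<and> card A = r}"

end


section \<open>Algorithms\<close>

text \<open>
  Algorithms are algebraic computation trees over a store of field elements. A tree contains no
  field elements, only addresses: the field is accessible solely through the operations below and
  through equality tests, and one and the same tree runs over every field. Every operation on
  field elements is charged, including inversions, constants and equality tests; handling of
  indices, edges and sets of edges is not.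
  \<open>Fresh xs\<close> yields some field element different from the contents of the addresses \<open>xs\<close>
  (\<open>\<zero>\<close> if there is none). Going through \<open>xs\<close> once to mark the elements that occur,
  among the first \<open>length xs + 1\<close> elements of the field, and then looking for an unmarked one
  takes a number of steps linear in \<open>length xs + 1\<close>, which is what is charged.

  With \<open>|Out(s)|\<close> a constant, multiplying the source kernel by \<open>[I \<ell>]\<close> costs \<open>O(n - 1)\<close>, which
  \<open>(n - 1)\<^sup>3 |\<A>\<^sub>r|\<close> absorbs (\<open>\<A>\<^sub>r\<close> is nonempty for \<open>r < C\<^sub>m\<^sub>i\<^sub>n\<close>). A hidden constant depending on
  \<open>|Out(s)|\<close> would absorb all powers of \<open>n\<close>, since \<open>n \<le> |Out(s)|\<close>; the theorem therefore has a universal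
  constant and the summand \<open>(n - 1) |Out(s)|\<close>, which is stronger.
\<close>

datatype 'x field_op =
    Zero | One | Add 'x 'x | Sub 'x 'x | Mult 'x 'x | Inverse 'x | Fresh "'x list"

fun op_value :: "'f ring \<Rightarrow> ('x \<Rightarrow> 'f) \<Rightarrow> 'x field_op \<Rightarrow> 'f" where
  "op_value F \<sigma> Zero = \<zero>\<^bsub>F\<^esub>"
| "op_value F \<sigma> One = \<one>\<^bsub>F\<^esub>"
| "op_value F \<sigma> (Add x y) = \<sigma> x \<oplus>\<^bsub>F\<^esub> \<sigma> y"
| "op_value F \<sigma> (Sub x y) = \<sigma> x \<ominus>\<^bsub>F\<^esub> \<sigma> y"
| "op_value F \<sigma> (Mult x y) = \<sigma> x \<otimes>\<^bsub>F\<^esub> \<sigma> y"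
| "op_value F \<sigma> (Inverse x) = (if \<sigma> x = \<zero>\<^bsub>F\<^esub> then \<zero>\<^bsub>F\<^esub> else inv\<^bsub>F\<^esub> (\<sigma> x))"
| "op_value F \<sigma> (Fresh xs) =
     (if carrier F \<subseteq> \<sigma> ` set xs then \<zero>\<^bsub>F\<^esub> else (SOME a. a \<in> carrier F - \<sigma> ` set xs))"

fun op_cost :: "'x field_op \<Rightarrow> nat" where
  "op_cost (Fresh xs) = length xs + 1"
| "op_cost _ = 1"

text \<open>\<open>Kernel v d e\<close>, \<open>Global e i\<close> and \<open>QEntry i j\<close> address the entries of the given local kernels,
  global kernels and matrix \<open>Q\<close>; the \<open>k\<close>-th operation performed writes its result to \<open>Temp k\<close>.\<close>

datatype ('v, 'e) address = Kernel 'v "'e channel" 'e | Global 'e nat | QEntry nat nat | Temp nat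

datatype ('x, 'r) comp_tree =
    Return 'r
  | Compute "'x field_op" "'x \<Rightarrow> ('x, 'r) comp_tree"
  | Test 'x 'x "bool \<Rightarrow> ('x, 'r) comp_tree"

text \<open>\<open>run F t \<sigma> k\<close> gives the result, the final store and the cost of \<open>t\<close> started in store \<open>\<sigma>\<close> with
  \<open>Temp k\<close> the next address to be written.\<close>

primrec run ::
  "'f ring \<Rightarrow> (('v, 'e) address, 'r) comp_tree \<Rightarrow> (('v, 'e) address \<Rightarrow> 'f) \<Rightarrow> nat \<Rightarrow>
     'r \<times> (('v, 'e) address \<Rightarrow> 'f) \<times> nat" where
  "run F (Return x) \<sigma> k = (x, \<sigma>, 0)"
| "run F (Compute p t) \<sigma> k =
     (let (x, \<sigma>', c) = run F (t (Temp k)) (\<sigma>(Temp k := op_value F \<sigma> p)) (Suc k)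
      in (x, \<sigma>', c + op_cost p))"
| "run F (Test x y t) \<sigma> k =
     (let (z, \<sigma>', c) = run F (t (\<sigma> x = \<sigma> y)) \<sigma> k in (z, \<sigma>', c + 1))"

definition (in network) input_store ::
  "'f ring \<Rightarrow> nat \<Rightarrow> ('v, 'e, 'f) code \<Rightarrow> (nat \<times> nat \<Rightarrow> 'f) \<Rightarrow> ('v, 'e) address \<Rightarrow> 'f" where
  "input_store F n C Q x =
     (case x of
        Kernel v d e \<Rightarrow> C v d e
      | Global e i \<Rightarrow> global_kernel F n C e i
      | QEntry i j \<Rightarrow> Q (i, j)
      | Temp k \<Rightarrow> \<zero>\<^bsub>F\<^esub>)"

text \<open>Output: the indices of the chosen vectors, the addresses of the entries of \<open>\<ell>\<close>, of the new
  kernel at the source and of the new matrix \<open>Q\<close>, and for each column of the latter the index of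
  the column of \<open>[I \<ell>] Q\<close> it is.\<close>

record ('v, 'e) reduction =
  chosen :: "nat set"
  ell_at :: "nat \<Rightarrow> ('v, 'e) address"
  kernel_at :: "nat \<Rightarrow> 'e \<Rightarrow> ('v, 'e) address"
  column :: "nat \<Rightarrow> nat"
  Q_at :: "nat \<Rightarrow> nat \<Rightarrow> ('v, 'e) address"

type_synonym ('v, 'e) rate_reduction_algorithm =
  "('v, 'e) pre_digraph \<Rightarrow> 'v \<Rightarrow> 'v set \<Rightarrow> nat \<Rightarrow> nat \<Rightarrow> 'e set set \<Rightarrow>
     (('v, 'e) address, ('v, 'e) reduction) comp_tree"

text \<open>\<open>dependent_sets\<close> is \<open>\<A>'\<^sub>r\<close> for the chosen indices \<open>J\<close>: truncation keeps the first \<open>m\<close> components of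
  vectors of length \<open>n = m + 1\<close>.\<close>

definition (in network) dependent_sets ::
  "'f ring \<Rightarrow> nat \<Rightarrow> nat \<Rightarrow> ('v, 'e, 'f) code \<Rightarrow> (nat \<times> nat \<Rightarrow> 'f) \<Rightarrow> nat set \<Rightarrow> 'e set set" where
  "dependent_sets F w r C Q J =
     {A \<in> primary_sets r.
        lin_dep_family F (w + r - 1)
          (case_sum (\<lambda>i. restrict (mat_col (w + r) Q i) {..<w + r - 1})
                    (\<lambda>e. restrict (global_kernel F (w + r) C e) {..<w + r - 1}))
          (J <+> A)}"

end

(*
  Everything is dualised. Let b_j be the columns of Q, f_e the global kernels, and m = n - 1. Security
  against A means that there are functionals y_i (i < w) with y_i(b_j) = delta_ij that vanish on all
  f_e, e in A: then every message M has a key K0(M) for which all symbols on A vanish, the symbols for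
  (M, K) are those for (0, K - K0(M)), and they are independent of M. A functional vanishing on a cut
  vanishes on everything behind it, and every A with |A| <= r is cut off by a primary set of size r,
  so that only these sets matter.

  The functionals of the shortened code, composed with [I l], are the functionals on F^n that vanish
  at v = (l, -1). If h_A vanishes on the w - 1 chosen columns and on f_e, e in A, but not at v, then
  y_i - (y_i(v) / h_A(v)) h_A are such functionals, and the shortened code is secure against A. The
  algorithm computes h_A by elimination as a null vector of m vectors in F^n, and then fixes the
  coordinates of l one at a time. At each step every A excludes at most one value, the one that would
  make the part of h_A(v) fixed so far vanish; as q > |A_r|, a value is left.
*)
theory Submission
  imports Defs
begin

section \<open>Linear algebra over a field given by its carrier\<close>

text \<open>Two columns of \<open>Q\<close> have to be singled out, one among the first
  \<open>w\<close> that is not chosen and one that the new matrix omits, and the latter must be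
  invertible. Both choices rest on one fact: \<open>[I l] Q\<close> has a one-dimensional kernel,
  spanned by some \<open>z\<close>, and deleting column \<open>i\<close> leaves an invertible matrix
  as soon as \<open>z i\<close> is nonzero. For \<open>l = 0\<close> the matrix is the truncation of
  \<open>Q\<close>; this case yields the \<open>w - 1\<close> chosen columns before \<open>l\<close>
  is known. For the final \<open>l\<close> the deleted column has to lie outside the chosen ones.
  Any \<open>h_A\<close> ensures that this is possible: \<open>Q z\<close> is a nonzero multiple of
  \<open>v\<close>, so the sum of all \<open>h_A(b_j) z j\<close> is nonzero, while the chosen
  \<open>j\<close> contribute nothing to it. This uses that at least one primary set of size
  \<open>r\<close> exists, which is a discrete continuity argument on minimum cuts. That
  \<open>h_A\<close> is nonzero is enough for the choice of \<open>l\<close>: since \<open>v\<close>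
  ends in -1, \<open>h_A(v)\<close> is an affine form in the coordinates of \<open>l\<close>, with
  constant term minus the last coefficient of \<open>h_A\<close>, and it does not vanish
  identically.\<close>

locale coeff_field = field F for F :: "'f ring" (structure)
begin

section \<open>The standard bilinear form on vectors over \<open>F\<close>\<close>

definition dot :: "nat \<Rightarrow> (nat \<Rightarrow> 'f) \<Rightarrow> (nat \<Rightarrow> 'f) \<Rightarrow> 'f" where
  "dot n x y = (\<Oplus>i\<in>{..<n}. x i \<otimes> y i)"

text \<open>\<open>Pi\<close> instead of the extensional \<open>PiE\<close>: a vector of length
  \<open>Suc m\<close> then also counts as one of length \<open>m\<close>, and the results of
  pointwise arithmetic need not be restricted.\<close>

abbreviation pvec :: "nat \<Rightarrow> (nat \<Rightarrow> 'f) set" where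
  "pvec n \<equiv> Pi {..<n} (\<lambda>_. carrier F)"

lemma dot_closed [simp, intro]: "x \<in> pvec n \<Longrightarrow> y \<in> pvec n \<Longrightarrow> dot n x y \<in> carrier F"
  unfolding dot_def by (intro finsum_closed) auto

lemma dot_0 [simp]: "dot 0 x y = \<zero>"
  by (simp add: dot_def)

lemma dot_Suc: "x \<in> pvec (Suc n) \<Longrightarrow> y \<in> pvec (Suc n) \<Longrightarrow> dot (Suc n) x y = dot n x y \<oplus> x n \<otimes> y n"
  unfolding dot_def lessThan_Suc by (subst finsum_insert) (auto simp: Pi_iff a_comm)

lemma dot_cong:
  assumes "\<And>i. i < n \<Longrightarrow> x i = x' i" "\<And>i. i < n \<Longrightarrow> y i = y' i"
  shows "dot n x y = dot n x' y'"
  unfolding dot_def by (rule finsum_fundef_cong) (use assms in auto)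

lemma dot_comm: "x \<in> pvec n \<Longrightarrow> y \<in> pvec n \<Longrightarrow> dot n x y = dot n y x"
proof (induction n)
  case (Suc n)
  then have "x n \<in> carrier F" "y n \<in> carrier F" "x \<in> pvec n" "y \<in> pvec n"
    by (auto simp: Pi_iff)
  with Suc show ?case by (simp add: dot_Suc m_comm)
qed simp

lemma dot_zero_left: "y \<in> pvec n \<Longrightarrow> (\<And>i. i < n \<Longrightarrow> x i = \<zero>) \<Longrightarrow> dot n x y = \<zero>"
proof (induction n)
  case (Suc n)
  then have "x \<in> pvec (Suc n)" "y \<in> pvec n" "y n \<in> carrier F" by (auto simp: Pi_iff)
  with Suc show ?case by (simp add: dot_Suc)
qed simp

lemma dot_zero_right: "x \<in> pvec n \<Longrightarrow> (\<And>i. i < n \<Longrightarrow> y i = \<zero>) \<Longrightarrow> dot n x y = \<zero>"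
  by (subst dot_comm) (auto intro: dot_zero_left)

lemma dot_add_left:
  "\<lbrakk>x \<in> pvec n; y \<in> pvec n; z \<in> pvec n\<rbrakk> \<Longrightarrow> dot n (\<lambda>i. x i \<oplus> y i) z = dot n x z \<oplus> dot n y z"
proof (induction n)
  case (Suc n)
  then have c: "x n \<in> carrier F" "y n \<in> carrier F" "z n \<in> carrier F" "x \<in> pvec n" "y \<in> pvec n" "z \<in> pvec n"
    "(\<lambda>i. x i \<oplus> y i) \<in> pvec (Suc n)"
    by (auto simp: Pi_iff)
  then show ?case
    using Suc by (simp add: dot_Suc l_distr a_ac)
qed simp

lemma dot_smult_left:
  "\<lbrakk>a \<in> carrier F; x \<in> pvec n; z \<in> pvec n\<rbrakk> \<Longrightarrow> dot n (\<lambda>i. a \<otimes> x i) z = a \<otimes> dot n x z"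
proof (induction n)
  case (Suc n)
  then have c: "x n \<in> carrier F" "z n \<in> carrier F" "x \<in> pvec n" "z \<in> pvec n" "(\<lambda>i. a \<otimes> x i) \<in> pvec (Suc n)"
    by (auto simp: Pi_iff)
  then show ?case
    using Suc by (simp add: dot_Suc r_distr m_assoc)
qed simp

lemma dot_add_right:
  "\<lbrakk>x \<in> pvec n; y \<in> pvec n; z \<in> pvec n\<rbrakk> \<Longrightarrow> dot n z (\<lambda>i. x i \<oplus> y i) = dot n z x \<oplus> dot n z y"
  using dot_add_left[of x n y z] dot_comm[of z n] by (auto simp: Pi_iff)

lemma dot_smult_right:
  "\<lbrakk>a \<in> carrier F; x \<in> pvec n; z \<in> pvec n\<rbrakk> \<Longrightarrow> dot n z (\<lambda>i. a \<otimes> x i) = a \<otimes> dot n z x"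
  using dot_smult_left[of a x n z] dot_comm[of z n] by (auto simp: Pi_iff)

lemma dot_sub_left:
  assumes "a \<in> carrier F" "x \<in> pvec n" "y \<in> pvec n" "z \<in> pvec n"
  shows "dot n (\<lambda>i. x i \<ominus> a \<otimes> y i) z = dot n x z \<ominus> a \<otimes> dot n y z"
proof -
  have "dot n (\<lambda>i. x i \<ominus> a \<otimes> y i) z = dot n (\<lambda>i. x i \<oplus> (\<ominus> a) \<otimes> y i) z"
    using assms by (intro dot_cong) (auto simp: a_minus_def l_minus Pi_iff)
  also have "\<dots> = dot n x z \<oplus> (\<ominus> a) \<otimes> dot n y z"
    using assms by (subst dot_add_left) (auto simp: dot_smult_left Pi_iff)
  finally show ?thesis
    using assms by (simp add: a_minus_def l_minus)
qed

lemma dot_sub_right: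
  assumes "a \<in> carrier F" "x \<in> pvec n" "y \<in> pvec n" "z \<in> pvec n"
  shows "dot n z (\<lambda>i. x i \<ominus> a \<otimes> y i) = dot n z x \<ominus> a \<otimes> dot n z y"
  using dot_sub_left[OF assms] dot_comm[of z n] assms by (auto simp: Pi_iff)

lemma dot_delta:
  assumes "k < n" "x \<in> pvec n"
  shows "dot n x (\<lambda>i. if i = k then \<one> else \<zero>) = x k"
  using assms
proof (induction n)
  case (Suc n)
  have "(\<lambda>i. if i = k then \<one> else \<zero>) \<in> pvec (Suc n)" by auto
  then have "dot (Suc n) x (\<lambda>i. if i = k then \<one> else \<zero>)
     = dot n x (\<lambda>i. if i = k then \<one> else \<zero>) \<oplus> x n \<otimes> (if n = k then \<one> else \<zero>)"
    using Suc.prems by (simp add: dot_Suc)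
  moreover have "k = n \<Longrightarrow> dot n x (\<lambda>i. if i = k then \<one> else \<zero>) = \<zero>"
    using Suc.prems by (intro dot_zero_right) auto
  ultimately show ?case
    using Suc by (cases "k = n") (auto simp: Pi_iff)
qed simp

lemma dot_delta_left:
  assumes "k < n" "x \<in> pvec n"
  shows "dot n (\<lambda>i. if i = k then \<one> else \<zero>) x = x k"
  using dot_delta[OF assms] dot_comm[of x n "\<lambda>i. if i = k then \<one> else \<zero>"] assms by auto

text \<open>The scalar \<open>y L x\<close> evaluated in either order, for a matrix
  \<open>L\<close>. Every transfer of a functional through a matrix below is an instance.\<close>

lemma dot_assoc:
  assumes "y \<in> pvec m" "x \<in> pvec n" "\<And>i j. i < m \<Longrightarrow> j < n \<Longrightarrow> L i j \<in> carrier F"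
  shows "dot n (\<lambda>j. dot m y (\<lambda>i. L i j)) x = dot m y (\<lambda>i. dot n (L i) x)"
  using assms
proof (induction m)
  case 0
  then show ?case by (auto intro: dot_zero_left)
next
  case (Suc m)
  have c: "y m \<in> carrier F" "y \<in> pvec m" "L m \<in> pvec n" "(\<lambda>j. dot m y (\<lambda>i. L i j)) \<in> pvec n"
    using Suc.prems by (auto intro!: dot_closed)
  have "dot n (\<lambda>j. dot (Suc m) y (\<lambda>i. L i j)) x = dot n (\<lambda>j. dot m y (\<lambda>i. L i j) \<oplus> y m \<otimes> L m j) x"
    using Suc.prems by (intro dot_cong) (auto simp: dot_Suc)
  also have "\<dots> = dot n (\<lambda>j. dot m y (\<lambda>i. L i j)) x \<oplus> y m \<otimes> dot n (L m) x"
    using Suc.prems c by (subst dot_add_left) (auto simp: dot_smult_left)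
  also have "\<dots> = dot m y (\<lambda>i. dot n (L i) x) \<oplus> y m \<otimes> dot n (L m) x"
    using Suc c by simp
  also have "\<dots> = dot (Suc m) y (\<lambda>i. dot n (L i) x)"
    using Suc.prems by (subst dot_Suc) auto
  finally show ?case .
qed

section \<open>The vector space of vectors of length \<open>n\<close>, and orthogonality\<close>

lemma vecs_pvec: "x \<in> vecs F n \<Longrightarrow> x \<in> pvec n"
  by (auto simp: PiE_iff)

lemma carrier_vec_sp: "carrier (vec_sp F n) = vecs F n"
  by (simp add: func_space_def)

lemma vec_sp_simps:
  "\<zero>\<^bsub>vec_sp F n\<^esub> = (\<lambda>i\<in>{..<n}. \<zero>)"
  "x \<oplus>\<^bsub>vec_sp F n\<^esub> y = (\<lambda>i\<in>{..<n}. x i \<oplus> y i)"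
  "a \<odot>\<^bsub>vec_sp F n\<^esub> x = (\<lambda>i\<in>{..<n}. a \<otimes> x i)"
  by (simp_all add: func_space_def)

lemma vec_sp_module: "module F (vec_sp F n)"
  by (rule func_space_is_module)

lemma vec_sp_vectorspace: "vectorspace F (vec_sp F n)"
  using vec_sp_module field_axioms by (simp add: vectorspace_def)

lemma finsum_vec_sp:
  assumes "finite I" "f \<in> I \<rightarrow> vecs F n"
  shows "finsum (vec_sp F n) f I = (\<lambda>k\<in>{..<n}. \<Oplus>i\<in>I. f i k)"
  using assms
proof (induction I rule: finite_induct)
  case empty
  interpret V: module F "vec_sp F n" by (rule vec_sp_module)
  show ?case by (simp add: vec_sp_simps)
next
  case (insert x I)
  interpret V: module F "vec_sp F n" by (rule vec_sp_module)
  have "finsum (vec_sp F n) f (insert x I) = f x \<oplus>\<^bsub>vec_sp F n\<^esub> finsum (vec_sp F n) f I"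
    using insert by (subst V.M.finsum_insert) (auto simp: carrier_vec_sp Pi_iff)
  also have "\<dots> = (\<lambda>k\<in>{..<n}. \<Oplus>i\<in>insert x I. f i k)"
    unfolding vec_sp_simps using insert
    by (intro restrict_ext) (subst finsum_insert, auto simp: PiE_iff)
  finally show ?case .
qed

lemma submodule_perp: "y \<in> pvec n \<Longrightarrow> submodule F {x \<in> vecs F n. dot n y x = \<zero>} (vec_sp F n)"
proof -
  assume y: "y \<in> pvec n"
  interpret V: module F "vec_sp F n" by (rule vec_sp_module)
  have r: "dot n y (restrict f {..<n}) = dot n y f" for f
    by (rule dot_cong) auto
  show ?thesis
  proof (rule submodule.intro)
    show "{x \<in> vecs F n. dot n y x = \<zero>} \<subseteq> carrier (vec_sp F n)" by (auto simp: carrier_vec_sp)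
    show "module F (vec_sp F n)" by (rule vec_sp_module)
    show "\<zero>\<^bsub>vec_sp F n\<^esub> \<in> {x \<in> vecs F n. dot n y x = \<zero>}"
      using y by (auto simp: vec_sp_simps r intro: dot_zero_right)
  next
    fix u v assume "u \<in> {x \<in> vecs F n. dot n y x = \<zero>}" "v \<in> {x \<in> vecs F n. dot n y x = \<zero>}"
    then show "u \<oplus>\<^bsub>vec_sp F n\<^esub> v \<in> {x \<in> vecs F n. dot n y x = \<zero>}"
      using y by (auto simp: vec_sp_simps r dot_add_right vecs_pvec PiE_iff)
  next
    fix a u assume "a \<in> carrier F" "u \<in> {x \<in> vecs F n. dot n y x = \<zero>}"
    then show "a \<odot>\<^bsub>vec_sp F n\<^esub> u \<in> {x \<in> vecs F n. dot n y x = \<zero>}"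
      using y by (auto simp: vec_sp_simps r dot_smult_right vecs_pvec PiE_iff)
  qed
qed

text \<open>The kernel of a functional is a submodule, hence contains the span of any set that it
  contains.\<close>

lemma span_perp:
  assumes "y \<in> pvec n" "S \<subseteq> vecs F n" "\<And>x. x \<in> S \<Longrightarrow> dot n y x = \<zero>" "z \<in> module.span F (vec_sp F n) S"
  shows "dot n y z = \<zero>"
proof -
  interpret V: module F "vec_sp F n" by (rule vec_sp_module)
  have "V.span S \<subseteq> {x \<in> vecs F n. dot n y x = \<zero>}"
    using assms by (intro V.span_is_subset submodule_perp) auto
  with assms show ?thesis by auto
qed

subsection \<open>Null spaces\<close>

text \<open>
  Invariant of the elimination that intersects the orthogonal spaces of the vectors \<open>xs\<close> one after the
  other: \<open>ms\<close> lists the coordinates not yet used up, and \<open>V i\<close>, \<open>i \<in> set ms\<close>, is the null vector that is the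
  \<open>i\<close>-th unit vector on \<open>ms\<close>. The span clause is what yields separating functionals.
\<close>

definition null_basis :: "nat \<Rightarrow> (nat \<Rightarrow> 'f) list \<Rightarrow> nat list \<Rightarrow> (nat \<Rightarrow> nat \<Rightarrow> 'f) \<Rightarrow> bool" where
  "null_basis d xs ms V \<longleftrightarrow>
     distinct ms \<and> set ms \<subseteq> {..<d} \<and> (\<forall>i\<in>set ms. V i \<in> pvec d) \<and>
     (\<forall>i\<in>set ms. \<forall>j\<in>set ms. V i j = (if i = j then \<one> else \<zero>)) \<and>
     (\<forall>x\<in>set xs. \<forall>i\<in>set ms. dot d (V i) x = \<zero>) \<and>
     (\<forall>y\<in>vecs F d. (\<forall>i\<in>set ms. dot d (V i) y = \<zero>) \<longrightarrow> y \<in> module.span F (vec_sp F d) (set xs)) \<and>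
     d \<le> length ms + length xs"

lemma null_basis_Nil: "null_basis d [] [0..<d] (\<lambda>i j. if i = j then \<one> else \<zero>)"
proof -
  interpret V: vectorspace F "vec_sp F d" by (rule vec_sp_vectorspace)
  have *: "y \<in> V.span {}" if y: "y \<in> vecs F d" and 0: "\<forall>i\<in>{..<d}. dot d (\<lambda>j. if i = j then \<one> else \<zero>) y = \<zero>" for y
  proof -
    have "y i = \<zero>" if "i < d" for i
      using 0 dot_delta_left[OF that vecs_pvec[OF y]] that by (auto simp: eq_commute)
    then have "y = (\<lambda>i\<in>{..<d}. \<zero>)"
      using y by (intro extensionalityI[of _ "{..<d}"]) (auto simp: PiE_iff)
    then show ?thesis by (simp add: V.span_empty vec_sp_simps)
  qed
  show ?thesis
    unfolding null_basis_def using * by (auto simp: atLeast0LessThan)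
qed

text \<open>If all null vectors are already orthogonal to \<open>x\<close>, no coordinate is used
  up; the span clause survives because spans are monotone.\<close>

lemma null_basis_skip:
  assumes "null_basis d xs ms V" "x \<in> vecs F d" "set xs \<subseteq> vecs F d" "\<And>i. i \<in> set ms \<Longrightarrow> dot d (V i) x = \<zero>"
  shows "null_basis d (x # xs) ms V"
proof -
  interpret V: vectorspace F "vec_sp F d" by (rule vec_sp_vectorspace)
  show ?thesis
    using assms V.span_is_monotone[of "set xs" "set (x # xs)"] unfolding null_basis_def
    by (auto simp: subset_insertI)
qed

text \<open>Subtracting from every other \<open>V i\<close> the multiple of \<open>V p\<close> that
  makes it kill \<open>x\<close> uses up the coordinate \<open>p\<close> and nothing else.\<close>

lemma null_basis_pivot:
  assumes nb: "null_basis d xs ms V" and x: "x \<in> vecs F d" and xs: "set xs \<subseteq> vecs F d"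
    and p: "p \<in> set ms" "dot d (V p) x \<noteq> \<zero>"
    and V': "\<And>i j. i \<in> set ms \<Longrightarrow> j < d \<Longrightarrow> i \<noteq> p \<Longrightarrow> V' i j = V i j \<ominus> (dot d (V i) x \<otimes> inv (dot d (V p) x)) \<otimes> V p j"
  shows "null_basis d (x # xs) (remove1 p ms) V'"
proof -
  interpret V: vectorspace F "vec_sp F d" by (rule vec_sp_vectorspace)
  define t where "t i = dot d (V i) x \<otimes> inv (dot d (V p) x)" for i
  have dist: "distinct ms" and sub: "set ms \<subseteq> {..<d}" and len: "d \<le> length ms + length xs"
    using nb unfolding null_basis_def by - (elim conjE, assumption)+
  have cl: "V i \<in> pvec d" if "i \<in> set ms" for i
    using nb that unfolding null_basis_def by (elim conjE) (erule (1) bspec)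
  have mk: "V i j = (if i = j then \<one> else \<zero>)" if "i \<in> set ms" "j \<in> set ms" for i j
    using nb that unfolding null_basis_def by (elim conjE) (drule (1) bspec, drule (1) bspec, assumption)
  have pp: "dot d (V i) z = \<zero>" if "i \<in> set ms" "z \<in> set xs" for i z
    using nb that unfolding null_basis_def by blast
  have E2: "y \<in> V.span (set xs)" if "y \<in> vecs F d" "\<And>i. i \<in> set ms \<Longrightarrow> dot d (V i) y = \<zero>" for y
    using nb that unfolding null_basis_def by blast
  have cx: "x \<in> pvec d" by (rule vecs_pvec[OF x])
  have dU: "dot d (V p) x \<in> Units F" using p cl cx by (simp add: field_Units)
  have ct: "t i \<in> carrier F" if "i \<in> set ms" for i
    unfolding t_def using that cl cx dU by auto
  have V't: "V' i j = V i j \<ominus> t i \<otimes> V p j" if "i \<in> set ms" "j < d" "i \<noteq> p" for i j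
    using V'[OF that] by (simp add: t_def)
  have dot': "dot d (V' i) z = dot d (V i) z \<ominus> t i \<otimes> dot d (V p) z"
    if "i \<in> set ms" "i \<noteq> p" "z \<in> pvec d" for i z
  proof -
    have "dot d (V' i) z = dot d (\<lambda>j. V i j \<ominus> t i \<otimes> V p j) z"
      by (rule dot_cong) (use that V't in auto)
    then show ?thesis using that p cl ct by (simp add: dot_sub_left)
  qed
  have ms': "set (remove1 p ms) = set ms - {p}" using dist by simp
  have tx: "t i \<otimes> dot d (V p) x = dot d (V i) x" if "i \<in> set ms" for i
    unfolding t_def using that cl cx dU p by (simp add: m_assoc)
  have span': "y \<in> V.span (set (x # xs))"
    if y: "y \<in> vecs F d" and 0: "\<And>i. i \<in> set ms - {p} \<Longrightarrow> dot d (V' i) y = \<zero>" for y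
  proof -
    \<comment> \<open>This coefficient makes \<open>V p\<close> kill \<open>y - c x\<close>. The
      other \<open>V i\<close> kill it too, because \<open>V' i\<close> kills \<open>y\<close>, so
      the old span clause puts \<open>y - c x\<close> into the span of \<open>xs\<close>.\<close>
    define c where "c = dot d (V p) y \<otimes> inv (dot d (V p) x)"
    define y' where "y' = (\<lambda>j\<in>{..<d}. y j \<ominus> c \<otimes> x j)"
    have cy: "y \<in> pvec d" by (rule vecs_pvec[OF y])
    have cc: "c \<in> carrier F" unfolding c_def using cl cy dU p by auto
    have y': "y' \<in> vecs F d" unfolding y'_def using cy cx cc by (auto simp: Pi_iff)
    have doty': "dot d (V i) y' = dot d (V i) y \<ominus> c \<otimes> dot d (V i) x" if "i \<in> set ms" for i
    proof -
      have "dot d (V i) y' = dot d (V i) (\<lambda>j. y j \<ominus> c \<otimes> x j)"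
        by (rule dot_cong) (auto simp: y'_def)
      then show ?thesis using that cl cy cx cc by (simp add: dot_sub_right)
    qed
    have "dot d (V i) y' = \<zero>" if i: "i \<in> set ms" for i
    proof (cases "i = p")
      case True
      then show ?thesis using doty'[OF i] cl[OF i] cy cx dU
        by (simp add: c_def m_assoc a_minus_def r_neg)
    next
      case False
      have "dot d (V i) y = t i \<otimes> dot d (V p) y"
        using 0[of i] dot'[OF i False cy] i False cl p ct cy by simp
      also have "\<dots> = c \<otimes> dot d (V i) x"
        unfolding t_def c_def using i p cl cx cy dU by (simp add: m_ac)
      finally show ?thesis using doty'[OF i] i cl cx cc by (simp add: a_minus_def r_neg)
    qed
    then have "y' \<in> V.span (set xs)" using E2 y' by blast
    then have "y' \<in> V.span (set (x # xs))" using V.span_is_monotone[of "set xs" "set (x#xs)"] by auto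
    moreover have "x \<in> V.span (set (x # xs))"
      using V.in_own_span[of "set (x # xs)"] x xs by (auto simp: carrier_vec_sp)
    ultimately have "y' \<oplus>\<^bsub>vec_sp F d\<^esub> c \<odot>\<^bsub>vec_sp F d\<^esub> x \<in> V.span (set (x # xs))"
      using V.span_is_submodule[of "set (x # xs)"] x xs cc
      by (intro submodule.m_closed submodule.smult_closed) (auto simp: carrier_vec_sp)
    moreover have "y' \<oplus>\<^bsub>vec_sp F d\<^esub> c \<odot>\<^bsub>vec_sp F d\<^esub> x = y"
      using y cx cc unfolding vec_sp_simps y'_def
      by (intro extensionalityI[of _ "{..<d}"]) (auto simp: PiE_iff a_minus_def a_assoc l_neg Pi_iff)
    ultimately show ?thesis by simp
  qed
  \<comment> \<open>On the remaining coordinates \<open>V p\<close> is zero, so the subtraction does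
    not disturb the unit pattern.\<close>
  have marker: "V' i j = (if i = j then \<one> else \<zero>)" if "i \<in> set ms" "j \<in> set ms" "i \<noteq> p" "j \<noteq> p" for i j
  proof -
    have "V' i j = V i j \<ominus> t i \<otimes> V p j" using that sub by (intro V't) auto
    then show ?thesis using that mk p ct by (auto simp: a_minus_def)
  qed
  have perp: "dot d (V' i) z = \<zero>" if "i \<in> set ms" "i \<noteq> p" "z \<in> set (x # xs)" for i z
  proof (cases "z = x")
    case True
    then show ?thesis using dot'[OF that(1,2) cx] tx that cl cx by (simp add: a_minus_def r_neg)
  next
    case False
    then have "z \<in> set xs" using that by simp
    moreover have "z \<in> pvec d" using \<open>z \<in> set xs\<close> xs vecs_pvec by blast
    ultimately show ?thesis using dot' that pp p ct by (simp add: a_minus_def)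
  qed
  have cl': "V' i \<in> pvec d" if "i \<in> set ms" "i \<noteq> p" for i
    using V't that cl p ct by (auto simp: Pi_iff)
  show ?thesis
    unfolding null_basis_def ms'
    using dist sub len p cl' marker perp span' by (auto simp: length_remove1)
qed

lemma null_basis_exists:
  assumes "set xs \<subseteq> vecs F d"
  shows "\<exists>ms V. null_basis d xs ms V"
  using assms
proof (induction xs)
  case Nil
  then show ?case using null_basis_Nil by blast
next
  case (Cons x xs)
  then obtain ms V where nb: "null_basis d xs ms V" by auto
  show ?case
  proof (cases "\<exists>p\<in>set ms. dot d (V p) x \<noteq> \<zero>")
    case True
    then obtain p where p: "p \<in> set ms" "dot d (V p) x \<noteq> \<zero>" by blast
    show ?thesis
      using null_basis_pivot[OF nb, of x p "\<lambda>i j. V i j \<ominus> (dot d (V i) x \<otimes> inv (dot d (V p) x)) \<otimes> V p j"] p Cons.prems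
      by (intro exI[of _ "remove1 p ms"] exI) auto
  next
    case False
    then have "null_basis d (x # xs) ms V" using null_basis_skip[OF nb, of x] Cons.prems by auto
    then show ?thesis by blast
  qed
qed

text \<open>Each vector uses up at most one coordinate, so fewer than \<open>d\<close> vectors leave
  one free, and the null vector belonging to it has the entry \<one> there.\<close>

lemma null_basis_nonzero:
  assumes "null_basis d xs ms V" "length xs < d"
  shows "ms \<noteq> []" "V (hd ms) \<in> pvec d" "\<exists>i<d. V (hd ms) i \<noteq> \<zero>" "\<And>x. x \<in> set xs \<Longrightarrow> dot d (V (hd ms)) x = \<zero>"
proof -
  show ne: "ms \<noteq> []" using assms by (auto simp: null_basis_def)
  then have h: "hd ms \<in> set ms" by simp
  show "V (hd ms) \<in> pvec d" "\<And>x. x \<in> set xs \<Longrightarrow> dot d (V (hd ms)) x = \<zero>"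
    using assms(1) h by (auto simp: null_basis_def)
  have "V (hd ms) (hd ms) = \<one>" "hd ms < d" using assms(1) h by (auto simp: null_basis_def)
  then show "\<exists>i<d. V (hd ms) i \<noteq> \<zero>" by auto
qed

text \<open>By the span clause some null vector of \<open>xs\<close> does not kill \<open>y\<close>;
  scaling it gives \<open>u\<close>.\<close>

lemma separation:
  assumes "set xs \<subseteq> vecs F d" "y \<in> vecs F d" "y \<notin> module.span F (vec_sp F d) (set xs)"
  shows "\<exists>u\<in>pvec d. dot d u y = \<one> \<and> (\<forall>x\<in>set xs. dot d u x = \<zero>)"
proof -
  obtain ms V where nb: "null_basis d xs ms V" using null_basis_exists[OF assms(1)] by blast
  then obtain i where i: "i \<in> set ms" "dot d (V i) y \<noteq> \<zero>"
    using assms unfolding null_basis_def by blast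
  have cl: "V i \<in> pvec d" "\<And>x. x \<in> set xs \<Longrightarrow> dot d (V i) x = \<zero>"
    using nb i by (auto simp: null_basis_def)
  define c where "c = inv (dot d (V i) y)"
  have U: "dot d (V i) y \<in> Units F" using i cl assms vecs_pvec by (simp add: field_Units)
  then have c: "c \<in> carrier F" by (simp add: c_def)
  have "dot d (\<lambda>j. c \<otimes> V i j) z = c \<otimes> dot d (V i) z" if "z \<in> vecs F d" for z
    using that c cl vecs_pvec by (intro dot_smult_left) auto
  then show ?thesis
    using assms cl c U by (intro bexI[of _ "\<lambda>j. c \<otimes> V i j"]) (auto simp: c_def Pi_iff subset_iff)
qed

end

section \<open>Full rank over a finite field\<close>

context coeff_field begin

text \<open>By counting: a space with a basis of \<open>n\<close> elements over \<open>F\<close> has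
  at least as many elements as \<open>vecs F n\<close>, and this one is contained in
  \<open>vecs F n\<close>.\<close>

lemma rank_full:
  assumes "finite (carrier F)" "S \<subseteq> vecs F n" "rank_of F n S = n"
  shows "module.span F (vec_sp F n) S = vecs F n"
proof -
  interpret V: vectorspace F "vec_sp F n" by (rule vec_sp_vectorspace)
  let ?W = "V.vs (V.span S)"
  have sub: "subspace F (V.span S) (vec_sp F n)"
    using assms(2) by (intro V.span_is_subspace) (simp add: carrier_vec_sp)
  interpret W: vectorspace F ?W by (rule V.subspace_is_vs[OF sub])
  have fin: "finite (vecs F n)" using assms(1) by (intro finite_PiE) auto
  have le: "V.span S \<subseteq> vecs F n"
    using V.span_is_subset2[of S] assms(2) by (simp add: carrier_vec_sp)
  have finW: "finite (carrier ?W)" using fin le finite_subset by auto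
  have "W.gen_set (carrier ?W)"
    using W.in_own_span[of "carrier ?W"] W.span_is_subset2[of "carrier ?W"] by blast
  then have "W.fin_dim" unfolding W.fin_dim_def using finW by blast
  then obtain B where B: "finite B" "W.basis B" using W.finite_basis_exists by blast
  have card_B: "card B = n" using W.dim_basis[OF B] assms(3) by (simp add: rank_of_def)
  have Bsub: "B \<subseteq> carrier ?W" using B by (simp add: W.basis_def)
  have ex1: "\<forall>v. v \<in> carrier ?W \<longrightarrow> (\<exists>!a. a \<in> B \<rightarrow>\<^sub>E carrier F \<and> W.lincomb a B = v)"
    using W.basis_criterion[OF B(1) Bsub] B(2) by blast
  \<comment> \<open>Different coefficient families on a basis give different vectors, which bounds
    the size of the span from below.\<close>
  have "inj_on (\<lambda>a. W.lincomb a B) (B \<rightarrow>\<^sub>E carrier F)"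
  proof (rule inj_onI)
    fix a b assume ab: "a \<in> B \<rightarrow>\<^sub>E carrier F" "b \<in> B \<rightarrow>\<^sub>E carrier F" "W.lincomb a B = W.lincomb b B"
    then have "W.lincomb a B \<in> carrier ?W" using Bsub by (intro W.lincomb_closed) (auto simp: PiE_iff)
    then show "a = b" using ex1 ab by metis
  qed
  moreover have "(\<lambda>a. W.lincomb a B) ` (B \<rightarrow>\<^sub>E carrier F) \<subseteq> carrier ?W"
    using Bsub by (intro image_subsetI W.lincomb_closed) (auto simp: PiE_iff)
  ultimately have "card (B \<rightarrow>\<^sub>E carrier F) \<le> card (carrier ?W)"
    using finW by (metis card_image card_mono)
  then have "card (vecs F n) \<le> card (V.span S)"
    using B(1) card_B by (simp add: card_funcsetE)
  then show ?thesis using fin le card_seteq by blast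
qed

text \<open>The unit vectors lie in the span, and a functional vanishing on them has only zero
  coefficients.\<close>

lemma rank_full_injective:
  assumes "finite (carrier F)" "S \<subseteq> vecs F n" "rank_of F n S = n"
    and y: "y \<in> pvec n" and 0: "\<And>x. x \<in> S \<Longrightarrow> dot n y x = \<zero>" and i: "i < n"
  shows "y i = \<zero>"
proof -
  have mem: "(\<lambda>j\<in>{..<n}. if j = i then \<one> else \<zero>) \<in> module.span F (vec_sp F n) S"
    unfolding rank_full[OF assms(1-3)] by auto
  have "dot n y (\<lambda>j\<in>{..<n}. if j = i then \<one> else \<zero>) = \<zero>"
    by (rule span_perp[OF y assms(2) 0 mem])
  moreover have "dot n y (\<lambda>j\<in>{..<n}. if j = i then \<one> else \<zero>) = dot n y (\<lambda>j. if j = i then \<one> else \<zero>)"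
    by (rule dot_cong) auto
  ultimately show ?thesis using dot_delta[OF i y] by simp
qed

subsection \<open>Invertible matrices\<close>

lemma mat_mult_entry:
  "i < m \<Longrightarrow> j < n \<Longrightarrow> mat_mult F m k n A B (i, j) = dot k (\<lambda>l. A (i, l)) (\<lambda>l. B (l, j))"
  by (simp add: mat_mult_def dot_def)

lemma mat_eqI:
  "\<lbrakk>A \<in> extensional ({..<m} \<times> {..<n}); B \<in> extensional ({..<m} \<times> {..<n});
    \<And>i j. i < m \<Longrightarrow> j < n \<Longrightarrow> A (i, j) = B (i, j)\<rbrakk> \<Longrightarrow> A = B"
  by (rule extensionalityI[of _ "{..<m} \<times> {..<n}"]) auto

lemma mat_mult_ext: "mat_mult F m k n A B \<in> extensional ({..<m} \<times> {..<n})"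
  by (auto simp: mat_mult_def)

lemma mat_mult_closed:
  assumes "A \<in> {..<m} \<times> {..<k} \<rightarrow>\<^sub>E carrier F" "B \<in> {..<k} \<times> {..<n} \<rightarrow>\<^sub>E carrier F"
  shows "mat_mult F m k n A B \<in> {..<m} \<times> {..<n} \<rightarrow>\<^sub>E carrier F"
proof -
  have "mat_mult F m k n A B (i, j) \<in> carrier F" if "i < m" "j < n" for i j
    unfolding mat_mult_entry[OF that] using assms that by (intro dot_closed) (auto simp: PiE_iff)
  then show ?thesis using mat_mult_ext by (auto simp: PiE_iff)
qed

lemma mat_monoid: "Group.monoid (mat_monoid F n)" (is "Group.monoid ?M")
proof (rule monoidI)
  fix A B C
  assume A: "A \<in> carrier ?M" and B: "B \<in> carrier ?M"
    and C: "C \<in> carrier ?M"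
  then have c: "\<And>i j. i < n \<Longrightarrow> j < n \<Longrightarrow> A (i, j) \<in> carrier F" "\<And>i j. i < n \<Longrightarrow> j < n \<Longrightarrow> B (i, j) \<in> carrier F"
    "\<And>i j. i < n \<Longrightarrow> j < n \<Longrightarrow> C (i, j) \<in> carrier F"
    by (auto simp: mat_monoid_def PiE_iff)
  show "A \<otimes>\<^bsub>?M\<^esub> B \<in> carrier ?M"
    using A B by (simp add: mat_monoid_def mat_mult_closed)
  show "A \<otimes>\<^bsub>?M\<^esub> B \<otimes>\<^bsub>?M\<^esub> C = A \<otimes>\<^bsub>?M\<^esub> (B \<otimes>\<^bsub>?M\<^esub> C)"
  proof (simp add: mat_monoid_def, rule mat_eqI[OF mat_mult_ext mat_mult_ext])
    fix i j assume ij: "i < n" "j < n"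
    have "mat_mult F n n n (mat_mult F n n n A B) C (i, j)
       = dot n (\<lambda>k. dot n (\<lambda>l. A (i, l)) (\<lambda>l. B (l, k))) (\<lambda>k. C (k, j))"
      unfolding mat_mult_entry[OF ij] by (rule dot_cong) (use ij in \<open>auto simp: mat_mult_entry\<close>)
    also have "\<dots> = dot n (\<lambda>l. A (i, l)) (\<lambda>l. dot n (\<lambda>k. B (l, k)) (\<lambda>k. C (k, j)))"
      using c ij by (intro dot_assoc) auto
    also have "\<dots> = mat_mult F n n n A (mat_mult F n n n B C) (i, j)"
      unfolding mat_mult_entry[OF ij] by (rule dot_cong) (use ij in \<open>auto simp: mat_mult_entry\<close>)
    finally show "mat_mult F n n n (mat_mult F n n n A B) C (i, j) = mat_mult F n n n A (mat_mult F n n n B C) (i, j)" .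
  qed
next
  show "\<one>\<^bsub>?M\<^esub> \<in> carrier ?M"
    by (auto simp: mat_monoid_def)
next
  fix A assume A: "A \<in> carrier ?M"
  then have c: "\<And>i j. i < n \<Longrightarrow> j < n \<Longrightarrow> A (i, j) \<in> carrier F" "A \<in> extensional ({..<n} \<times> {..<n})"
    by (auto simp: mat_monoid_def PiE_iff)
  show "\<one>\<^bsub>?M\<^esub> \<otimes>\<^bsub>?M\<^esub> A = A"
  proof (simp add: mat_monoid_def, rule mat_eqI[OF mat_mult_ext c(2)])
    fix i j assume ij: "i < n" "j < n"
    have "mat_mult F n n n (\<lambda>(i, j)\<in>{..<n} \<times> {..<n}. if i = j then \<one> else \<zero>) A (i, j)
      = dot n (\<lambda>l. if l = i then \<one> else \<zero>) (\<lambda>l. A (l, j))"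
      unfolding mat_mult_entry[OF ij] by (rule dot_cong) (use ij in auto)
    then show "mat_mult F n n n (\<lambda>(i, j)\<in>{..<n} \<times> {..<n}. if i = j then \<one> else \<zero>) A (i, j) = A (i, j)"
      using dot_delta_left[OF ij(1), of "\<lambda>l. A (l, j)"] c ij by auto
  qed
  show "A \<otimes>\<^bsub>?M\<^esub> \<one>\<^bsub>?M\<^esub> = A"
  proof (simp add: mat_monoid_def, rule mat_eqI[OF mat_mult_ext c(2)])
    fix i j assume ij: "i < n" "j < n"
    have "mat_mult F n n n A (\<lambda>(i, j)\<in>{..<n} \<times> {..<n}. if i = j then \<one> else \<zero>) (i, j)
      = dot n (\<lambda>l. A (i, l)) (\<lambda>l. if l = j then \<one> else \<zero>)"
      unfolding mat_mult_entry[OF ij] by (rule dot_cong) (use ij in auto)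
    then show "mat_mult F n n n A (\<lambda>(i, j)\<in>{..<n} \<times> {..<n}. if i = j then \<one> else \<zero>) (i, j) = A (i, j)"
      using dot_delta[OF ij(2), of "\<lambda>l. A (i, l)"] c ij by auto
  qed
qed

lemma mat_one_entry: "i < n \<Longrightarrow> j < n \<Longrightarrow> \<one>\<^bsub>mat_monoid F n\<^esub> (i, j) = (if i = j then \<one> else \<zero>)"
  by (simp add: mat_monoid_def)

lemma mat_monoid_mult: "A \<otimes>\<^bsub>mat_monoid F n\<^esub> B = mat_mult F n n n A B"
  by (simp add: mat_monoid_def)

lemma mat_carrier_entry: "Q \<in> carrier (mat_monoid F n) \<Longrightarrow> i < n \<Longrightarrow> j < n \<Longrightarrow> Q (i, j) \<in> carrier F"
  by (auto simp: mat_monoid_def PiE_iff)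

lemma units_entry:
  assumes "Q \<in> Units (mat_monoid F n)"
  shows "i < n \<Longrightarrow> j < n \<Longrightarrow> Q (i, j) \<in> carrier F"
proof -
  interpret M: Group.monoid "mat_monoid F n" by (rule mat_monoid)
  show "i < n \<Longrightarrow> j < n \<Longrightarrow> Q (i, j) \<in> carrier F"
    using mat_carrier_entry[OF M.Units_closed[OF assms]] .
qed

lemma mat_inv:
  assumes "Q \<in> Units (mat_monoid F n)"
  shows "inv\<^bsub>mat_monoid F n\<^esub> Q \<in> carrier (mat_monoid F n)"
    and "\<And>i j. i < n \<Longrightarrow> j < n \<Longrightarrow>
      dot n (\<lambda>l. (inv\<^bsub>mat_monoid F n\<^esub> Q) (i, l)) (\<lambda>l. Q (l, j)) = (if i = j then \<one> else \<zero>)"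
    and "\<And>i j. i < n \<Longrightarrow> j < n \<Longrightarrow>
      dot n (\<lambda>l. Q (i, l)) (\<lambda>l. (inv\<^bsub>mat_monoid F n\<^esub> Q) (l, j)) = (if i = j then \<one> else \<zero>)"
proof -
  interpret M: Group.monoid "mat_monoid F n" by (rule mat_monoid)
  show "inv\<^bsub>mat_monoid F n\<^esub> Q \<in> carrier (mat_monoid F n)" using assms by simp
  fix i j assume ij: "i < n" "j < n"
  show "dot n (\<lambda>l. (inv\<^bsub>mat_monoid F n\<^esub> Q) (i, l)) (\<lambda>l. Q (l, j)) = (if i = j then \<one> else \<zero>)"
    using M.Units_l_inv[OF assms] mat_mult_entry[OF ij, of n "inv\<^bsub>mat_monoid F n\<^esub> Q" Q] mat_one_entry[OF ij]
    by (simp add: mat_monoid_mult)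
  show "dot n (\<lambda>l. Q (i, l)) (\<lambda>l. (inv\<^bsub>mat_monoid F n\<^esub> Q) (l, j)) = (if i = j then \<one> else \<zero>)"
    using M.Units_r_inv[OF assms] mat_mult_entry[OF ij, of n Q "inv\<^bsub>mat_monoid F n\<^esub> Q"] mat_one_entry[OF ij]
    by (simp add: mat_monoid_mult)
qed

text \<open>That is, \<open>(y P) Q = y\<close> when \<open>P Q\<close> is the identity. It is
  applied with \<open>Q\<close> and its inverse in both roles.\<close>

lemma row_mult_cancel:
  assumes y: "y \<in> pvec n" and j: "j < n"
    and P: "\<And>i j. i < n \<Longrightarrow> j < n \<Longrightarrow> P (i, j) \<in> carrier F"
    and Q: "\<And>i j. i < n \<Longrightarrow> j < n \<Longrightarrow> Q (i, j) \<in> carrier F"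
    and PQ: "\<And>i j. i < n \<Longrightarrow> j < n \<Longrightarrow> dot n (\<lambda>l. P (i, l)) (\<lambda>l. Q (l, j)) = (if i = j then \<one> else \<zero>)"
  shows "dot n (\<lambda>k. dot n y (\<lambda>i. P (i, k))) (\<lambda>k. Q (k, j)) = y j"
proof -
  have "dot n (\<lambda>k. dot n y (\<lambda>i. P (i, k))) (\<lambda>k. Q (k, j)) = dot n y (\<lambda>i. dot n (\<lambda>k. P (i, k)) (\<lambda>k. Q (k, j)))"
    using y j P Q by (intro dot_assoc) auto
  also have "\<dots> = dot n y (\<lambda>i. if i = j then \<one> else \<zero>)"
    by (rule dot_cong) (use PQ j in auto)
  finally show ?thesis using dot_delta[OF j y] by simp
qed

lemma units_col_injective:
  assumes Q: "Q \<in> Units (mat_monoid F n)" and c: "c \<in> pvec n"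
    and 0: "\<And>i. i < n \<Longrightarrow> dot n (\<lambda>j. Q (i, j)) c = \<zero>" and j: "j < n"
  shows "c j = \<zero>"
proof -
  let ?P = "inv\<^bsub>mat_monoid F n\<^esub> Q"
  note cQ = units_entry[OF Q]
  have cP: "\<And>i j. i < n \<Longrightarrow> j < n \<Longrightarrow> ?P (i, j) \<in> carrier F"
    using mat_carrier_entry mat_inv(1)[OF Q] by blast
  have "\<zero> = dot n (\<lambda>i. ?P (j, i)) (\<lambda>i. dot n (\<lambda>k. Q (i, k)) c)"
    using cP j 0 by (subst dot_zero_right) auto
  also have "\<dots> = dot n (\<lambda>k. dot n (\<lambda>i. ?P (j, i)) (\<lambda>i. Q (i, k))) c"
    using cP cQ j c by (subst dot_assoc) auto
  also have "\<dots> = dot n (\<lambda>k. if k = j then \<one> else \<zero>) c"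
    by (rule dot_cong) (use mat_inv(2)[OF Q j] in auto)
  finally show ?thesis using dot_delta_left[OF j c] by simp
qed

text \<open>Over a finite field injectivity implies surjectivity by counting, which provides a right inverse.\<close>

lemma mat_unitI:
  assumes fin: "finite (carrier F)" and Q: "Q \<in> carrier (mat_monoid F n)"
    and inj: "\<And>c. c \<in> vecs F n \<Longrightarrow> (\<And>i. i < n \<Longrightarrow> dot n (\<lambda>j. Q (i, j)) c = \<zero>) \<Longrightarrow> (\<And>j. j < n \<Longrightarrow> c j = \<zero>)"
  shows "Q \<in> Units (mat_monoid F n)"
proof -
  let ?M = "mat_monoid F n"
  interpret M: Group.monoid "mat_monoid F n" by (rule mat_monoid)
  define h where "h c = (\<lambda>i\<in>{..<n}. dot n (\<lambda>j. Q (i, j)) c)" for c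
  have cQ: "\<And>i. i < n \<Longrightarrow> (\<lambda>j. Q (i, j)) \<in> pvec n"
    using mat_carrier_entry[OF Q] by auto
  have finV: "finite (vecs F n)" using fin by (intro finite_PiE) auto
  have inj': "c = c'" if cc: "c \<in> vecs F n" "c' \<in> vecs F n"
    and eq: "\<And>i. i < n \<Longrightarrow> dot n (\<lambda>j. Q (i, j)) c = dot n (\<lambda>j. Q (i, j)) c'" for c c'
  proof -
    \<comment> \<open>The factor \<one> only gives the difference the shape that
      \<open>dot_sub_right\<close> expects.\<close>
    define d where "d = (\<lambda>j\<in>{..<n}. c j \<ominus> \<one> \<otimes> c' j)"
    have p: "c \<in> pvec n" "c' \<in> pvec n" using cc vecs_pvec by auto
    have d: "d \<in> vecs F n" using p by (auto simp: d_def Pi_iff)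
    have "dot n (\<lambda>j. Q (i, j)) d = \<zero>" if "i < n" for i
    proof -
      have "dot n (\<lambda>j. Q (i, j)) d = dot n (\<lambda>j. Q (i, j)) (\<lambda>j. c j \<ominus> \<one> \<otimes> c' j)"
        by (rule dot_cong) (auto simp: d_def)
      also have "\<dots> = dot n (\<lambda>j. Q (i, j)) c \<ominus> \<one> \<otimes> dot n (\<lambda>j. Q (i, j)) c'"
        using p cQ[OF that] by (intro dot_sub_right) auto
      finally show ?thesis using eq[OF that] p cQ[OF that] by (simp add: a_minus_def r_neg)
    qed
    then have "d j = \<zero>" if "j < n" for j using inj d that by blast
    then have "c j = c' j" if "j < n" for j
      using that p sum_zero_eq_neg[of "c j" "\<ominus> c' j"] by (fastforce simp: d_def a_minus_def Pi_iff)
    then show ?thesis using cc by (intro extensionalityI[of _ "{..<n}"]) (auto simp: PiE_iff)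
  qed
  have hV: "h ` vecs F n \<subseteq> vecs F n" using cQ vecs_pvec by (auto simp: h_def)
  have "inj_on h (vecs F n)"
    by (rule inj_onI, rule inj') (auto simp: h_def fun_eq_iff restrict_def split: if_splits)
  then have surj: "h ` vecs F n = vecs F n"
    using endo_inj_surj[OF finV hV] by blast
  have "\<exists>c\<in>vecs F n. \<forall>i<n. dot n (\<lambda>k. Q (i, k)) c = (if i = j then \<one> else \<zero>)" for j
  proof -
    have "(\<lambda>i\<in>{..<n}. if i = j then \<one> else \<zero>) \<in> h ` vecs F n" unfolding surj by auto
    then obtain c where c: "c \<in> vecs F n" "(\<lambda>i\<in>{..<n}. if i = j then \<one> else \<zero>) = h c" by auto
    have "dot n (\<lambda>k. Q (i, k)) c = (if i = j then \<one> else \<zero>)" if "i < n" for i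
      using fun_cong[OF c(2), of i] that by (simp add: h_def)
    then show ?thesis using c(1) by blast
  qed
  then obtain R where R: "\<And>j. R j \<in> vecs F n"
    "\<And>i j. i < n \<Longrightarrow> dot n (\<lambda>k. Q (i, k)) (R j) = (if i = j then \<one> else \<zero>)"
    by metis
  define P where "P = (\<lambda>(i, j)\<in>{..<n} \<times> {..<n}. R j i)"
  have P: "P \<in> carrier ?M"
    using R(1) by (auto simp: P_def mat_monoid_def PiE_iff)
  have P_col: "dot n x (\<lambda>i. P (i, j)) = dot n x (R j)" if "j < n" for x j
    by (rule dot_cong) (use that in \<open>auto simp: P_def\<close>)
  have cP: "\<And>j. j < n \<Longrightarrow> (\<lambda>i. P (i, j)) \<in> pvec n" "\<And>i. i < n \<Longrightarrow> (\<lambda>j. P (i, j)) \<in> pvec n"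
    using mat_carrier_entry[OF P] by auto
  have QP: "Q \<otimes>\<^bsub>?M\<^esub> P = \<one>\<^bsub>?M\<^esub>"
    unfolding mat_monoid_mult
    by (rule mat_eqI[of _ n n, OF mat_mult_ext])
      (auto simp: mat_mult_entry P_col R(2) mat_one_entry, simp add: mat_monoid_def)
  \<comment> \<open>Both \<open>Q (P Q)\<close> and \<open>Q 1\<close> equal \<open>Q\<close>, and
    \<open>inj'\<close> cancels the left factor \<open>Q\<close> column by column.\<close>
  have "P \<otimes>\<^bsub>?M\<^esub> Q = \<one>\<^bsub>?M\<^esub>"
  proof -
    have "Q \<otimes>\<^bsub>?M\<^esub> (P \<otimes>\<^bsub>?M\<^esub> Q) = Q \<otimes>\<^bsub>?M\<^esub> \<one>\<^bsub>?M\<^esub>"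
      using QP P Q by (simp flip: M.m_assoc)
    then have eq: "mat_mult F n n n Q (P \<otimes>\<^bsub>?M\<^esub> Q) = mat_mult F n n n Q \<one>\<^bsub>?M\<^esub>"
      by (simp add: mat_monoid_mult)
    have PQ: "P \<otimes>\<^bsub>?M\<^esub> Q \<in> carrier ?M" using P Q by simp
    have "(\<lambda>k\<in>{..<n}. (P \<otimes>\<^bsub>?M\<^esub> Q) (k, j)) = (\<lambda>k\<in>{..<n}. \<one>\<^bsub>?M\<^esub> (k, j))" if j: "j < n" for j
    proof (rule inj')
      show "(\<lambda>k\<in>{..<n}. (P \<otimes>\<^bsub>?M\<^esub> Q) (k, j)) \<in> vecs F n" "(\<lambda>k\<in>{..<n}. \<one>\<^bsub>?M\<^esub> (k, j)) \<in> vecs F n"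
        using mat_carrier_entry[OF PQ] mat_carrier_entry[OF M.one_closed] j by auto
      fix i assume i: "i < n"
      have r: "dot n x (restrict g {..<n}) = dot n x g" for x g by (rule dot_cong) auto
      show "dot n (\<lambda>k. Q (i, k)) (\<lambda>k\<in>{..<n}. (P \<otimes>\<^bsub>?M\<^esub> Q) (k, j)) =
            dot n (\<lambda>k. Q (i, k)) (\<lambda>k\<in>{..<n}. \<one>\<^bsub>?M\<^esub> (k, j))"
        using fun_cong[OF eq, of "(i, j)"] unfolding r mat_mult_entry[OF i j] .
    qed
    then have "(P \<otimes>\<^bsub>?M\<^esub> Q) (i, j) = \<one>\<^bsub>?M\<^esub> (i, j)" if "i < n" "j < n" for i j
      using fun_cong[of _ _ i] that by (metis (mono_tags, lifting) lessThan_iff restrict_apply')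
    then show ?thesis
      using PQ M.one_closed by (intro mat_eqI[of _ n n]) (auto simp: mat_monoid_def PiE_iff)
  qed
  with QP P Q show ?thesis unfolding Units_def by blast
qed

lemma mat_col_vecs: "(\<And>i. i < n \<Longrightarrow> Q (i, j) \<in> carrier F) \<Longrightarrow> mat_col n Q j \<in> vecs F n"
  by (auto simp: mat_col_def)

lemma dot_mat_col: "dot n y (mat_col n Q j) = dot n y (\<lambda>k. Q (k, j))"
  by (rule dot_cong) (auto simp: mat_col_def)

text \<open>It suffices that \<open>b_i\<close> is not in the span of the other first
  \<open>w\<close> columns and the \<open>f e\<close>; a separating functional then takes the
  required values. If \<open>b_i = u + v\<close> with \<open>u\<close> from the columns and
  \<open>v\<close> from the kernels, then \<open>v\<close> lies in both spans, so
  \<open>v = 0\<close>, and \<open>b_i = u\<close> contradicts the invertibility of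
  \<open>Q\<close>.\<close>

lemma dual_security:
  assumes Q: "Q \<in> Units (mat_monoid F n)" and wn: "w \<le> n" and A: "finite A" "f ` A \<subseteq> vecs F n"
    and triv: "module.span F (vec_sp F n) (mat_col n Q ` {..<w}) \<inter> module.span F (vec_sp F n) (f ` A)
      = {\<zero>\<^bsub>vec_sp F n\<^esub>}"
    and i: "i < w"
  shows "\<exists>y\<in>pvec n. (\<forall>j<w. dot n y (\<lambda>k. Q (k, j)) = (if j = i then \<one> else \<zero>)) \<and> (\<forall>e\<in>A. dot n y (f e) = \<zero>)"
proof -
  interpret V: vectorspace F "vec_sp F n" by (rule vec_sp_vectorspace)
  let ?P = "inv\<^bsub>mat_monoid F n\<^esub> Q"
  let ?S = "mat_col n Q ` ({..<w} - {i})" and ?T = "f ` A" and ?b = "mat_col n Q i"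
  note cQ = units_entry[OF Q]
  have S: "?S \<subseteq> vecs F n" and B: "mat_col n Q ` {..<w} \<subseteq> vecs F n" and b: "?b \<in> vecs F n"
    using cQ wn i by (auto intro!: mat_col_vecs)
  have nin: "?b \<notin> V.span (?S \<union> ?T)"
  proof
    assume "?b \<in> V.span (?S \<union> ?T)"
    then have "?b \<in> V.submodule_sum (V.span ?S) (V.span ?T)"
      using S A V.span_union_is_sum[of ?S ?T] by (simp add: carrier_vec_sp)
    then obtain u v where uv: "u \<in> V.span ?S" "v \<in> V.span ?T" "?b = u \<oplus>\<^bsub>vec_sp F n\<^esub> v"
      unfolding V.submodule_sum_def by auto
    have cu: "u \<in> carrier (vec_sp F n)" and cv: "v \<in> carrier (vec_sp F n)"
      using uv S A V.span_is_subset2[of ?S] V.span_is_subset2[of ?T] by (auto simp: carrier_vec_sp)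
    have "v = ?b \<oplus>\<^bsub>vec_sp F n\<^esub> \<ominus>\<^bsub>vec_sp F n\<^esub> u"
      using uv(3) cu cv by (metis V.M.a_comm V.M.a_inv_closed V.M.add.inv_solve_left V.M.add.m_closed)
    moreover have "u \<in> V.span (mat_col n Q ` {..<w})"
      using uv(1) V.span_is_monotone[of ?S "mat_col n Q ` {..<w}"] by blast
    moreover have "?b \<in> V.span (mat_col n Q ` {..<w})"
      using V.in_own_span[of "mat_col n Q ` {..<w}"] B i by (auto simp: carrier_vec_sp)
    ultimately have "v \<in> V.span (mat_col n Q ` {..<w})"
      using B by (auto intro!: V.span_add1 V.span_neg simp: carrier_vec_sp)
    then have "v = \<zero>\<^bsub>vec_sp F n\<^esub>" using triv uv(2) by blast
    then have bu: "?b = u" using uv(3) cu by simp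
    \<comment> \<open>Row \<open>i\<close> of the inverse of \<open>Q\<close> kills the other
      columns but is \<one> on \<open>b_i\<close>.\<close>
    have "dot n (\<lambda>l. ?P (i, l)) u = \<zero>"
    proof (rule span_perp[OF _ S _ uv(1)])
      show "(\<lambda>l. ?P (i, l)) \<in> pvec n" using mat_carrier_entry[OF mat_inv(1)[OF Q]] i wn by auto
      fix x assume "x \<in> ?S"
      then show "dot n (\<lambda>l. ?P (i, l)) x = \<zero>"
        using mat_inv(2)[OF Q, of i] i wn by (auto simp: dot_mat_col split: if_splits)
    qed
    moreover have "dot n (\<lambda>l. ?P (i, l)) ?b = \<one>"
      using mat_inv(2)[OF Q] i wn by (auto simp: dot_mat_col)
    ultimately show False using bu by simp
  qed
  obtain xs where xs: "set xs = ?S \<union> ?T" using A finite_list[of "?S \<union> ?T"] by auto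
  then obtain y where y: "y \<in> pvec n" "dot n y ?b = \<one>" "\<And>x. x \<in> ?S \<union> ?T \<Longrightarrow> dot n y x = \<zero>"
    using separation[of xs n ?b] S A b nin by auto
  have "dot n y (\<lambda>k. Q (k, j)) = (if j = i then \<one> else \<zero>)" if "j < w" for j
    using y(2) y(3)[of "mat_col n Q j"] that unfolding dot_mat_col by auto
  then show ?thesis using y by blast
qed

end

section \<open>Secure codes\<close>

subsection \<open>Mutual information\<close>

text \<open>For each fixed \<open>x\<close> the map \<open>Y (x, _)\<close> is \<open>g\<close>
  preceded by a permutation of \<open>B\<close>. Hence the conditional distribution of
  \<open>Y\<close> does not depend on \<open>x\<close>, the joint distribution is the product of the
  marginals, and the divergence of a measure from itself is 0.\<close>

lemma mutual_information_eq_0_shift: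
  assumes fin: "finite A" "A \<noteq> {}" "finite B" "B \<noteq> {}"
    and shift: "\<And>x. x \<in> A \<Longrightarrow> \<exists>h. bij_betw h B B \<and> (\<forall>y\<in>B. Y (x, y) = g (h y))"
  defines "M \<equiv> uniform_count_measure A \<Otimes>\<^sub>M uniform_count_measure B"
  shows "prob_space.mutual_information M b (count_space (Y ` space M)) (count_space (fst ` space M)) Y fst = 0"
proof -
  let ?A = "uniform_count_measure A" and ?B = "uniform_count_measure B"
  interpret A: prob_space ?A using fin by (intro prob_space_uniform_count_measure)
  interpret B: prob_space ?B using fin by (intro prob_space_uniform_count_measure)
  interpret P: pair_prob_space ?A ?B ..
  have PM: "prob_space M" unfolding M_def by (rule P.prob_space_axioms)
  interpret M: prob_space M by (rule PM)
  have sets_M: "sets M = Pow (A \<times> B)"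
    unfolding M_def using fin
    by (intro sets_pair_countable countable_finite) (simp_all add: sets_uniform_count_measure)
  have space_M: "space M = A \<times> B"
    by (simp add: M_def space_pair_measure space_uniform_count_measure)
  \<comment> \<open>The common conditional probability of \<open>Y\<close> being in
    \<open>Z\<close>; it will turn out to be the marginal distribution of \<open>Y\<close>.\<close>
  define p where "p Z = ennreal (card {y \<in> B. g y \<in> Z} / card B)" for Z
  have slice: "emeasure ?B {y \<in> B. Y (x, y) \<in> Z} = p Z" if x: "x \<in> A" for x Z
  proof -
    obtain h where h: "bij_betw h B B" "\<And>y. y \<in> B \<Longrightarrow> Y (x, y) = g (h y)" using shift[OF x] by blast
    have "bij_betw h {y \<in> B. Y (x, y) \<in> Z} {y \<in> B. g y \<in> Z}"
    proof (rule bij_betw_subset[OF h(1)])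
      show "h ` {y \<in> B. Y (x, y) \<in> Z} = {y \<in> B. g y \<in> Z}"
        using h bij_betw_imp_surj_on[OF h(1)] by (auto simp: image_iff) (metis imageE)+
    qed auto
    then have "card {y \<in> B. Y (x, y) \<in> Z} = card {y \<in> B. g y \<in> Z}" by (rule bij_betw_same_card)
    then show ?thesis
      using fin by (subst emeasure_uniform_count_measure) (auto simp: p_def)
  qed
  have rect: "emeasure M {z \<in> A \<times> B. Y z \<in> Z \<and> fst z \<in> W} = p Z * emeasure ?A (A \<inter> W)" for Z W
  proof -
    have "emeasure M {z \<in> A \<times> B. Y z \<in> Z \<and> fst z \<in> W}
        = (\<integral>\<^sup>+ x. emeasure ?B (Pair x -` {z \<in> A \<times> B. Y z \<in> Z \<and> fst z \<in> W}) \<partial>?A)"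
      unfolding M_def by (intro B.emeasure_pair_measure_alt) (use sets_M in \<open>auto simp: M_def\<close>)
    also have "\<dots> = (\<integral>\<^sup>+ x. p Z * indicator (A \<inter> W) x \<partial>?A)"
    proof (rule nn_integral_cong)
      fix x assume "x \<in> space ?A"
      then have x: "x \<in> A" by (simp add: space_uniform_count_measure)
      have "Pair x -` {z \<in> A \<times> B. Y z \<in> Z \<and> fst z \<in> W} = (if x \<in> W then {y \<in> B. Y (x, y) \<in> Z} else {})"
        using x by auto
      then show "emeasure ?B (Pair x -` {z \<in> A \<times> B. Y z \<in> Z \<and> fst z \<in> W}) = p Z * indicator (A \<inter> W) x"
        using slice[OF x, of Z] x by (auto simp: indicator_def)
    qed
    also have "\<dots> = p Z * emeasure ?A (A \<inter> W)"
      by (intro nn_integral_cmult_indicator) (simp add: sets_uniform_count_measure)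
    finally show ?thesis .
  qed
  let ?S = "count_space (Y ` space M)" and ?T = "count_space (fst ` space M)"
  have mY: "Y \<in> measurable M ?S" and mF: "fst \<in> measurable M ?T"
    using sets_M space_M by (auto simp: measurable_def)
  have fin_im: "finite (Y ` space M)" "finite (fst ` space M)" using fin by (auto simp: space_M)
  have YS: "emeasure (distr M ?S Y) Z = p Z" if "Z \<subseteq> Y ` space M" for Z
  proof -
    have "emeasure (distr M ?S Y) Z = emeasure M (Y -` Z \<inter> space M)"
      using mY that by (intro emeasure_distr) auto
    also have "Y -` Z \<inter> space M = {z \<in> A \<times> B. Y z \<in> Z \<and> fst z \<in> A}" by (auto simp: space_M)
    also have "emeasure M \<dots> = p Z * emeasure ?A (A \<inter> A)" by (rule rect)
    also have "\<dots> = p Z" using A.emeasure_space_1 by (simp add: space_uniform_count_measure)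
    finally show ?thesis .
  qed
  have pU: "p (Y ` space M) = 1"
  proof -
    interpret S: prob_space "distr M ?S Y" by (rule M.prob_space_distr[OF mY])
    show ?thesis using YS[of "Y ` space M"] S.emeasure_space_1 by simp
  qed
  have FT: "emeasure (distr M ?T fst) W = emeasure ?A (A \<inter> W)" if "W \<subseteq> fst ` space M" for W
  proof -
    have "emeasure (distr M ?T fst) W = emeasure M (fst -` W \<inter> space M)"
      using mF that by (intro emeasure_distr) auto
    also have "fst -` W \<inter> space M = {z \<in> A \<times> B. Y z \<in> Y ` space M \<and> fst z \<in> W}" by (auto simp: space_M)
    also have "emeasure M \<dots> = p (Y ` space M) * emeasure ?A (A \<inter> W)" by (rule rect)
    finally show ?thesis using pU by simp
  qed
  have m2: "(\<lambda>z. (Y z, fst z)) \<in> measurable M (?S \<Otimes>\<^sub>M ?T)"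
    using mY mF by (rule measurable_Pair)
  interpret S: prob_space "distr M ?S Y" by (rule M.prob_space_distr[OF mY])
  interpret T: prob_space "distr M ?T fst" by (rule M.prob_space_distr[OF mF])
  \<comment> \<open>Both marginals are probability measures, so it is enough to compare on
    rectangles, where \<open>rect\<close> gives the product form.\<close>
  have "distr M ?S Y \<Otimes>\<^sub>M distr M ?T fst = distr M (?S \<Otimes>\<^sub>M ?T) (\<lambda>z. (Y z, fst z))"
  proof (rule pair_measure_eqI)
    show "sigma_finite_measure (distr M ?S Y)" "sigma_finite_measure (distr M ?T fst)" ..
    show "sets (distr M ?S Y \<Otimes>\<^sub>M distr M ?T fst) = sets (distr M (?S \<Otimes>\<^sub>M ?T) (\<lambda>z. (Y z, fst z)))"
      unfolding sets_distr by (rule sets_pair_measure_cong) simp_all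
  next
    fix Z W assume "Z \<in> sets (distr M ?S Y)" "W \<in> sets (distr M ?T fst)"
    then have ZW: "Z \<subseteq> Y ` space M" "W \<subseteq> fst ` space M" by auto
    have "emeasure (distr M (?S \<Otimes>\<^sub>M ?T) (\<lambda>z. (Y z, fst z))) (Z \<times> W)
        = emeasure M ((\<lambda>z. (Y z, fst z)) -` (Z \<times> W) \<inter> space M)"
      using m2 ZW by (intro emeasure_distr) auto
    also have "(\<lambda>z. (Y z, fst z)) -` (Z \<times> W) \<inter> space M = {z \<in> A \<times> B. Y z \<in> Z \<and> fst z \<in> W}"
      by (auto simp: space_M)
    also have "emeasure M \<dots> = p Z * emeasure ?A (A \<inter> W)" by (rule rect)
    finally show "emeasure (distr M ?S Y) Z * emeasure (distr M ?T fst) W =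
        emeasure (distr M (?S \<Otimes>\<^sub>M ?T) (\<lambda>z. (Y z, fst z))) (Z \<times> W)"
      using YS[OF ZW(1)] FT[OF ZW(2)] by simp
  qed
  then show ?thesis
    unfolding M.mutual_information_def
    by (metis KL_divergence_def S.sigma_finite_measure_axioms M.prob_space_distr m2 prob_space_imp_sigma_finite
        sigma_finite_measure.KL_same_eq_0)
qed

context network begin

subsection \<open>Cuts\<close>

lemma edge_cut_cut: "edge_cut A X \<Longrightarrow> X \<subseteq> arcs G"
  by (simp add: edge_cut_def)

lemma edge_cut_subset: "A \<subseteq> X \<Longrightarrow> X \<subseteq> arcs G \<Longrightarrow> edge_cut A X"
  unfolding edge_cut_def by (metis IntI empty_iff last_in_set subsetD)

lemma edge_cut_self: "A \<subseteq> arcs G \<Longrightarrow> edge_cut A A"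
  by (rule edge_cut_subset) auto

lemma edge_cut_mono: "edge_cut A X \<Longrightarrow> B \<subseteq> A \<Longrightarrow> edge_cut B X"
  by (auto simp: edge_cut_def)

lemma edge_cut_UN: "X \<subseteq> arcs G \<Longrightarrow> (\<And>e. e \<in> A \<Longrightarrow> edge_cut {e} X) \<Longrightarrow> edge_cut A X"
  by (auto simp: edge_cut_def)

text \<open>Cutting a path just after the edge where it meets \<open>X\<close> leaves a path from
  \<open>s\<close> whose last edge is in \<open>X\<close>, and this shorter path must already meet
  \<open>Y\<close>.\<close>

lemma edge_cut_trans:
  assumes "edge_cut A X" "edge_cut X Y"
  shows "edge_cut A Y"
  unfolding edge_cut_def
proof (intro conjI allI impI)
  show "Y \<subseteq> arcs G" using assms(2) by (rule edge_cut_cut)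
next
  fix p v assume p: "awalk s p v \<and> p \<noteq> [] \<and> last p \<in> A"
  then obtain x where "x \<in> set p" "x \<in> X" using assms(1) unfolding edge_cut_def by blast
  then obtain p1 p2 where dec: "p = (p1 @ [x]) @ p2" by (auto simp: in_set_conv_decomp)
  then have "awalk s (p1 @ [x]) (awlast s (p1 @ [x]))" using p awalk_append_iff by blast
  then have "set (p1 @ [x]) \<inter> Y \<noteq> {}"
    using assms(2) \<open>x \<in> X\<close> unfolding edge_cut_def by (metis last_snoc snoc_eq_iff_butlast)
  then show "set p \<inter> Y \<noteq> {}" using dec by auto
qed

lemma edge_cut_out_arc:
  assumes "edge_cut A X" "e \<in> A" "e \<in> out_arcs G s"
  shows "e \<in> X"
proof -
  have "awalk s [e] (head G e)" using assms(3) arc_implies_awalk[of e] by auto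
  then have "set [e] \<inter> X \<noteq> {}" using assms unfolding edge_cut_def by (metis last.simps list.distinct(1))
  then show ?thesis by simp
qed

text \<open>A path ending in \<open>d\<close> can be prolonged by \<open>e\<close>; the longer path
  meets \<open>X\<close>, but not in \<open>e\<close>. This carries separation backwards along the
  recursion for the global kernels.\<close>

lemma edge_cut_prev:
  assumes "edge_cut {e} X" "e \<notin> X" "e \<in> arcs G" "d \<in> in_arcs G (tail G e)"
  shows "edge_cut {d} X"
  unfolding edge_cut_def
proof (intro conjI allI impI)
  show "X \<subseteq> arcs G" using assms(1) by (rule edge_cut_cut)
next
  fix p v assume p: "awalk s p v \<and> p \<noteq> [] \<and> last p \<in> {d}"
  then have "v = head G d"
    by (metis awalkE' awalk_verts_conv last_snoc singletonD)
  then have "awalk s (p @ [e]) (head G e)"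
    using p assms(3,4) arc_implies_awalk[OF assms(3)] by (intro awalk_appendI[of s p v]) auto
  then have "set (p @ [e]) \<inter> X \<noteq> {}" using assms(1) unfolding edge_cut_def by (metis insertI1 last_snoc snoc_eq_iff_butlast)
  then show "set p \<inter> X \<noteq> {}" using assms(2) by auto
qed

lemma min_edge_cut_exists:
  assumes "A \<subseteq> arcs G"
  shows "\<exists>X. min_edge_cut A X"
proof -
  let ?k = "LEAST k. \<exists>X. edge_cut A X \<and> card X = k"
  have "\<exists>X. edge_cut A X \<and> card X = ?k"
    by (rule LeastI_ex) (use edge_cut_self[OF assms] in blast)
  moreover have "?k \<le> card Y" if "edge_cut A Y" for Y
    by (rule Least_le) (use that in blast)
  ultimately show ?thesis unfolding min_edge_cut_def by metis
qed

text \<open>A cut of \<open>X\<close> is a cut of \<open>A\<close> by transitivity, so none can be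
  smaller than \<open>X\<close>.\<close>

lemma min_edge_cut_min_self:
  assumes "min_edge_cut A X"
  shows "min_edge_cut X X"
  using assms edge_cut_trans edge_cut_self edge_cut_cut unfolding min_edge_cut_def by blast

text \<open>Discrete continuity: when the edges leaving \<open>s\<close> are added to
  \<open>A\<close> one at a time, the minimum cut size goes up by at most 1 per step. It starts at
  no more than \<open>r\<close> and ends at no less than \<open>r\<close>, so it equals
  \<open>r\<close> at some point.\<close>

lemma exists_superset_min_cut_eq:
  assumes A: "A \<subseteq> arcs G" "card A \<le> r" and r: "r \<le> card (out_arcs G s)"
  shows "\<exists>A' X. A \<subseteq> A' \<and> min_edge_cut A' X \<and> card X = r"
proof -
  have "\<exists>A' X. A \<subseteq> A' \<and> A' \<subseteq> A \<union> B \<and> min_edge_cut A' X \<and> card X = r"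
    if "finite B" "B \<subseteq> out_arcs G s" "\<exists>X. min_edge_cut (A \<union> B) X \<and> r \<le> card X" for B
    using that
  proof (induction B rule: finite_induct)
    case empty
    then obtain X where X: "min_edge_cut A X" "r \<le> card X" by auto
    moreover have "card X \<le> card A" using X edge_cut_self[OF A(1)] by (auto simp: min_edge_cut_def)
    ultimately show ?case using A(2) by fastforce
  next
    case (insert e B)
    obtain X where X: "min_edge_cut (A \<union> insert e B) X" "r \<le> card X" using insert.prems by blast
    have "A \<union> B \<subseteq> arcs G" using A insert.prems by auto
    then obtain Y where Y: "min_edge_cut (A \<union> B) Y" using min_edge_cut_exists by blast
    show ?case
    proof (cases "r \<le> card Y")
      case True
      then show ?thesis using insert Y by blast
    next
      case False
      have "edge_cut (A \<union> B) Y" "Y \<subseteq> arcs G" "e \<in> arcs G"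
        using Y insert.prems edge_cut_cut by (auto simp: min_edge_cut_def)
      have "edge_cut (A \<union> insert e B) (insert e Y)"
      proof (rule edge_cut_UN)
        show "insert e Y \<subseteq> arcs G" using \<open>Y \<subseteq> arcs G\<close> \<open>e \<in> arcs G\<close> by simp
      next
        fix f assume f: "f \<in> A \<union> insert e B"
        have eY: "insert e Y \<subseteq> arcs G" using \<open>Y \<subseteq> arcs G\<close> \<open>e \<in> arcs G\<close> by simp
        show "edge_cut {f} (insert e Y)"
        proof (cases "f = e")
          case True
          then show ?thesis using eY by (intro edge_cut_subset) auto
        next
          case False
          then have "edge_cut {f} Y"
            using f by (intro edge_cut_mono[OF \<open>edge_cut (A \<union> B) Y\<close>]) auto
          moreover have "edge_cut Y (insert e Y)" using eY by (intro edge_cut_subset) auto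
          ultimately show ?thesis by (rule edge_cut_trans)
        qed
      qed
      \<comment> \<open>The size was below \<open>r\<close> without \<open>e\<close> and is at least
        \<open>r\<close> with it; a minimum cut for the smaller set together with \<open>e\<close>
        shows that the jump is at most 1.\<close>
      then have "card X \<le> card (insert e Y)" using X by (auto simp: min_edge_cut_def)
      also have "\<dots> \<le> Suc (card Y)" by (simp add: card_insert_le_m1 card_insert_if)
      finally have "card X = r" using False X by simp
      then show ?thesis using X by blast
    qed
  qed
  moreover have "finite (out_arcs G s)" by (rule finite_subset[OF _ finite_arcs]) auto
  \<comment> \<open>An edge leaving \<open>s\<close> is a path on its own, so every cut of these
    edges contains all of them.\<close>
  moreover have "\<exists>X. min_edge_cut (A \<union> out_arcs G s) X \<and> r \<le> card X"
  proof -
    obtain X where X: "min_edge_cut (A \<union> out_arcs G s) X"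
      using min_edge_cut_exists[of "A \<union> out_arcs G s"] A by (auto simp: out_arcs_def)
    then have "out_arcs G s \<subseteq> X" "X \<subseteq> arcs G"
      using edge_cut_out_arc[of "A \<union> out_arcs G s" X] edge_cut_cut by (auto simp: min_edge_cut_def)
    then have "card (out_arcs G s) \<le> card X" using finite_arcs by (meson card_mono finite_subset)
    then show ?thesis using X r by auto
  qed
  ultimately show ?thesis by blast
qed

text \<open>Among the size-\<open>r\<close> minimum cuts separating \<open>A\<close>, one cutting off as many edges as possible is primary.\<close>

lemma exists_primary_set_cutting:
  assumes A: "A \<subseteq> arcs G" "card A \<le> r" and r: "r \<le> card (out_arcs G s)"
  shows "\<exists>X\<in>primary_sets r. edge_cut A X"
proof -
  define D where "D X = {e \<in> arcs G. edge_cut {e} X}" for X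
  define P where "P X \<longleftrightarrow> edge_cut A X \<and> min_edge_cut X X \<and> card X = r" for X
  obtain A' X0 where "A \<subseteq> A'" "min_edge_cut A' X0" "card X0 = r"
    using exists_superset_min_cut_eq[OF assms] by blast
  then have P0: "P X0"
    unfolding P_def using min_edge_cut_min_self edge_cut_mono by (auto simp: min_edge_cut_def)
  have bound: "card (D X) < Suc (card (arcs G))" for X
    by (auto simp: D_def less_Suc_eq_le intro!: card_mono)
  obtain X where X: "P X" "\<And>Y. P Y \<Longrightarrow> card (D Y) \<le> card (D X)"
    using ex_has_greatest_nat[of P X0 "\<lambda>X. card (D X)" "Suc (card (arcs G))"] P0 bound by auto
  have sub: "X \<subseteq> arcs G" using X(1) edge_cut_cut unfolding P_def by blast
  have "edge_cut Y X" if Y: "min_edge_cut X Y" for Y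
  proof -
    have YA: "Y \<subseteq> arcs G" and XY: "edge_cut X Y" using Y edge_cut_cut by (auto simp: min_edge_cut_def)
    have "card Y = r"
      using Y X(1) edge_cut_self[OF sub] by (auto simp: P_def min_edge_cut_def intro: le_antisym)
    moreover have "edge_cut A Y" using X(1) XY edge_cut_trans by (auto simp: P_def)
    ultimately have "P Y" using min_edge_cut_min_self[OF Y] by (simp add: P_def)
    \<comment> \<open>Everything cut off by \<open>X\<close> is cut off by \<open>Y\<close>.
      Maximality of \<open>D X\<close> turns this into equality, and as \<open>Y\<close> cuts off
      its own edges, \<open>X\<close> cuts them off too.\<close>
    moreover have "D X \<subseteq> D Y" using XY edge_cut_trans by (auto simp: D_def)
    ultimately have "D X = D Y" using X(2)[of Y] by (intro card_seteq) (auto simp: D_def)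
    moreover have "Y \<subseteq> D Y"
    proof
      fix e assume "e \<in> Y"
      then show "e \<in> D Y" unfolding D_def using YA edge_cut_subset[of "{e}" Y] by blast
    qed
    ultimately have "Y \<subseteq> D X" by simp
    then show ?thesis using sub unfolding D_def by - (rule edge_cut_UN, auto)
  qed
  then have "X \<in> primary_sets r"
    using X(1) sub by (auto simp: primary_sets_def primary_min_cut_def P_def)
  then show ?thesis using X(1) by (auto simp: P_def)
qed

lemma finite_primary_sets: "finite (primary_sets r)"
  by (rule finite_subset[of _ "Pow (arcs G)"]) (auto simp: primary_sets_def)

text \<open>Sinks differ from \<open>s\<close>, so a path to a sink is nonempty and starts with an
  edge leaving \<open>s\<close>. From here on \<open>C_min\<close> enters only through this
  bound.\<close>

lemma C_min_le_out_arcs: "C_min \<le> card (out_arcs G s)"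
proof -
  obtain t where t: "t \<in> T" using sinks_nonempty by blast
  have finT: "finite T" using sinks_verts finite_verts by (meson finite_Diff finite_subset)
  have "C_min \<le> min_cut_capacity t"
    unfolding C_min_def using t finT by (intro Min_le) auto
  also have "\<dots> \<le> card (out_arcs G s)"
    unfolding min_cut_capacity_def
  proof (intro Least_le exI[of _ "out_arcs G s"] conjI refl)
    show "sink_cut t (out_arcs G s)"
      unfolding sink_cut_def
    proof (intro conjI allI impI)
      fix p assume p: "awalk s p t"
      then have "p \<noteq> []" using t sinks_verts by (auto simp: awalk_Nil_iff)
      then obtain e q where "p = e # q" by (cases p) auto
      then show "set p \<inter> out_arcs G s \<noteq> {}" using p by (auto simp: awalk_Cons_iff)
    qed auto
  qed
  finally show ?thesis .
qed

end

section \<open>Functionals applied to global encoding kernels\<close>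

lemma (in coeff_field) finsum_vec_sp_closed:
  assumes "finite I" "f \<in> I \<rightarrow> vecs F n"
  shows "finsum (vec_sp F n) f I \<in> vecs F n"
proof -
  interpret V: module F "vec_sp F n" by (rule vec_sp_module)
  show ?thesis using V.M.finsum_closed[of f I] assms by (simp add: carrier_vec_sp)
qed

lemma (in coeff_field) dot_finsum:
  assumes "finite I" "f \<in> I \<rightarrow> vecs F n" "y \<in> pvec n"
  shows "dot n y (finsum (vec_sp F n) f I) = (\<Oplus>i\<in>I. dot n y (f i))"
  using assms
proof (induction I rule: finite_induct)
  case empty
  interpret V: module F "vec_sp F n" by (rule vec_sp_module)
  show ?case using empty by (simp add: vec_sp_simps dot_zero_right)
next
  case (insert x I)
  interpret V: module F "vec_sp F n" by (rule vec_sp_module)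
  have f: "f x \<in> pvec n" "finsum (vec_sp F n) f I \<in> pvec n" "\<And>i. i \<in> I \<Longrightarrow> f i \<in> pvec n"
    using insert finsum_vec_sp_closed[of I f n] by (auto simp: Pi_iff intro!: vecs_pvec)
  have "dot n y (finsum (vec_sp F n) f (insert x I)) = dot n y (f x \<oplus>\<^bsub>vec_sp F n\<^esub> finsum (vec_sp F n) f I)"
    using insert by (subst V.M.finsum_insert) (auto simp: carrier_vec_sp Pi_iff)
  also have "\<dots> = dot n y (\<lambda>i. f x i \<oplus> finsum (vec_sp F n) f I i)"
    by (rule dot_cong) (auto simp: vec_sp_simps)
  also have "\<dots> = dot n y (f x) \<oplus> dot n y (finsum (vec_sp F n) f I)"
    using f insert by (intro dot_add_right) auto
  also have "\<dots> = (\<Oplus>i\<in>insert x I. dot n y (f i))"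
    using insert f by (subst finsum_insert) auto
  finally show ?case .
qed

lemma (in coeff_field) dot_vec_smult:
  "a \<in> carrier F \<Longrightarrow> x \<in> pvec n \<Longrightarrow> y \<in> pvec n \<Longrightarrow> dot n y (a \<odot>\<^bsub>vec_sp F n\<^esub> x) = a \<otimes> dot n y x"
  by (subst dot_smult_right[symmetric]) (auto simp: vec_sp_simps intro!: dot_cong)

text \<open>Induction in topological order. The hypothesis is only offered when \<open>e\<close> is
  an arc, so other values of the edge type are handled directly; their kernel is zero.\<close>

lemma (in network) arc_induct:
  assumes "\<And>e. (\<And>d. e \<in> arcs G \<Longrightarrow> d \<in> in_arcs G (tail G e) \<Longrightarrow> P d) \<Longrightarrow> P e"
  shows "P e"
proof -
  have "wf (inv_image (arcs_ends G) (tail G))"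
    by (intro wf_inv_image finite_acyclic_wf acyclic_arcs) (simp add: arcs_ends_def)
  then show ?thesis
  proof (induction e rule: wf_induct_rule)
    case (less e)
    show ?case
      by (rule assms, rule less) (auto simp: arcs_ends_conv in_arcs_def)
  qed
qed

locale coded_network = network G s T + coeff_field F
  for G :: "('v, 'e) pre_digraph" and s T and F :: "'f ring" (structure)
begin

lemma linear_code_carrier:
  assumes "linear_code F n C" "e \<in> arcs G" "d \<in> In n (tail G e)"
  shows "C (tail G e) d e \<in> carrier F"
proof -
  have "tail G e \<notin> T" using sinks_out[of "tail G e"] assms(2) by (force simp: out_arcs_def)
  then show ?thesis using assms unfolding linear_code_def by auto
qed

lemma unit_vector_vecs: "unit_vector F n j \<in> vecs F n"
  by (auto simp: unit_vector_def)

lemma global_kernel_closed: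
  assumes C: "linear_code F n C"
  shows "global_kernel F n C e \<in> vecs F n"
proof (induction e rule: arc_induct)
  case (1 e)
  interpret V: module F "vec_sp F n" by (rule vec_sp_module)
  show ?case
  proof (cases "e \<in> arcs G")
    case True
    have "(case d of Imag j \<Rightarrow> unit_vector F n j | Edge d' \<Rightarrow> global_kernel F n C d') \<in> vecs F n"
      if "d \<in> In n (tail G e)" for d
    proof (cases d)
      case (Imag j)
      then show ?thesis using unit_vector_vecs by simp
    next
      case (Edge d')
      then have "d' \<in> in_arcs G (tail G e)" using that unfolding In_def by (force split: if_splits)
      then show ?thesis using 1[OF True] Edge by simp
    qed
    then have "C (tail G e) d e \<odot>\<^bsub>vec_sp F n\<^esub>
       (case d of Imag j \<Rightarrow> unit_vector F n j | Edge d' \<Rightarrow> global_kernel F n C d') \<in> carrier (vec_sp F n)"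
      if "d \<in> In n (tail G e)" for d
      using that linear_code_carrier[OF C True] by (intro V.smult_closed) (auto simp: carrier_vec_sp)
    then have "(\<Oplus>\<^bsub>vec_sp F n\<^esub>d\<in>In n (tail G e). C (tail G e) d e \<odot>\<^bsub>vec_sp F n\<^esub>
       (case d of Imag j \<Rightarrow> unit_vector F n j | Edge d' \<Rightarrow> global_kernel F n C d')) \<in> carrier (vec_sp F n)"
      by (intro V.M.finsum_closed Pi_I)
    then show ?thesis
      using True by (subst global_kernel.simps) (simp add: carrier_vec_sp)
  next
    case False
    then show ?thesis using V.M.zero_closed by (subst global_kernel.simps) (simp add: carrier_vec_sp)
  qed
qed

lemmas global_kernel_pvec = vecs_pvec[OF global_kernel_closed]

lemma global_kernel_no_arc: "e \<notin> arcs G \<Longrightarrow> i < n \<Longrightarrow> global_kernel F n C e i = \<zero>"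
  by (subst global_kernel.simps) (simp add: vec_sp_simps)

lemma global_kernel_source:
  assumes C: "linear_code F n C" and e: "e \<in> arcs G" "tail G e = s" and i: "i < n"
  shows "global_kernel F n C e i = C s (Imag i) e"
proof -
  interpret V: module F "vec_sp F n" by (rule vec_sp_module)
  let ?f = "\<lambda>d. C s d e \<odot>\<^bsub>vec_sp F n\<^esub> (case d of Imag j \<Rightarrow> unit_vector F n j | Edge d' \<Rightarrow> global_kernel F n C d')"
  have c: "C s (Imag j) e \<in> carrier F" if "j < n" for j
    using linear_code_carrier[OF C e(1), of "Imag j"] that e(2) by (auto simp: In_def)
  have f: "?f \<in> Imag ` {..<n} \<rightarrow> vecs F n"
  proof (rule Pi_I)
    fix d :: "'e channel" assume "d \<in> Imag ` {..<n}"
    then obtain j where "d = Imag j" "j < n" by blast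
    then show "?f d \<in> vecs F n"
      using V.smult_closed[OF c, of j "unit_vector F n j"] unit_vector_vecs by (simp add: carrier_vec_sp)
  qed
  have "global_kernel F n C e = finsum (vec_sp F n) ?f (Imag ` {..<n})"
    using e by (subst global_kernel.simps) (simp add: In_def)
  then have "global_kernel F n C e i = (\<Oplus>d\<in>Imag ` {..<n}. ?f d i)"
    using f i by (simp add: finsum_vec_sp)
  also have "\<dots> = (\<Oplus>j\<in>{..<n}. ?f (Imag j) i)"
    using f i by (subst finsum_reindex) (auto simp: inj_on_def Pi_iff PiE_iff)
  also have "\<dots> = dot n (\<lambda>j. C s (Imag j) e) (\<lambda>j. if j = i then \<one> else \<zero>)"
    unfolding dot_def using i by (intro finsum_fundef_cong) (auto simp: vec_sp_simps unit_vector_def)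
  also have "\<dots> = C s (Imag i) e"
    using c i by (intro dot_delta) auto
  finally show ?thesis .
qed

text \<open>The recursion after applying an arbitrary functional. Unit functionals give back the
  coordinates, and functionals vanishing on a cut give the propagation of zeros.\<close>

lemma dot_global_kernel_inner:
  assumes C: "linear_code F n C" and e: "e \<in> arcs G" "tail G e \<noteq> s" and y: "y \<in> pvec n"
  shows "dot n y (global_kernel F n C e) =
    (\<Oplus>d\<in>in_arcs G (tail G e). C (tail G e) (Edge d) e \<otimes> dot n y (global_kernel F n C d))"
proof -
  interpret V: module F "vec_sp F n" by (rule vec_sp_module)
  let ?g = "\<lambda>d. C (tail G e) d e \<odot>\<^bsub>vec_sp F n\<^esub> (case d of Imag j \<Rightarrow> unit_vector F n j | Edge d' \<Rightarrow> global_kernel F n C d')"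
  let ?I = "in_arcs G (tail G e)"
  have c: "C (tail G e) (Edge d) e \<in> carrier F" if "d \<in> ?I" for d
    using linear_code_carrier[OF C e(1), of "Edge d"] that e(2) by (auto simp: In_def)
  have finI: "finite ?I" by (rule finite_subset[OF _ finite_arcs]) auto
  have g: "?g \<in> Edge ` ?I \<rightarrow> vecs F n"
  proof (rule Pi_I)
    fix d assume "d \<in> Edge ` ?I"
    then obtain d' where "d = Edge d'" "d' \<in> ?I" by blast
    then show "?g d \<in> vecs F n"
      using V.smult_closed[OF c, of d' "global_kernel F n C d'"] global_kernel_closed[OF C]
      by (simp add: carrier_vec_sp)
  qed
  have "global_kernel F n C e = finsum (vec_sp F n) ?g (Edge ` ?I)"
    using e by (subst global_kernel.simps) (simp add: In_def)
  then have "dot n y (global_kernel F n C e) = (\<Oplus>d\<in>Edge ` ?I. dot n y (?g d))"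
    using g y finI by (simp add: dot_finsum)
  also have "\<dots> = (\<Oplus>d\<in>?I. dot n y (?g (Edge d)))"
    using g y by (subst finsum_reindex) (auto simp: inj_on_def Pi_iff intro!: dot_closed dest!: vecs_pvec)
  also have "\<dots> = (\<Oplus>d\<in>?I. C (tail G e) (Edge d) e \<otimes> dot n y (global_kernel F n C d))"
    using c global_kernel_pvec[OF C] y
    by (intro finsum_cong') (auto simp: dot_vec_smult)
  finally show ?thesis .
qed

text \<open>An arc cut off by \<open>X\<close> but not in \<open>X\<close> does not leave
  \<open>s\<close>, and all arcs entering its tail are cut off as well; its kernel is a combination
  of theirs.\<close>

lemma global_kernel_perp_cut:
  assumes C: "linear_code F n C" and y: "y \<in> pvec n"
    and X: "\<And>x. x \<in> X \<Longrightarrow> dot n y (global_kernel F n C x) = \<zero>"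
  shows "edge_cut {e} X \<Longrightarrow> dot n y (global_kernel F n C e) = \<zero>"
proof (induction e rule: arc_induct)
  case (1 e)
  show ?case
  proof (cases "e \<in> arcs G \<and> e \<notin> X")
    case False
    then show ?thesis
      using X dot_zero_right[OF y, of "global_kernel F n C e"] global_kernel_no_arc by blast
  next
    case True
    have "tail G e \<noteq> s"
      using edge_cut_out_arc[OF 1(2), of e] True by auto
    moreover have "C (tail G e) (Edge d) e \<otimes> dot n y (global_kernel F n C d) = \<zero>"
      if d: "d \<in> in_arcs G (tail G e)" for d
    proof -
      have "dot n y (global_kernel F n C d) = \<zero>"
        using 1(1)[OF _ d] edge_cut_prev[OF 1(2) _ _ d] True by blast
      moreover have "C (tail G e) (Edge d) e \<in> carrier F"
        using linear_code_carrier[OF C, of e "Edge d"] True d \<open>tail G e \<noteq> s\<close> by (auto simp: In_def)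
      ultimately show ?thesis by simp
    qed
    ultimately show ?thesis
      using True y by (simp add: dot_global_kernel_inner[OF C] cong: finsum_cong)
  qed
qed

lemma code_mult_closed:
  assumes C: "linear_code F n C" and L: "\<And>i j. i < m \<Longrightarrow> j < n \<Longrightarrow> L (i, j) \<in> carrier F"
  shows "linear_code F m (code_mult F n L C)"
  unfolding linear_code_def
proof (intro ballI)
  fix v d e assume v: "v \<in> verts G - T" "d \<in> In m v" "e \<in> out_arcs G v"
  show "code_mult F n L C v d e \<in> carrier F"
  proof (cases "v = s")
    case True
    then obtain i where i: "d = Imag i" "i < m" using v by (auto simp: In_def)
    have "C s (Imag j) e \<in> carrier F" if "j < n" for j
      using C v True that unfolding linear_code_def by (auto simp: In_def)
    then show ?thesis using True i L by (auto simp: code_mult_def intro!: finsum_closed)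
  next
    case False
    then show ?thesis using C v unfolding linear_code_def by (auto simp: In_def code_mult_def)
  qed
qed

lemma code_mult_source:
  "code_mult F n L C s (Imag i) e = dot n (\<lambda>j. L (i, j)) (\<lambda>j. C s (Imag j) e)"
  by (simp add: code_mult_def dot_def)

lemma dot_row_mult:
  assumes "x \<in> pvec m" "z \<in> pvec n" "\<And>i j. i < m \<Longrightarrow> j < n \<Longrightarrow> L (i, j) \<in> carrier F"
    and "\<And>i. i < m \<Longrightarrow> z' i = dot n (\<lambda>j. L (i, j)) z"
  shows "dot m x z' = dot n (\<lambda>j. dot m x (\<lambda>i. L (i, j))) z"
proof -
  have "dot m x z' = dot m x (\<lambda>i. dot n (\<lambda>j. L (i, j)) z)"
    by (rule dot_cong) (use assms in auto)
  then show ?thesis using assms(1-3) by (subst dot_assoc) auto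
qed

text \<open>For arcs leaving \<open>s\<close> this is the definition of the product; behind them
  both codes follow the same linear recursion with the same local kernels.\<close>

lemma global_kernel_code_mult:
  assumes C: "linear_code F n C" and L: "\<And>i j. i < m \<Longrightarrow> j < n \<Longrightarrow> L (i, j) \<in> carrier F"
  shows "i < m \<Longrightarrow> global_kernel F m (code_mult F n L C) e i = dot n (\<lambda>j. L (i, j)) (global_kernel F n C e)"
proof (induction e rule: arc_induct)
  case (1 e)
  let ?C = "code_mult F n L C"
  have C': "linear_code F m ?C" by (rule code_mult_closed[OF C], rule L)
  have Li: "(\<lambda>j. L (i, j)) \<in> pvec n" using L 1 by auto
  consider "e \<notin> arcs G" | "e \<in> arcs G" "tail G e = s" | "e \<in> arcs G" "tail G e \<noteq> s" by blast
  then show ?case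
  proof cases
    case 1
    then show ?thesis using Li \<open>i < m\<close> by (simp add: global_kernel_no_arc dot_zero_right)
  next
    case 2
    have "global_kernel F m ?C e i = dot n (\<lambda>j. L (i, j)) (\<lambda>j. C s (Imag j) e)"
      using 2 \<open>i < m\<close> by (simp add: global_kernel_source[OF C'] code_mult_source)
    also have "\<dots> = dot n (\<lambda>j. L (i, j)) (global_kernel F n C e)"
      by (rule dot_cong) (use 2 in \<open>auto simp: global_kernel_source[OF C]\<close>)
    finally show ?thesis .
  next
    case 3
    have k: "?C (tail G e) (Edge d) e = C (tail G e) (Edge d) e" for d
      using 3 by (simp add: code_mult_def)
    have c: "C (tail G e) (Edge d) e \<in> carrier F" if "d \<in> in_arcs G (tail G e)" for d
      using linear_code_carrier[OF C, of e "Edge d"] 3 that by (auto simp: In_def)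
    \<comment> \<open>The functional that reads off coordinate \<open>i\<close>, so that
      \<open>dot_global_kernel_inner\<close> applies to a single coordinate.\<close>
    have \<delta>: "(\<lambda>j. if j = i then \<one> else \<zero>) \<in> pvec m" by auto
    have unit: "dot m (\<lambda>j. if j = i then \<one> else \<zero>) (global_kernel F m ?C d) = global_kernel F m ?C d i" for d
      by (rule dot_delta_left[OF \<open>i < m\<close> global_kernel_pvec[OF C']])
    have "global_kernel F m ?C e i = (\<Oplus>d\<in>in_arcs G (tail G e). C (tail G e) (Edge d) e \<otimes> global_kernel F m ?C d i)"
      using dot_global_kernel_inner[OF C' 3 \<delta>] by (simp add: unit k)
    also have "\<dots> = (\<Oplus>d\<in>in_arcs G (tail G e). C (tail G e) (Edge d) e \<otimes> dot n (\<lambda>j. L (i, j)) (global_kernel F n C d))"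
      using "1.IH"[OF 3(1)] \<open>i < m\<close> c Li global_kernel_pvec[OF C] by (intro finsum_cong') auto
    also have "\<dots> = dot n (\<lambda>j. L (i, j)) (global_kernel F n C e)"
      by (rule dot_global_kernel_inner[OF C 3 Li, symmetric])
    finally show ?thesis .
  qed
qed

text \<open>The dual form: a functional \<open>x\<close> for the product code acts on the original
  kernels as \<open>x L\<close>.\<close>

lemma dot_global_kernel_code_mult:
  assumes C: "linear_code F n C" and L: "\<And>i j. i < m \<Longrightarrow> j < n \<Longrightarrow> L (i, j) \<in> carrier F" and x: "x \<in> pvec m"
  shows "dot m x (global_kernel F m (code_mult F n L C) e) = dot n (\<lambda>j. dot m x (\<lambda>i. L (i, j))) (global_kernel F n C e)"
proof (rule dot_row_mult[OF x global_kernel_pvec[OF C]])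
  show "global_kernel F m (code_mult F n L C) e i = dot n (\<lambda>j. L (i, j)) (global_kernel F n C e)" if "i < m" for i
    by (rule global_kernel_code_mult[OF C]) (rule L that; assumption)+
qed (rule L)

text \<open>Decodability in the form that is used: the row vector \<open>y\<close> plays the part of
  a difference of two inputs that a sink cannot tell apart.\<close>

lemma decodable_injective:
  assumes "finite (carrier F)" "linear_code F n C" "decodable F n C" "t \<in> T" "y \<in> pvec n"
    and "\<And>e. e \<in> in_arcs G t \<Longrightarrow> dot n y (global_kernel F n C e) = \<zero>" "i < n"
  shows "y i = \<zero>"
proof (rule rank_full_injective[OF assms(1) _ _ assms(5) _ assms(7)])
  show "global_kernel F n C ` in_arcs G t \<subseteq> vecs F n" using global_kernel_closed[OF assms(2)] by blast
  show "rank_of F n (global_kernel F n C ` in_arcs G t) = n" using assms(3,4) by (simp add: decodable_def)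
qed (use assms(6) in blast)

subsection \<open>A dual criterion for secure codes\<close>

text \<open>Phrased for \<open>C\<close> and \<open>Q\<close> before multiplication by the inverse
  of \<open>Q\<close>. In the coordinates of the multiplied code the columns of \<open>Q\<close>
  become unit vectors, so \<open>y\<close> has the message part of a unit vector.\<close>

definition dual_secure :: "nat \<Rightarrow> nat \<Rightarrow> ('v, 'e, 'f) code \<Rightarrow> (nat \<times> nat \<Rightarrow> 'f) \<Rightarrow> 'e set \<Rightarrow> bool" where
  "dual_secure n w C Q A \<longleftrightarrow> (\<forall>i<w. \<exists>y\<in>pvec n.
     (\<forall>j<w. dot n y (\<lambda>k. Q (k, j)) = (if j = i then \<one> else \<zero>)) \<and>
     (\<forall>e\<in>A. dot n y (global_kernel F n C e) = \<zero>))"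

lemma dual_secure_cut:
  assumes "linear_code F n C" "dual_secure n w C Q X" "edge_cut A X"
  shows "dual_secure n w C Q A"
  unfolding dual_secure_def
proof (intro allI impI)
  fix i assume "i < w"
  then obtain y where "y \<in> pvec n" "\<forall>j<w. dot n y (\<lambda>k. Q (k, j)) = (if j = i then \<one> else \<zero>)"
    "\<forall>e\<in>X. dot n y (global_kernel F n C e) = \<zero>"
    using assms(2) unfolding dual_secure_def by blast
  moreover have "dot n y (global_kernel F n C e) = \<zero>" if "e \<in> A" for e
    by (rule global_kernel_perp_cut[OF assms(1), of y X])
      (use calculation that edge_cut_mono[OF assms(3), of "{e}"] in auto)
  ultimately show "\<exists>y\<in>pvec n. (\<forall>j<w. dot n y (\<lambda>k. Q (k, j)) = (if j = i then \<one> else \<zero>)) \<and>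
     (\<forall>e\<in>A. dot n y (global_kernel F n C e) = \<zero>)" by blast
qed

lemma source_input_vecs:
  "M \<in> vecs F w \<Longrightarrow> K \<in> vecs F r \<Longrightarrow> source_input w r (M, K) \<in> vecs F (w + r)"
  by (auto simp: source_input_def PiE_iff)

lemma symbols_dot:
  "symbols F w r C A MK = (\<lambda>e\<in>A. dot (w + r) (source_input w r MK) (global_kernel F (w + r) C e))"
  by (simp add: symbols_def dot_def)

text \<open>Applied both to the given code and to the shortened one. Decodability is assumed in its
  dual form \<open>dec\<close>, which the shortened code inherits without any computation of
  ranks.\<close>

theorem slnc_code_mult_inv:
  assumes fin: "finite (carrier F)" and C: "linear_code F (w + r) C" and r: "r \<le> card (out_arcs G s)"
    and Q: "Q \<in> Units (mat_monoid F (w + r))"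
    and dec: "\<And>t y i. t \<in> T \<Longrightarrow> y \<in> pvec (w + r) \<Longrightarrow>
      (\<And>e. e \<in> in_arcs G t \<Longrightarrow> dot (w + r) y (global_kernel F (w + r) C e) = \<zero>) \<Longrightarrow> i < w + r \<Longrightarrow> y i = \<zero>"
    and sec: "\<And>A. A \<in> primary_sets r \<Longrightarrow> dual_secure (w + r) w C Q A"
  shows "slnc F w r (code_mult F (w + r) (inv\<^bsub>mat_monoid F (w + r)\<^esub> Q) C)"
proof -
  let ?n = "w + r"
  let ?P = "inv\<^bsub>mat_monoid F ?n\<^esub> Q"
  let ?C = "code_mult F ?n ?P C"
  let ?f = "global_kernel F ?n C" and ?f' = "global_kernel F ?n ?C"
  note cQ = units_entry[OF Q]
  have cP: "\<And>i j. i < ?n \<Longrightarrow> j < ?n \<Longrightarrow> ?P (i, j) \<in> carrier F"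
    using mat_carrier_entry mat_inv(1)[OF Q] by blast
  have C': "linear_code F ?n ?C" by (rule code_mult_closed[OF C], rule cP)
  have dotC: "dot ?n x (?f' e) = dot ?n (\<lambda>j. dot ?n x (\<lambda>i. ?P (i, j))) (?f e)"
    if "x \<in> pvec ?n" for x e
    by (rule dot_global_kernel_code_mult[OF C _ that], rule cP)
  have gk: "?f' e \<in> pvec ?n" for e by (rule global_kernel_pvec[OF C'])
  have sub_closed: "(\<lambda>i. x i \<ominus> \<one> \<otimes> x' i) \<in> pvec ?n" if "x \<in> pvec ?n" "x' \<in> pvec ?n" for x x'
    using that by (auto simp: Pi_iff)
  have dot_diff: "dot ?n (\<lambda>i. x i \<ominus> \<one> \<otimes> x' i) (?f' e) =
      dot ?n x (?f' e) \<ominus> dot ?n x' (?f' e)"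
    if "x \<in> pvec ?n" "x' \<in> pvec ?n" for x x' e
    using dot_sub_left[OF one_closed that gk] that gk by simp
  have diff_0: "a = b" if "a \<ominus> b = \<zero>" "a \<in> carrier F" "b \<in> carrier F" for a b
    using that sum_zero_eq_neg[of a "\<ominus> b"] by (simp add: a_minus_def)
  have src: "source_input w r (M, K) \<in> pvec ?n" if "M \<in> vecs F w" "K \<in> vecs F r" for M K
    using source_input_vecs[OF that] by (rule vecs_pvec)
  \<comment> \<open>The difference \<open>z\<close> of two inputs with equal symbols at
    \<open>t\<close> gives a functional \<open>y = z P\<close> killing all kernels entering
    \<open>t\<close>. By \<open>dec\<close> it is zero, and \<open>z = y Q\<close> is zero with
    it.\<close>
  have inj: "M = M'"
    if t: "t \<in> T" and MK: "M \<in> vecs F w" "K \<in> vecs F r" "M' \<in> vecs F w" "K' \<in> vecs F r"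
      and eq: "symbols F w r ?C (in_arcs G t) (M, K) = symbols F w r ?C (in_arcs G t) (M', K')" for t M K M' K'
  proof -
    let ?x = "source_input w r (M, K)" and ?x' = "source_input w r (M', K')"
    define z where "z = (\<lambda>i. ?x i \<ominus> \<one> \<otimes> ?x' i)"
    have x: "?x \<in> pvec ?n" "?x' \<in> pvec ?n" using src MK by auto
    have z: "z \<in> pvec ?n" unfolding z_def by (rule sub_closed[OF x])
    define y where "y j = dot ?n z (\<lambda>i. ?P (i, j))" for j
    have y: "y \<in> pvec ?n" unfolding y_def using z cP by auto
    have "dot ?n y (?f e) = \<zero>" if e: "e \<in> in_arcs G t" for e
    proof -
      have "dot ?n y (?f e) = dot ?n z (?f' e)"
        unfolding dotC[OF z] y_def ..
      also have "\<dots> = dot ?n ?x (?f' e) \<ominus> dot ?n ?x' (?f' e)"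
        unfolding z_def by (rule dot_diff[OF x])
      also have "\<dots> = \<zero>"
        using fun_cong[OF eq, of e] e x gk by (simp add: symbols_dot a_minus_def r_neg)
      finally show ?thesis .
    qed
    then have y0: "y j = \<zero>" if "j < ?n" for j using dec[OF t y _ that] by blast
    have z0: "z j = \<zero>" if j: "j < ?n" for j
    proof -
      have "z j = dot ?n y (\<lambda>k. Q (k, j))"
        unfolding y_def using row_mult_cancel[OF z j, of ?P Q] cP cQ mat_inv(2)[OF Q] by simp
      also have "\<dots> = \<zero>" using y0 cQ j by (intro dot_zero_left) auto
      finally show ?thesis .
    qed
    have "M j = M' j" if "j < w" for j
    proof (rule diff_0)
      show "M j \<ominus> M' j = \<zero>" "M j \<in> carrier F" "M' j \<in> carrier F"
        using z0[of j] that MK by (auto simp: z_def source_input_def PiE_iff)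
    qed
    then show ?thesis using MK by (intro extensionalityI[of _ "{..<w}"]) (auto simp: PiE_iff)
  qed
  have decoder: "\<exists>decoder. \<forall>M\<in>vecs F w. \<forall>K\<in>vecs F r. decoder (symbols F w r ?C (in_arcs G t) (M, K)) = M"
    if t: "t \<in> T" for t
  proof (intro exI ballI)
    fix M K assume MK: "M \<in> vecs F w" "K \<in> vecs F r"
    \<comment> \<open>The decoder returns the message of any input compatible with the received
      symbols; \<open>inj\<close> makes the answer unique.\<close>
    let ?R = "\<lambda>Y M'. \<exists>K'. M' \<in> vecs F w \<and> K' \<in> vecs F r \<and> symbols F w r ?C (in_arcs G t) (M', K') = Y"
    show "(\<lambda>Y. SOME M'. ?R Y M') (symbols F w r ?C (in_arcs G t) (M, K)) = M"
      by (rule some_equality) (use MK inj[OF t] in \<open>auto dest: sym\<close>)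
  qed
  have finV: "finite (vecs F k)" "vecs F k \<noteq> {}" for k
    using fin by (auto intro!: finite_PiE simp: PiE_eq_empty_iff)
  have mi: "prob_space.mutual_information (source_space F w r) 2
      (count_space (symbols F w r ?C A ` space (source_space F w r)))
      (count_space (fst ` space (source_space F w r))) (symbols F w r ?C A) fst = 0"
    if A: "A \<subseteq> arcs G" "card A \<le> r" for A
  proof -
    obtain X where "X \<in> primary_sets r" "edge_cut A X" using exists_primary_set_cutting[OF A r] by blast
    then have "dual_secure ?n w C Q A" using dual_secure_cut[OF C sec] by blast
    then have "\<forall>i. \<exists>y. i < w \<longrightarrow> y \<in> pvec ?n \<and>
        (\<forall>j<w. dot ?n y (\<lambda>k. Q (k, j)) = (if j = i then \<one> else \<zero>)) \<and>
        (\<forall>e\<in>A. dot ?n y (?f e) = \<zero>)"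
      unfolding dual_secure_def by blast
    then obtain y where y: "\<And>i. i < w \<Longrightarrow> y i \<in> pvec ?n"
      "\<And>i j. i < w \<Longrightarrow> j < w \<Longrightarrow> dot ?n (y i) (\<lambda>k. Q (k, j)) = (if j = i then \<one> else \<zero>)"
      "\<And>i e. i < w \<Longrightarrow> e \<in> A \<Longrightarrow> dot ?n (y i) (?f e) = \<zero>"
      unfolding choice_iff by blast
    define Z where "Z = (\<lambda>i\<in>{..<w}. \<zero>)"
    have Z: "Z \<in> vecs F w" by (auto simp: Z_def)
    have "\<exists>h. bij_betw h (vecs F r) (vecs F r) \<and>
        (\<forall>K\<in>vecs F r. symbols F w r ?C A (M, K) = symbols F w r ?C A (Z, h K))"
      if M: "M \<in> vecs F w" for M
    proof -
      have Mp: "M \<in> pvec w" by (rule vecs_pvec[OF M])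
      \<comment> \<open>The combination of the dual functionals with the entries of \<open>M\<close>
        as coefficients: it takes the value \<open>M j\<close> on the column \<open>b_j\<close> and
        vanishes on \<open>A\<close>. Accordingly \<open>x = u Q\<close> is an input with message
        \<open>M\<close> and zero symbols on \<open>A\<close>; its last \<open>r\<close> entries
        form the key belonging to \<open>M\<close>.\<close>
      define u where "u k = dot w M (\<lambda>i. y i k)" for k
      have u: "u \<in> pvec ?n" unfolding u_def using Mp y(1) by (auto intro!: dot_closed)
      define x where "x j = dot ?n u (\<lambda>k. Q (k, j))" for j
      have x: "x \<in> pvec ?n" unfolding x_def using u cQ by auto
      have x_M: "x j = M j" if j: "j < w" for j
      proof -
        have "x j = dot w M (\<lambda>i. dot ?n (y i) (\<lambda>k. Q (k, j)))"
          unfolding x_def u_def using Mp y(1) cQ j by (intro dot_assoc) auto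
        also have "\<dots> = dot w M (\<lambda>i. if i = j then \<one> else \<zero>)"
          by (rule dot_cong) (use y(2) j in auto)
        finally show ?thesis using dot_delta[OF j Mp] by simp
      qed
      have x_0: "dot ?n x (?f' e) = \<zero>" if e: "e \<in> A" for e
      proof -
        have "dot ?n x (?f' e) = dot ?n u (?f e)"
          unfolding dotC[OF x]
          by (rule dot_cong) (use row_mult_cancel[OF u, of _ Q ?P] cQ cP mat_inv(3)[OF Q] in \<open>auto simp: x_def [abs_def]\<close>)
        also have "\<dots> = dot w M (\<lambda>i. dot ?n (y i) (?f e))"
          unfolding u_def using Mp y(1) global_kernel_pvec[OF C] by (intro dot_assoc) (auto simp: Pi_iff)
        also have "\<dots> = \<zero>" by (rule dot_zero_right[OF Mp]) (rule y(3)[OF _ e])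
        finally show ?thesis .
      qed
      \<comment> \<open>Subtracting \<open>x\<close> from the input \<open>(M, K)\<close> leaves the
        zero message and this shifted key.\<close>
      define h where "h K = (\<lambda>i\<in>{..<r}. K i \<ominus> x (w + i))" for K
      define h' where "h' K = (\<lambda>i\<in>{..<r}. K i \<oplus> x (w + i))" for K
      have "bij_betw h (vecs F r) (vecs F r)"
      proof (rule bij_betw_byWitness[where f' = h'])
        show "h ` vecs F r \<subseteq> vecs F r" "h' ` vecs F r \<subseteq> vecs F r"
          using x by (auto simp: h_def h'_def PiE_iff Pi_iff)
        show "\<forall>K\<in>vecs F r. h' (h K) = K" "\<forall>K\<in>vecs F r. h (h' K) = K"
          using x unfolding h_def h'_def
          by (auto simp: PiE_iff Pi_iff a_minus_def a_assoc l_neg r_neg intro!: extensionalityI[of _ "{..<r}"])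
      qed
      moreover have "symbols F w r ?C A (M, K) = symbols F w r ?C A (Z, h K)" if K: "K \<in> vecs F r" for K
      proof -
        let ?m = "source_input w r (M, K)"
        have mp: "?m \<in> pvec ?n" by (rule src[OF M K])
        have "dot ?n (source_input w r (Z, h K)) (?f' e) = dot ?n ?m (?f' e)"
          if e: "e \<in> A" for e
        proof -
          have "dot ?n (source_input w r (Z, h K)) (?f' e) =
             dot ?n (\<lambda>i. ?m i \<ominus> \<one> \<otimes> x i) (?f' e)"
          proof (rule dot_cong)
            fix i assume i: "i < ?n"
            show "source_input w r (Z, h K) i = ?m i \<ominus> \<one> \<otimes> x i"
              using i x_M[of i] x M by (auto simp: source_input_def Z_def h_def a_minus_def r_neg Pi_iff PiE_iff)
          qed simp
          also have "\<dots> = dot ?n ?m (?f' e) \<ominus> dot ?n x (?f' e)"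
            by (rule dot_diff[OF mp x])
          finally show ?thesis using x_0[OF e] mp gk by (simp add: a_minus_def)
        qed
        then show ?thesis by (auto simp: symbols_dot intro!: restrict_ext)
      qed
      ultimately show ?thesis by blast
    qed
    then show ?thesis
      unfolding source_space_def using finV
      by (intro mutual_information_eq_0_shift[where g = "\<lambda>K. symbols F w r ?C A (Z, K)"]) auto
  qed
  show ?thesis
    unfolding slnc_def using C' decoder mi by blast
qed

end

subsection \<open>Reducing the dimension\<close>

context coeff_field begin

lemma id_append_closed:
  "l \<in> pvec m \<Longrightarrow> i < m \<Longrightarrow> j < Suc m \<Longrightarrow> id_append F m l (i, j) \<in> carrier F"
  by (auto simp: id_append_def)

lemma dot_id_append_row:
  assumes l: "l \<in> pvec m" and z: "z \<in> pvec (Suc m)" and i: "i < m"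
  shows "dot (Suc m) (\<lambda>j. id_append F m l (i, j)) z = z i \<oplus> l i \<otimes> z m"
proof -
  have zm: "z \<in> pvec m" using z by auto
  have "dot m (\<lambda>j. id_append F m l (i, j)) z = dot m (\<lambda>j. if j = i then \<one> else \<zero>) z"
    by (rule dot_cong) (use i in \<open>auto simp: id_append_def\<close>)
  also have "\<dots> = z i" by (rule dot_delta_left[OF i zm])
  finally show ?thesis
    using dot_Suc[of "\<lambda>j. id_append F m l (i, j)" m z] z id_append_closed[OF l i] i
    by (auto simp: id_append_def)
qed

lemma dot_id_append_col:
  assumes l: "l \<in> pvec m" and y: "y \<in> pvec m" and j: "j < Suc m"
  shows "dot m y (\<lambda>i. id_append F m l (i, j)) = (if j < m then y j else dot m y l)"
proof (cases "j < m")
  case True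
  have "dot m y (\<lambda>i. id_append F m l (i, j)) = dot m y (\<lambda>i. if i = j then \<one> else \<zero>)"
    by (rule dot_cong) (use True in \<open>auto simp: id_append_def\<close>)
  then show ?thesis using True dot_delta[OF True y] by simp
next
  case False
  then have "j = m" using j by simp
  then show ?thesis by (auto simp: id_append_def intro: dot_cong)
qed

lemma minus_eq_zeroD: "a \<in> carrier F \<Longrightarrow> b \<in> carrier F \<Longrightarrow> a \<ominus> b = \<zero> \<Longrightarrow> a = b"
  using sum_zero_eq_neg[of a "\<ominus> b"] by (simp add: a_minus_def)

text \<open>The kernel of \<open>[I l] Q\<close> is a line, since that of \<open>[I l]\<close> is spanned by \<open>(l, -1)\<close>.\<close>

lemma kernel_line:
  assumes Q: "Q \<in> Units (mat_monoid F (Suc m))" and l: "l \<in> pvec m"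
    and z: "z \<in> pvec (Suc m)" "\<exists>i<Suc m. z i \<noteq> \<zero>"
    and z0: "\<And>i. i < m \<Longrightarrow> dot (Suc m) (\<lambda>j. Q (i, j)) z \<oplus> l i \<otimes> dot (Suc m) (\<lambda>j. Q (m, j)) z = \<zero>"
  shows "dot (Suc m) (\<lambda>j. Q (m, j)) z \<noteq> \<zero>"
    and "\<And>c. c \<in> pvec (Suc m) \<Longrightarrow>
      (\<And>i. i < m \<Longrightarrow> dot (Suc m) (\<lambda>j. Q (i, j)) c \<oplus> l i \<otimes> dot (Suc m) (\<lambda>j. Q (m, j)) c = \<zero>) \<Longrightarrow>
      \<exists>g\<in>carrier F. \<forall>k<Suc m. c k = g \<otimes> z k"
proof -
  have cQ: "(\<lambda>j. Q (i, j)) \<in> pvec (Suc m)" if "i < Suc m" for i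
    using units_entry[OF Q] that by auto
  \<comment> \<open>When the last coordinate of \<open>Q c\<close> is zero, the equations force the
    others to be zero as well, and \<open>Q\<close> is injective.\<close>
  have zero: "c k = \<zero>"
    if c: "c \<in> pvec (Suc m)" and eq: "\<And>i. i < m \<Longrightarrow> dot (Suc m) (\<lambda>j. Q (i, j)) c \<oplus> l i \<otimes> dot (Suc m) (\<lambda>j. Q (m, j)) c = \<zero>"
      and last: "dot (Suc m) (\<lambda>j. Q (m, j)) c = \<zero>" and k: "k < Suc m" for c k
  proof (rule units_col_injective[OF Q c _ k])
    fix i assume "i < Suc m"
    then show "dot (Suc m) (\<lambda>j. Q (i, j)) c = \<zero>"
      using eq[of i] last l c cQ[of i] by (cases "i = m") (auto simp: Pi_iff)
  qed
  show nz: "dot (Suc m) (\<lambda>j. Q (m, j)) z \<noteq> \<zero>" using zero[OF z(1) z0] z(2) by blast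
  fix c assume c: "c \<in> pvec (Suc m)"
    and c0: "\<And>i. i < m \<Longrightarrow> dot (Suc m) (\<lambda>j. Q (i, j)) c \<oplus> l i \<otimes> dot (Suc m) (\<lambda>j. Q (m, j)) c = \<zero>"
  define qz where "qz i = dot (Suc m) (\<lambda>j. Q (i, j)) z" for i
  define qc where "qc i = dot (Suc m) (\<lambda>j. Q (i, j)) c" for i
  have cl: "qz i \<in> carrier F" "qc i \<in> carrier F" if "i < Suc m" for i
    unfolding qz_def qc_def using cQ[OF that] z(1) c by auto
  have U: "qz m \<in> Units F" using nz cl[of m] by (simp add: qz_def field_Units)
  \<comment> \<open>Chosen so that the last coordinate of \<open>Q (c - g z)\<close>
    vanishes.\<close>
  define g where "g = qc m \<otimes> inv (qz m)"
  have g: "g \<in> carrier F" using cl[of m] U by (simp add: g_def)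
  have gq: "g \<otimes> qz m = qc m" using cl[of m] U by (simp add: g_def m_assoc)
  define d where "d k = c k \<ominus> g \<otimes> z k" for k
  have d: "d \<in> pvec (Suc m)" using c z(1) g by (auto simp: d_def Pi_iff)
  have qd: "dot (Suc m) (\<lambda>j. Q (i, j)) d = qc i \<ominus> g \<otimes> qz i" if "i < Suc m" for i
    unfolding d_def qz_def qc_def by (rule dot_sub_right[OF g c z(1) cQ[OF that]])
  have li: "l i \<in> carrier F" if "i < m" for i using l that by auto
  have neg: "qc i = \<ominus> (l i \<otimes> qc m)" "qz i = \<ominus> (l i \<otimes> qz m)" if "i < m" for i
    using c0[OF that] z0[OF that] cl[of i] cl[of m] li[OF that] that
    by (auto simp: qc_def qz_def intro!: sum_zero_eq_neg)
  have "qc i \<ominus> g \<otimes> qz i = \<zero>" if "i < Suc m" for i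
  proof (cases "i = m")
    case True
    then show ?thesis using gq cl[of m] by (simp add: a_minus_def r_neg)
  next
    case False
    then have i: "i < m" using that by simp
    have "g \<otimes> qz i = \<ominus> (l i \<otimes> (g \<otimes> qz m))"
      unfolding neg(2)[OF i] using g li[OF i] cl[of m] by (simp add: r_minus m_lcomm)
    then show ?thesis using gq neg(1)[OF i] cl[of i] that by (simp add: a_minus_def r_neg)
  qed
  then have "dot (Suc m) (\<lambda>j. Q (i, j)) d = \<zero>" if "i < Suc m" for i using qd that by simp
  then have d0: "d k = \<zero>" if "k < Suc m" for k using units_col_injective[OF Q d _ that] by blast
  have "c k = g \<otimes> z k" if "k < Suc m" for k
    by (rule minus_eq_zeroD) (use d0[OF that] that c z(1) g in \<open>auto simp: d_def\<close>)
  then show "\<exists>g\<in>carrier F. \<forall>k<Suc m. c k = g \<otimes> z k" using g by blast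
qed

lemma dot_support:
  assumes "S \<subseteq> {..<n}" "x \<in> pvec n" "c \<in> pvec n" "\<And>k. k < n \<Longrightarrow> k \<notin> S \<Longrightarrow> c k = \<zero>"
  shows "dot n x c = (\<Oplus>k\<in>S. x k \<otimes> c k)"
  unfolding dot_def
  by (rule add.finprod_mono_neutral_cong_right[unfolded finsum_def[symmetric]]) (use assms in \<open>auto simp: Pi_iff subset_iff\<close>)

text \<open>A dependence among the truncated columns without \<open>i0\<close>, extended by zeros,
  lies in the kernel of the first \<open>m\<close> rows of \<open>Q\<close> and is thus a multiple
  \<open>g z\<close>. If \<open>z i0\<close> is nonzero, the zero at \<open>i0\<close> forces
  \<open>g = 0\<close>; otherwise \<open>z\<close> vanishes on all of the first \<open>w\<close>
  coordinates, and so does the dependence.\<close>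

lemma chosen_independent:
  assumes Q: "Q \<in> Units (mat_monoid F (Suc m))"
    and z: "z \<in> pvec (Suc m)" "\<exists>i<Suc m. z i \<noteq> \<zero>"
    and z0: "\<And>i. i < m \<Longrightarrow> dot (Suc m) (\<lambda>j. Q (i, j)) z = \<zero>"
    and w: "w \<le> Suc m" and i0: "z i0 \<noteq> \<zero> \<or> (\<forall>i<w. z i = \<zero>)" "i0 < w"
  shows "\<not> lin_dep_family F m (\<lambda>i. restrict (mat_col (Suc m) Q i) {..<m}) ({..<w} - {i0})"
proof
  let ?J = "{..<w} - {i0}"
  interpret V: module F "vec_sp F m" by (rule vec_sp_module)
  note cQ = units_entry[OF Q]
  assume "lin_dep_family F m (\<lambda>i. restrict (mat_col (Suc m) Q i) {..<m}) ?J"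
  then obtain a where a: "a \<in> Pi ?J (\<lambda>_. carrier F)"
    and sum0: "(\<Oplus>\<^bsub>vec_sp F m\<^esub>j\<in>?J. a j \<odot>\<^bsub>vec_sp F m\<^esub> restrict (mat_col (Suc m) Q j) {..<m}) = \<zero>\<^bsub>vec_sp F m\<^esub>"
    and nz: "\<exists>j\<in>?J. a j \<noteq> \<zero>"
    unfolding lin_dep_family_def by blast
  define c where "c k = (if k \<in> ?J then a k else \<zero>)" for k
  have c: "c \<in> pvec (Suc m)" using a by (auto simp: c_def)
  have Jsub: "?J \<subseteq> {..<Suc m}" using w by auto
  have "dot (Suc m) (\<lambda>j. Q (i, j)) c = \<zero>" if i: "i < m" for i
  proof -
    have mem: "a j \<odot>\<^bsub>vec_sp F m\<^esub> restrict (mat_col (Suc m) Q j) {..<m} \<in> vecs F m" if "j \<in> ?J" for j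
      using a that cQ Jsub by (auto simp: vec_sp_simps mat_col_def Pi_iff)
    have "\<zero> = (\<Oplus>\<^bsub>vec_sp F m\<^esub>j\<in>?J. a j \<odot>\<^bsub>vec_sp F m\<^esub> restrict (mat_col (Suc m) Q j) {..<m}) i"
      unfolding sum0 using i by (simp add: vec_sp_simps)
    also have "\<dots> = (\<Oplus>j\<in>?J. (a j \<odot>\<^bsub>vec_sp F m\<^esub> restrict (mat_col (Suc m) Q j) {..<m}) i)"
      using mem i by (subst finsum_vec_sp) auto
    also have "\<dots> = (\<Oplus>j\<in>?J. Q (i, j) \<otimes> c j)"
    proof (rule finsum_cong')
      fix j assume j: "j \<in> ?J"
      then show "(a j \<odot>\<^bsub>vec_sp F m\<^esub> restrict (mat_col (Suc m) Q j) {..<m}) i = Q (i, j) \<otimes> c j"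
        using i a cQ[of i j] Jsub by (auto simp: vec_sp_simps mat_col_def c_def Pi_iff m_comm)
    next
      show "(\<lambda>j. Q (i, j) \<otimes> c j) \<in> Pi ?J (\<lambda>_. carrier F)"
      proof (rule Pi_I)
        fix j assume "j \<in> ?J"
        then have "j < Suc m" using Jsub by auto
        then show "Q (i, j) \<otimes> c j \<in> carrier F" using cQ[of i j] c i by auto
      qed
    qed simp
    also have "\<dots> = dot (Suc m) (\<lambda>j. Q (i, j)) c"
      by (rule dot_support[symmetric]) (use Jsub cQ c i in \<open>auto simp: c_def\<close>)
    finally show ?thesis by simp
  qed
  moreover have "dot (Suc m) (\<lambda>j. Q (m, j)) x \<in> carrier F" if "x \<in> pvec (Suc m)" for x
    using cQ that by (intro dot_closed) auto
  \<comment> \<open>Truncation is multiplication by \<open>[I l]\<close> with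
    \<open>l = 0\<close>.\<close>
  ultimately obtain g where g: "g \<in> carrier F" "\<And>k. k < Suc m \<Longrightarrow> c k = g \<otimes> z k"
    using kernel_line(2)[OF Q, of "\<lambda>_. \<zero>" z c] z z0 c by auto
  have "a j = \<zero>" if j: "j \<in> ?J" for j
  proof -
    have aj: "a j = g \<otimes> z j" using g(2)[of j] j Jsub by (auto simp: c_def)
    show ?thesis
    proof (cases "z i0 = \<zero>")
      case True
      then have "z j = \<zero>" using i0(1) j by blast
      then show ?thesis using aj g(1) by simp
    next
      case False
      have "c i0 = \<zero>" by (simp add: c_def)
      moreover have "c i0 = g \<otimes> z i0" using g(2) i0(2) w by simp
      ultimately have "g \<otimes> z i0 = \<zero>" by simp
      moreover have "z i0 \<in> carrier F" "z j \<in> carrier F" using z(1) i0 w j Jsub by auto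
      ultimately have "g = \<zero>" using False g(1) integral by blast
      then show ?thesis using aj \<open>z j \<in> carrier F\<close> by simp
    qed
  qed
  then show False using nz by blast
qed

text \<open>The vector \<open>u = Q z\<close> is the multiple of \<open>(l, -1)\<close> with last
  entry \<open>u m\<close>, which is nonzero, so \<open>h\<close> does not vanish at
  \<open>u\<close>. But \<open>h(u)\<close> is the sum of the \<open>h(b_j) z j\<close>, whose terms
  with \<open>j \<in> J\<close> are zero.\<close>

lemma dropped_column_exists:
  assumes Q: "Q \<in> Units (mat_monoid F (Suc m))" and l: "l \<in> pvec m"
    and z: "z \<in> pvec (Suc m)" "\<exists>i<Suc m. z i \<noteq> \<zero>"
    and z0: "\<And>i. i < m \<Longrightarrow> dot (Suc m) (\<lambda>j. Q (i, j)) z \<oplus> l i \<otimes> dot (Suc m) (\<lambda>j. Q (m, j)) z = \<zero>"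
    and h: "h \<in> pvec (Suc m)" "\<And>j. j \<in> J \<Longrightarrow> dot (Suc m) h (\<lambda>k. Q (k, j)) = \<zero>" "dot m h l \<noteq> h m"
  shows "\<exists>i<Suc m. i \<notin> J \<and> z i \<noteq> \<zero>"
proof (rule ccontr)
  assume neg: "\<not> ?thesis"
  note cQ = units_entry[OF Q]
  define u where "u i = dot (Suc m) (\<lambda>j. Q (i, j)) z" for i
  have u: "u \<in> pvec (Suc m)" unfolding u_def using cQ z by auto
  have um: "u m \<noteq> \<zero>" using kernel_line(1)[OF Q l z z0] by (simp add: u_def)
  have hm: "h \<in> pvec m" "h m \<in> carrier F" "u m \<in> carrier F" using h u by auto
  have "\<zero> = dot (Suc m) (\<lambda>j. dot (Suc m) h (\<lambda>k. Q (k, j))) z"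
  proof -
    have "dot (Suc m) h (\<lambda>k. Q (k, j)) \<otimes> z j = \<zero>" if j: "j < Suc m" for j
    proof -
      have "dot (Suc m) h (\<lambda>k. Q (k, j)) \<in> carrier F" "z j \<in> carrier F" using h(1) cQ j z by auto
      then show ?thesis using neg h(2)[of j] j by (cases "j \<in> J") auto
    qed
    then show ?thesis by (simp add: dot_def finsum_zero cong: finsum_cong)
  qed
  also have "\<dots> = dot (Suc m) h u"
    unfolding u_def using h(1) cQ z by (intro dot_assoc) auto
  also have "\<dots> = dot m h u \<oplus> h m \<otimes> u m" by (rule dot_Suc[OF h(1) u])
  \<comment> \<open>The kernel equations say that \<open>u i\<close> is minus \<open>u m\<close>
    times \<open>l i\<close>.\<close>
  also have "dot m h u = dot m h (\<lambda>i. (\<ominus> u m) \<otimes> l i)"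
  proof (rule dot_cong)
    fix i assume i: "i < m"
    then have "u i \<oplus> l i \<otimes> u m = \<zero>" using z0[OF i] by (simp add: u_def)
    moreover have "u i \<in> carrier F" "l i \<in> carrier F" using i u l by auto
    ultimately show "u i = (\<ominus> u m) \<otimes> l i"
      using sum_zero_eq_neg[of "u i" "l i \<otimes> u m"] hm l_minus[of "u m" "l i"] m_comm[of "u m" "l i"] by simp
  qed simp
  also have "\<dots> = (\<ominus> u m) \<otimes> dot m h l" using hm l by (intro dot_smult_right) auto
  finally have "h m \<otimes> u m = u m \<otimes> dot m h l"
    using hm l minus_eq_zeroD[of "h m \<otimes> u m" "u m \<otimes> dot m h l"] by (simp add: l_minus a_minus_def a_comm)
  then have "u m \<otimes> h m = u m \<otimes> dot m h l" using hm by (simp add: m_comm)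
  then have "h m = dot m h l" using um hm l m_lcancel[of "u m" "h m" "dot m h l"] by auto
  then show False using h(3) by simp
qed

text \<open>A kernel vector of the remaining columns, extended by zero at \<open>i1\<close>, is a
  multiple of \<open>z\<close>, and \<open>z i1\<close> being nonzero makes the multiplier
  zero.\<close>

lemma remaining_columns_unit:
  assumes fin: "finite (carrier F)" and Q: "Q \<in> Units (mat_monoid F (Suc m))" and l: "l \<in> pvec m"
    and z: "z \<in> pvec (Suc m)" "z i1 \<noteq> \<zero>" "i1 < Suc m"
    and z0: "\<And>i. i < m \<Longrightarrow> dot (Suc m) (\<lambda>j. Q (i, j)) z \<oplus> l i \<otimes> dot (Suc m) (\<lambda>j. Q (m, j)) z = \<zero>"
    and col: "bij_betw col {..<m} ({..<Suc m} - {i1})"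
    and Q': "Q' \<in> carrier (mat_monoid F m)"
      "\<And>i j. i < m \<Longrightarrow> j < m \<Longrightarrow> Q' (i, j) = Q (i, col j) \<oplus> l i \<otimes> Q (m, col j)"
  shows "Q' \<in> Units (mat_monoid F m)"
proof (rule mat_unitI[OF fin Q'(1)])
  fix c j assume c: "c \<in> vecs F m" and c0: "\<And>i. i < m \<Longrightarrow> dot m (\<lambda>j. Q' (i, j)) c = \<zero>" and j: "j < m"
  note cQ = units_entry[OF Q]
  have cp: "c \<in> pvec m" by (rule vecs_pvec[OF c])
  \<comment> \<open>The entries of \<open>c\<close> at the positions listed by \<open>col\<close>,
    and zero at the omitted column.\<close>
  define c' where "c' k = (if k \<in> {..<Suc m} - {i1} then c (the_inv_into {..<m} col k) else \<zero>)" for k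
  have inj: "inj_on col {..<m}" and im: "col ` {..<m} = {..<Suc m} - {i1}"
    using col by (auto simp: bij_betw_def)
  have col_lt: "col k < Suc m" if "k < m" for k using im that by auto
  have c'_col: "c' (col k) = c k" if "k < m" for k
    using that im the_inv_into_f_f[OF inj, of k] by (auto simp: c'_def)
  have c': "c' \<in> pvec (Suc m)"
  proof
    fix k assume "k \<in> {..<Suc m}"
    show "c' k \<in> carrier F"
    proof (cases "k \<in> col ` {..<m}")
      case True
      then show ?thesis using c'_col cp by auto
    next
      case False
      then show ?thesis unfolding im by (auto simp: c'_def)
    qed
  qed
  have dotc': "dot (Suc m) x c' = dot m (\<lambda>j. x (col j)) c" if x: "x \<in> pvec (Suc m)" for x
  proof -
    have "dot (Suc m) x c' = (\<Oplus>k\<in>col ` {..<m}. x k \<otimes> c' k)"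
      by (rule dot_support) (use x c' im in \<open>auto simp: c'_def\<close>)
    also have "\<dots> = (\<Oplus>j\<in>{..<m}. x (col j) \<otimes> c' (col j))"
      by (rule finsum_reindex[OF _ inj]) (use x c' im in auto)
    also have "\<dots> = dot m (\<lambda>j. x (col j)) c"
      unfolding dot_def by (rule finsum_fundef_cong) (use c'_col in auto)
    finally show ?thesis .
  qed
  have "dot (Suc m) (\<lambda>j. Q (i, j)) c' \<oplus> l i \<otimes> dot (Suc m) (\<lambda>j. Q (m, j)) c' = \<zero>" if i: "i < m" for i
  proof -
    have li: "l i \<in> carrier F" using l i by auto
    have p: "(\<lambda>j. Q (i, col j)) \<in> pvec m" "(\<lambda>j. Q (m, col j)) \<in> pvec m"
      using cQ col_lt i by auto
    have "\<zero> = dot m (\<lambda>j. Q' (i, j)) c" using c0[OF i] by simp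
    also have "\<dots> = dot m (\<lambda>j. Q (i, col j) \<oplus> l i \<otimes> Q (m, col j)) c"
      by (rule dot_cong) (use Q'(2) i in auto)
    also have "\<dots> = dot m (\<lambda>j. Q (i, col j)) c \<oplus> l i \<otimes> dot m (\<lambda>j. Q (m, col j)) c"
      using p li cp by (subst dot_add_left) (auto simp: dot_smult_left)
    finally show ?thesis using dotc' cQ i by simp
  qed
  then obtain g where g: "g \<in> carrier F" "\<And>k. k < Suc m \<Longrightarrow> c' k = g \<otimes> z k"
    using kernel_line(2)[OF Q l z(1) _ z0 c'] z by blast
  have "g \<otimes> z i1 = \<zero>" using g(2)[OF z(3)] by (simp add: c'_def)
  moreover have "z i1 \<in> carrier F" using z by auto
  ultimately have "g = \<zero>" using z(2) g(1) integral by blast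
  moreover have "z (col j) \<in> carrier F" using z(1) col_lt[OF j] by auto
  ultimately have "c' (col j) = \<zero>" using g(2)[OF col_lt[OF j]] by simp
  then show "c j = \<zero>" using c'_col[OF j] by simp
qed

end

context coded_network begin

text \<open>A functional \<open>h\<close> killing the chosen columns and the kernels of \<open>A\<close> but not \<open>(l, -1)\<close> serves to
  correct the dual functionals of the given code so that they factor through \<open>[I l]\<close>.\<close>

lemma dual_secure_reduced:
  assumes C: "linear_code F (Suc m) C" and l: "l \<in> pvec m"
    and Q: "\<And>i j. i < Suc m \<Longrightarrow> j < Suc m \<Longrightarrow> Q (i, j) \<in> carrier F"
    and sec: "dual_secure (Suc m) w C Q A"
    and h: "h \<in> pvec (Suc m)" "\<And>j. j < w' \<Longrightarrow> dot (Suc m) h (\<lambda>k. Q (k, col j)) = \<zero>"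
      "\<And>e. e \<in> A \<Longrightarrow> dot (Suc m) h (global_kernel F (Suc m) C e) = \<zero>" "dot m h l \<noteq> h m"
    and col: "inj_on col {..<w'}" "\<And>j. j < w' \<Longrightarrow> col j < w" and w: "w \<le> Suc m" and w': "w' \<le> m"
    and Q': "\<And>i j. i < m \<Longrightarrow> j < w' \<Longrightarrow> Q' (i, j) = Q (i, col j) \<oplus> l i \<otimes> Q (m, col j)"
  shows "dual_secure m w' (code_mult F (Suc m) (id_append F m l) C) Q' A"
  unfolding dual_secure_def
proof (intro allI impI)
  let ?L = "id_append F m l"
  fix i assume i: "i < w'"
  obtain y0 where y0: "y0 \<in> pvec (Suc m)"
    "\<And>j. j < w \<Longrightarrow> dot (Suc m) y0 (\<lambda>k. Q (k, j)) = (if j = col i then \<one> else \<zero>)"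
    "\<And>e. e \<in> A \<Longrightarrow> dot (Suc m) y0 (global_kernel F (Suc m) C e) = \<zero>"
    using sec[unfolded dual_secure_def, rule_format, OF col(2)[OF i]]
    by (elim bexE conjE) (rule that, auto)
  \<comment> \<open>\<open>D x\<close> is the value of the functional \<open>x\<close> at
    \<open>(l, -1)\<close>; \<open>a\<close> is chosen so that the corrected functional
    \<open>y\<close> vanishes there.\<close>
  define D where "D x = dot m x l \<ominus> x m" for x
  have D: "D x \<in> carrier F" if "x \<in> pvec (Suc m)" for x
  proof -
    have "x \<in> pvec m" "x m \<in> carrier F" using that by auto
    then show ?thesis using l by (simp add: D_def)
  qed
  have "h \<in> pvec m" "h m \<in> carrier F" using h(1) by auto
  then have "D h \<noteq> \<zero>" using h(4) l minus_eq_zeroD[of "dot m h l" "h m"] by (auto simp: D_def)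
  then have U: "D h \<in> Units F" using D[OF h(1)] by (simp add: field_Units)
  define a where "a = D y0 \<otimes> inv (D h)"
  have a: "a \<in> carrier F" using D y0(1) U by (simp add: a_def)
  have aD: "a \<otimes> D h = D y0" using D y0(1) h(1) U by (simp add: a_def m_assoc)
  define y where "y k = y0 k \<ominus> a \<otimes> h k" for k
  have y: "y \<in> pvec (Suc m)" using y0(1) h(1) a by (auto simp: y_def Pi_iff)
  have ym: "y \<in> pvec m" using y by auto
  have doty: "dot (Suc m) y x = dot (Suc m) y0 x \<ominus> a \<otimes> dot (Suc m) h x" if "x \<in> pvec (Suc m)" for x
    unfolding y_def by (rule dot_sub_left[OF a y0(1) h(1) that])
  \<comment> \<open>This is \<open>D y = 0\<close>, the condition for \<open>y\<close> to factor:
    its first \<open>m\<close> coefficients followed by \<open>[I l]\<close> are all of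
    \<open>y\<close>.\<close>
  have "dot m y l = y m"
  proof (rule minus_eq_zeroD)
    have p: "y0 \<in> pvec m" "h \<in> pvec m" "y0 m \<in> carrier F" "h m \<in> carrier F" using y0(1) h(1) by auto
    have dl: "dot m y l = dot m y0 l \<ominus> a \<otimes> dot m h l"
      unfolding y_def by (rule dot_sub_left[OF a p(1,2) l])
    have c: "dot m y0 l \<in> carrier F" "dot m h l \<in> carrier F" using p l by auto
    have "dot m y l \<ominus> y m = D y0 \<ominus> a \<otimes> D h"
      unfolding dl unfolding y_def D_def using p a c by algebra
    then show "dot m y l \<ominus> y m = \<zero>" using aD D[OF y0(1)] by (simp add: a_minus_def r_neg)
  qed (use ym y l in auto)
  then have yL: "dot m y (\<lambda>i. ?L (i, j)) = y j" if "j < Suc m" for j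
    using dot_id_append_col[OF l ym that] that by (cases "j < m") (auto simp: less_Suc_eq)
  have push: "dot (Suc m) (\<lambda>j. dot m y (\<lambda>i. ?L (i, j))) x = dot (Suc m) y x" for x
    by (rule dot_cong) (use yL in auto)
  have Lc: "?L (i, j) \<in> carrier F" if "i < m" "j < Suc m" for i j
    by (rule id_append_closed[OF l that])
  have "dot m y (global_kernel F m (code_mult F (Suc m) ?L C) e) = \<zero>" if e: "e \<in> A" for e
  proof -
    have "dot m y (global_kernel F m (code_mult F (Suc m) ?L C) e) = dot (Suc m) y (global_kernel F (Suc m) C e)"
      unfolding push[symmetric] by (rule dot_global_kernel_code_mult[OF C _ ym], rule Lc)
    then show ?thesis
      using doty[OF global_kernel_pvec[OF C]] y0(3)[OF e] h(3)[OF e] a by (simp add: a_minus_def)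
  qed
  moreover have "dot m y (\<lambda>k. Q' (k, j)) = (if j = i then \<one> else \<zero>)" if j: "j < w'" for j
  proof -
    have cj: "col j < Suc m" using col(2)[OF j] w by simp
    have q: "(\<lambda>k. Q (k, col j)) \<in> pvec (Suc m)" using Q cj by auto
    have "dot m y (\<lambda>k. Q' (k, j)) = dot (Suc m) (\<lambda>j. dot m y (\<lambda>i. ?L (i, j))) (\<lambda>k. Q (k, col j))"
    proof (rule dot_row_mult[OF ym q])
      show "?L (k, j) \<in> carrier F" if "k < m" "j < Suc m" for k j by (rule Lc[OF that])
      fix k assume k: "k < m"
      show "Q' (k, j) = dot (Suc m) (\<lambda>j. ?L (k, j)) (\<lambda>k. Q (k, col j))"
        using Q'[OF k j] dot_id_append_row[OF l q k] by simp
    qed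
    also have "\<dots> = dot (Suc m) y0 (\<lambda>k. Q (k, col j)) \<ominus> a \<otimes> dot (Suc m) h (\<lambda>k. Q (k, col j))"
      unfolding push by (rule doty[OF q])
    also have "\<dots> = (if col j = col i then \<one> else \<zero>)"
      using y0(2)[OF col(2)[OF j]] h(2)[OF j] a by (simp add: a_minus_def)
    finally show ?thesis using inj_onD[OF col(1), of j i] i j by auto
  qed
  ultimately show "\<exists>y\<in>pvec m. (\<forall>j<w'. dot m y (\<lambda>k. Q' (k, j)) = (if j = i then \<one> else \<zero>)) \<and>
     (\<forall>e\<in>A. dot m y (global_kernel F m (code_mult F (Suc m) ?L C) e) = \<zero>)"
    using ym by blast
qed

text \<open>The first \<open>m\<close> entries of \<open>y [I l]\<close> are those of
  \<open>y\<close>, and \<open>y [I l]\<close> kills the kernels of the given code entering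
  \<open>t\<close>.\<close>

lemma reduced_injective:
  assumes fin: "finite (carrier F)" and C: "linear_code F (Suc m) C" and dec: "decodable F (Suc m) C"
    and l: "l \<in> pvec m" and t: "t \<in> T" and y: "y \<in> pvec m"
    and 0: "\<And>e. e \<in> in_arcs G t \<Longrightarrow> dot m y (global_kernel F m (code_mult F (Suc m) (id_append F m l) C) e) = \<zero>"
    and i: "i < m"
  shows "y i = \<zero>"
proof -
  let ?L = "id_append F m l"
  let ?y = "\<lambda>j. dot m y (\<lambda>i. ?L (i, j))"
  have Lc: "?L (i, j) \<in> carrier F" if "i < m" "j < Suc m" for i j
    by (rule id_append_closed[OF l that])
  have "?y i = \<zero>"
  proof (rule decodable_injective[OF fin C dec t])
    show "?y \<in> pvec (Suc m)" using y Lc by auto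
    fix e assume e: "e \<in> in_arcs G t"
    have "dot (Suc m) ?y (global_kernel F (Suc m) C e) = dot m y (global_kernel F m (code_mult F (Suc m) ?L C) e)"
      by (rule dot_global_kernel_code_mult[OF C _ y, symmetric], rule Lc)
    then show "dot (Suc m) ?y (global_kernel F (Suc m) C e) = \<zero>" using 0[OF e] by simp
  qed (use i in simp)
  then show ?thesis using dot_id_append_col[OF l y, of i] i by simp
qed

end

section \<open>The algorithm\<close>

subsection \<open>Composing computation trees\<close>

primrec bind_tree :: "('x, 'a) comp_tree \<Rightarrow> ('a \<Rightarrow> ('x, 'b) comp_tree) \<Rightarrow> ('x, 'b) comp_tree" where
  "bind_tree (Return x) f = f x"
| "bind_tree (Compute p t) f = Compute p (\<lambda>x. bind_tree (t x) f)"
| "bind_tree (Test x y t) f = Test x y (\<lambda>b. bind_tree (t b) f)"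

definition operation :: "'x field_op \<Rightarrow> ('x, 'x) comp_tree" where
  "operation p = Compute p Return"

text \<open>Unlike \<open>run\<close>, \<open>exec\<close> also returns the next free temporary, which sequential composition needs.\<close>

primrec exec ::
  "'f ring \<Rightarrow> (('v, 'e) address, 'r) comp_tree \<Rightarrow> (('v, 'e) address \<Rightarrow> 'f) \<Rightarrow> nat \<Rightarrow>
     'r \<times> (('v, 'e) address \<Rightarrow> 'f) \<times> nat \<times> nat" where
  "exec F (Return x) \<sigma> k = (x, \<sigma>, k, 0)"
| "exec F (Compute p t) \<sigma> k =
     (let (x, \<sigma>', k', c) = exec F (t (Temp k)) (\<sigma>(Temp k := op_value F \<sigma> p)) (Suc k)
      in (x, \<sigma>', k', c + op_cost p))"
| "exec F (Test x y t) \<sigma> k =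
     (let (z, \<sigma>', k', c) = exec F (t (\<sigma> x = \<sigma> y)) \<sigma> k in (z, \<sigma>', k', c + 1))"

lemma run_exec: "run F t \<sigma> k = (case exec F t \<sigma> k of (x, \<sigma>', k', c) \<Rightarrow> (x, \<sigma>', c))"
  by (induction t arbitrary: \<sigma> k) (auto simp: Let_def split: prod.split)

lemma exec_bind_tree:
  "exec F (bind_tree t f) \<sigma> k =
     (case exec F t \<sigma> k of (x, \<sigma>', k', c) \<Rightarrow>
      case exec F (f x) \<sigma>' k' of (y, \<sigma>'', k'', c') \<Rightarrow> (y, \<sigma>'', k'', c' + c))"
  by (induction t arbitrary: \<sigma> k) (auto simp: Let_def split: prod.split)

fun allocated :: "nat \<Rightarrow> ('v, 'e) address \<Rightarrow> bool" where
  "allocated k (Temp j) \<longleftrightarrow> j < k"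
| "allocated k x \<longleftrightarrow> True"

text \<open>Programs write only to unallocated temporaries, so what was readable stays readable with
  the same contents. This replaces any reasoning about frames.\<close>

definition extends :: "nat \<Rightarrow> (('v, 'e) address \<Rightarrow> 'f) \<Rightarrow> nat \<Rightarrow> (('v, 'e) address \<Rightarrow> 'f) \<Rightarrow> bool" where
  "extends k \<sigma> k' \<sigma>' \<longleftrightarrow> k \<le> k' \<and> (\<forall>x. allocated k x \<longrightarrow> \<sigma>' x = \<sigma> x)"

lemma allocated_mono: "allocated k x \<Longrightarrow> k \<le> k' \<Longrightarrow> allocated k' x"
  by (cases x) auto

lemma extends_refl [simp, intro]: "extends k \<sigma> k \<sigma>"
  by (simp add: extends_def)

lemma extends_trans: "extends k \<sigma> k' \<sigma>' \<Longrightarrow> extends k' \<sigma>' k'' \<sigma>'' \<Longrightarrow> extends k \<sigma> k'' \<sigma>''"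
  unfolding extends_def using allocated_mono by (metis order_trans)

text \<open>A total-correctness triple for one fixed initial store, with the cost bound
  \<open>c\<close> and preservation of the old contents built in.\<close>

definition spec ::
  "'f ring \<Rightarrow> (('v, 'e) address, 'r) comp_tree \<Rightarrow> (('v, 'e) address \<Rightarrow> 'f) \<Rightarrow> nat \<Rightarrow> nat \<Rightarrow>
     ('r \<Rightarrow> (('v, 'e) address \<Rightarrow> 'f) \<Rightarrow> nat \<Rightarrow> bool) \<Rightarrow> bool" where
  "spec F t \<sigma> k c \<Phi> \<longleftrightarrow>
     (case exec F t \<sigma> k of (x, \<sigma>', k', c') \<Rightarrow> c' \<le> c \<and> extends k \<sigma> k' \<sigma>' \<and> \<Phi> x \<sigma>' k')"

lemma spec_Return: "\<Phi> x \<sigma> k \<Longrightarrow> spec F (Return x) \<sigma> k c \<Phi>"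
  by (simp add: spec_def)

lemma spec_mono:
  "spec F t \<sigma> k c \<Phi> \<Longrightarrow> c \<le> c' \<Longrightarrow> (\<And>x \<sigma>' k'. extends k \<sigma> k' \<sigma>' \<Longrightarrow> \<Phi> x \<sigma>' k' \<Longrightarrow> \<Psi> x \<sigma>' k') \<Longrightarrow> spec F t \<sigma> k c' \<Psi>"
  by (auto simp: spec_def split: prod.splits)

lemma spec_bind:
  assumes "spec F t \<sigma> k c1 \<Psi>"
    and "\<And>x \<sigma>' k'. extends k \<sigma> k' \<sigma>' \<Longrightarrow> \<Psi> x \<sigma>' k' \<Longrightarrow> spec F (f x) \<sigma>' k' c2 \<Phi>"
    and "c1 + c2 \<le> c"
  shows "spec F (bind_tree t f) \<sigma> k c \<Phi>"
proof -
  obtain x \<sigma>' k' c' where e: "exec F t \<sigma> k = (x, \<sigma>', k', c')" by (cases "exec F t \<sigma> k")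
  then have 1: "c' \<le> c1" "extends k \<sigma> k' \<sigma>'" "\<Psi> x \<sigma>' k'" using assms(1) by (auto simp: spec_def)
  obtain y \<sigma>'' k'' c'' where e': "exec F (f x) \<sigma>' k' = (y, \<sigma>'', k'', c'')" by (cases "exec F (f x) \<sigma>' k'")
  then have "c'' \<le> c2" "extends k' \<sigma>' k'' \<sigma>''" "\<Phi> y \<sigma>'' k''"
    using assms(2)[OF 1(2,3)] by (auto simp: spec_def)
  then show ?thesis
    using 1 assms(3) extends_trans by (fastforce simp: spec_def exec_bind_tree e e')
qed

text \<open>The conjunct \<open>allocated\<close> is what lets the fact outlive later
  writes.\<close>

definition reads :: "(('v, 'e) address \<Rightarrow> 'f) \<Rightarrow> nat \<Rightarrow> ('v, 'e) address \<Rightarrow> 'f \<Rightarrow> bool" where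
  "reads \<sigma> k x a \<longleftrightarrow> allocated k x \<and> \<sigma> x = a"

abbreviation reads_vec where
  "reads_vec d \<sigma> k v x \<equiv> \<forall>i<d. reads \<sigma> k (v i) (x i)"

lemma reads_extends: "reads \<sigma> k x a \<Longrightarrow> extends k \<sigma> k' \<sigma>' \<Longrightarrow> reads \<sigma>' k' x a"
  by (auto simp: reads_def extends_def allocated_mono)

lemma reads_vec_extends: "reads_vec d \<sigma> k v x \<Longrightarrow> extends k \<sigma> k' \<sigma>' \<Longrightarrow> reads_vec d \<sigma>' k' v x"
  by (auto intro: reads_extends)

lemma spec_operation: "op_cost p \<le> c \<Longrightarrow> spec F (operation p) \<sigma> k c (\<lambda>x \<sigma>' k'. reads \<sigma>' k' x (op_value F \<sigma> p))"
  by (auto simp: operation_def spec_def reads_def extends_def)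

primrec tabulate :: "'a list \<Rightarrow> ('a \<Rightarrow> ('x, 'b) comp_tree) \<Rightarrow> ('x, 'a \<Rightarrow> 'b) comp_tree" where
  "tabulate [] f = Return (\<lambda>_. undefined)"
| "tabulate (a # as) f = bind_tree (f a) (\<lambda>b. bind_tree (tabulate as f) (\<lambda>g. Return (g(a := b))))"

text \<open>\<open>stable\<close> carries the result for one list element over the runs for the
  elements after it; in every use it comes from \<open>reads_extends\<close>.\<close>

lemma spec_tabulate:
  assumes f: "\<And>a \<sigma>' k'. a \<in> set as \<Longrightarrow> extends k \<sigma> k' \<sigma>' \<Longrightarrow> spec F (f a) \<sigma>' k' c (R a)"
    and stable: "\<And>a b \<sigma>1 k1 \<sigma>2 k2. R a b \<sigma>1 k1 \<Longrightarrow> extends k1 \<sigma>1 k2 \<sigma>2 \<Longrightarrow> R a b \<sigma>2 k2"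
    and c': "length as * c \<le> c'"
  shows "spec F (tabulate as f) \<sigma> k c' (\<lambda>g \<sigma>' k'. \<forall>a\<in>set as. R a (g a) \<sigma>' k')"
proof -
  have "spec F (tabulate as f) \<sigma> k (length as * c) (\<lambda>g \<sigma>' k'. \<forall>a\<in>set as. R a (g a) \<sigma>' k')"
    using f
  proof (induction as arbitrary: \<sigma> k)
    case Nil
    then show ?case by (simp add: spec_Return)
  next
    case (Cons a as)
    show ?case
      unfolding tabulate.simps
    proof (rule spec_bind[where ?c1.0 = c and ?c2.0 = "length as * c" and \<Psi> = "R a"])
      show "spec F (f a) \<sigma> k c (R a)" using Cons.prems by simp
      fix b \<sigma>' k' assume 1: "extends k \<sigma> k' \<sigma>'" "R a b \<sigma>' k'"
      show "spec F (bind_tree (tabulate as f) (\<lambda>g. Return (g(a := b)))) \<sigma>' k' (length as * c)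
          (\<lambda>g \<sigma>' k'. \<forall>a\<in>set (a # as). R a (g a) \<sigma>' k')"
      proof (rule spec_bind[where ?c1.0 = "length as * c" and ?c2.0 = 0])
        show "spec F (tabulate as f) \<sigma>' k' (length as * c) (\<lambda>g \<sigma>' k'. \<forall>a\<in>set as. R a (g a) \<sigma>' k')"
          by (rule Cons.IH) (use Cons.prems 1 extends_trans in \<open>meson list.set_intros(2)\<close>)
        fix g \<sigma>'' k'' assume "extends k' \<sigma>' k'' \<sigma>''" "\<forall>a\<in>set as. R a (g a) \<sigma>'' k''"
        then show "spec F (Return (g(a := b))) \<sigma>'' k'' 0 (\<lambda>g \<sigma>' k'. \<forall>a\<in>set (a # as). R a (g a) \<sigma>' k')"
          using stable[OF 1(2)] by (intro spec_Return) auto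
      qed simp
    qed simp
  qed
  then show ?thesis by (rule spec_mono) (use c' in auto)
qed

subsection \<open>Null vectors and the choice of \<open>l\<close>\<close>

primrec dot_prog :: "nat \<Rightarrow> (nat \<Rightarrow> 'x) \<Rightarrow> (nat \<Rightarrow> 'x) \<Rightarrow> ('x, 'x) comp_tree" where
  "dot_prog 0 x y = operation Zero"
| "dot_prog (Suc d) x y =
     bind_tree (dot_prog d x y) (\<lambda>a. bind_tree (operation (Mult (x d) (y d))) (\<lambda>b. operation (Add a b)))"

primrec find_nonzero :: "'x \<Rightarrow> ('a \<Rightarrow> 'x) \<Rightarrow> 'a list \<Rightarrow> ('x, 'a option) comp_tree" where
  "find_nonzero z v [] = Return None"
| "find_nonzero z v (a # as) = Test (v a) z (\<lambda>b. if b then find_nonzero z v as else Return (Some a))"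

definition elim_step ::
  "nat \<Rightarrow> (nat \<Rightarrow> 'x) \<Rightarrow> nat list \<times> (nat \<Rightarrow> nat \<Rightarrow> 'x) \<Rightarrow> ('x, nat list \<times> (nat \<Rightarrow> nat \<Rightarrow> 'x)) comp_tree" where
  "elim_step d x = (\<lambda>(ms, V).
     bind_tree (tabulate ms (\<lambda>i. dot_prog d (V i) x)) (\<lambda>D.
     bind_tree (operation Zero) (\<lambda>z.
     bind_tree (find_nonzero z D ms) (\<lambda>q. case q of None \<Rightarrow> Return (ms, V) | Some p \<Rightarrow>
     bind_tree (operation (Inverse (D p))) (\<lambda>v.
     bind_tree (tabulate (remove1 p ms) (\<lambda>i.
       bind_tree (operation (Mult (D i) v)) (\<lambda>t.
       tabulate [0..<d] (\<lambda>j. bind_tree (operation (Mult t (V p j))) (\<lambda>a. operation (Sub (V i j) a)))))) (\<lambda>V'.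
     Return (remove1 p ms, V')))))))"

primrec elim :: "nat \<Rightarrow> (nat \<Rightarrow> 'x) list \<Rightarrow> ('x, nat list \<times> (nat \<Rightarrow> nat \<Rightarrow> 'x)) comp_tree" where
  "elim d [] = bind_tree (operation One) (\<lambda>u. bind_tree (operation Zero) (\<lambda>z.
     Return ([0..<d], \<lambda>i j. if i = j then u else z)))"
| "elim d (x # xs) = bind_tree (elim d xs) (elim_step d x)"

definition null_vector :: "nat \<Rightarrow> (nat \<Rightarrow> 'x) list \<Rightarrow> ('x, nat \<Rightarrow> 'x) comp_tree" where
  "null_vector d xs = bind_tree (elim d xs) (\<lambda>(ms, V). Return (V (hd ms)))"

text \<open>\<open>S A\<close> holds the value at \<open>(l, -1)\<close> of the functional \<open>H A\<close> restricted to the coordinates fixed so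
  far. Each new coordinate avoids the at most one value per \<open>A\<close> that would make \<open>S A\<close> vanish, so that
  \<open>S A\<close> stays nonzero from the first nonzero coefficient of \<open>H A\<close> on.\<close>

primrec ell_prog ::
  "nat \<Rightarrow> 'a list \<Rightarrow> ('a \<Rightarrow> nat \<Rightarrow> 'x) \<Rightarrow> 'x \<Rightarrow> ('a \<Rightarrow> 'x) \<Rightarrow> ('x, (nat \<Rightarrow> 'x) \<times> ('a \<Rightarrow> 'x)) comp_tree" where
  "ell_prog 0 as H z S = Return (\<lambda>_. z, S)"
| "ell_prog (Suc p) as H z S0 =
     bind_tree (ell_prog p as H z S0) (\<lambda>(l, S).
     bind_tree (tabulate as (\<lambda>A. bind_tree (operation (Inverse (H A p))) (\<lambda>i.
       bind_tree (operation (Mult (S A) i)) (\<lambda>t. operation (Sub z t))))) (\<lambda>E.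
     bind_tree (operation (Fresh (map E as))) (\<lambda>b.
     bind_tree (tabulate as (\<lambda>A. bind_tree (operation (Mult (H A p) b)) (\<lambda>t. operation (Add (S A) t)))) (\<lambda>S'.
     Return (l(p := b), S')))))"

section \<open>Correctness and cost of the elimination\<close>

context coeff_field begin

text \<open>One operation for the initial zero, then a multiplication and an addition per
  coordinate.\<close>

lemma spec_dot_prog:
  assumes "x \<in> pvec d" "y \<in> pvec d" "reads_vec d \<sigma> k v x" "reads_vec d \<sigma> k u y"
  shows "spec F (dot_prog d v u) \<sigma> k (2 * d + 1) (\<lambda>a \<sigma>' k'. reads \<sigma>' k' a (dot d x y))"
  using assms
proof (induction d)
  case 0
  show ?case using spec_operation[of Zero 1 F \<sigma> k] by simp
next
  case (Suc d)
  have IH: "spec F (dot_prog d v u) \<sigma> k (2 * d + 1) (\<lambda>a \<sigma>' k'. reads \<sigma>' k' a (dot d x y))"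
    by (rule Suc.IH) (use Suc.prems in auto)
  show ?case
    unfolding dot_prog.simps
  proof (rule spec_bind[OF IH, where ?c2.0 = 2])
    fix a \<sigma>1 k1 assume e1: "extends k \<sigma> k1 \<sigma>1" and a: "reads \<sigma>1 k1 a (dot d x y)"
    have vu: "\<sigma>1 (v d) = x d" "\<sigma>1 (u d) = y d"
      using Suc.prems(3,4) reads_extends[OF _ e1] by (auto simp: reads_def)
    show "spec F (bind_tree (operation (Mult (v d) (u d))) (\<lambda>b. operation (Add a b))) \<sigma>1 k1 2
        (\<lambda>a \<sigma>' k'. reads \<sigma>' k' a (dot (Suc d) x y))"
    proof (rule spec_bind[OF spec_operation[of _ 1], where ?c2.0 = 1])
      fix b \<sigma>2 k2 assume e2: "extends k1 \<sigma>1 k2 \<sigma>2" and b: "reads \<sigma>2 k2 b (op_value F \<sigma>1 (Mult (v d) (u d)))"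
      show "spec F (operation (Add a b)) \<sigma>2 k2 1 (\<lambda>a \<sigma>' k'. reads \<sigma>' k' a (dot (Suc d) x y))"
        using spec_operation[of "Add a b" 1 F \<sigma>2 k2] b reads_extends[OF a e2] Suc.prems(1,2)
        by (simp add: reads_def vu dot_Suc)
    qed auto
  qed simp
qed

lemma spec_find_nonzero:
  assumes "\<sigma> z = \<zero>"
  shows "spec F (find_nonzero z v as) \<sigma> k (length as) (\<lambda>q \<sigma>' k'. \<sigma>' = \<sigma> \<and> k' = k \<and>
    (case q of None \<Rightarrow> \<forall>a\<in>set as. \<sigma> (v a) = \<zero> | Some a \<Rightarrow> a \<in> set as \<and> \<sigma> (v a) \<noteq> \<zero>))"
  using assms
proof (induction as)
  case (Cons a as)
  show ?case
  proof (cases "\<sigma> (v a) = \<zero>")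
    case True
    then show ?thesis
      using Cons by (auto simp: spec_def Let_def split: prod.splits option.splits)
  next
    case False
    then show ?thesis using Cons.prems by (auto simp: spec_def)
  qed
qed (simp add: spec_Return)

text \<open>The program only knows addresses; the vectors stored there are existentially
  quantified.\<close>

definition elim_state where
  "elim_state d xs = (\<lambda>(ms, V) \<sigma> k. \<exists>X. null_basis d xs ms X \<and> (\<forall>i\<in>set ms. reads_vec d \<sigma> k (V i) (X i)))"

text \<open>The two outcomes of the search are \<open>null_basis_skip\<close> and
  \<open>null_basis_pivot\<close>. Cost: at most \<open>d\<close> inner products of cost
  \<open>2 * d + 1\<close>, a zero, at most \<open>d\<close> tests, an inversion, and at most
  \<open>d\<close> row updates with one multiplier and two operations for each of \<open>d\<close>
  entries.\<close>

lemma spec_elim_step: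
  assumes st: "elim_state d xs (ms, V) \<sigma> k" and x: "x \<in> vecs F d" "reads_vec d \<sigma> k v x"
    and xs: "set xs \<subseteq> vecs F d"
  shows "spec F (elim_step d v (ms, V)) \<sigma> k (4 * d * d + 3 * d + 2) (elim_state d (x # xs))"
proof -
  let ?row = "\<lambda>p t i. tabulate [0..<d] (\<lambda>j. bind_tree (operation (Mult t (V p j))) (\<lambda>a. operation (Sub (V i j) a)))"
  let ?upd = "\<lambda>D p v. tabulate (remove1 p ms) (\<lambda>i. bind_tree (operation (Mult (D i) v)) (\<lambda>t. ?row p t i))"
  let ?elim = "\<lambda>D p. bind_tree (operation (Inverse (D p))) (\<lambda>v. bind_tree (?upd D p v) (\<lambda>V'. Return (remove1 p ms, V')))"
  let ?branch = "\<lambda>D q. case q of None \<Rightarrow> Return (ms, V) | Some p \<Rightarrow> ?elim D p"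
  obtain X where nb: "null_basis d xs ms X" and X: "\<And>i. i \<in> set ms \<Longrightarrow> reads_vec d \<sigma> k (V i) (X i)"
    using st by (auto simp: elim_state_def)
  have dist: "distinct ms" and sub: "set ms \<subseteq> {..<d}"
    using nb unfolding null_basis_def by - (elim conjE, assumption)+
  have cX: "X i \<in> pvec d" if "i \<in> set ms" for i
    using nb that unfolding null_basis_def by (elim conjE) (erule (1) bspec)
  have xp: "x \<in> pvec d" by (rule vecs_pvec[OF x(1)])
  have len: "length ms \<le> d"
    using dist sub by (metis card_lessThan card_mono distinct_card finite_lessThan)
  let ?c = "length ms"
  have le: "?c * (2 * d + 1) + (1 + (?c + (1 + ?c * (2 * d + 1)))) \<le> 4 * d * d + 3 * d + 2"
  proof -
    have "?c * (2 * d + 1) \<le> d * (2 * d + 1)" using len by (rule mult_right_mono) simp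
    then show ?thesis using len by (simp add: algebra_simps)
  qed
  have D: "spec F (tabulate ms (\<lambda>i. dot_prog d (V i) v)) \<sigma> k (?c * (2 * d + 1))
      (\<lambda>D \<sigma>' k'. \<forall>i\<in>set ms. reads \<sigma>' k' (D i) (dot d (X i) x))"
  proof (rule spec_tabulate)
    fix i \<sigma>' k' assume i: "i \<in> set ms" and e: "extends k \<sigma> k' \<sigma>'"
    show "spec F (dot_prog d (V i) v) \<sigma>' k' (2 * d + 1) (\<lambda>a \<sigma>' k'. reads \<sigma>' k' a (dot d (X i) x))"
      by (rule spec_dot_prog[OF cX[OF i] xp reads_vec_extends[OF X[OF i] e] reads_vec_extends[OF x(2) e]])
  qed (auto intro: reads_extends)
  show ?thesis
    unfolding elim_step_def prod.case
  proof (rule spec_bind[OF D _ le])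
    fix D \<sigma>1 k1 assume e1: "extends k \<sigma> k1 \<sigma>1" and D: "\<forall>i\<in>set ms. reads \<sigma>1 k1 (D i) (dot d (X i) x)"
    show "spec F (bind_tree (operation Zero) (\<lambda>z.
     bind_tree (find_nonzero z D ms) (\<lambda>q. ?branch D q))) \<sigma>1 k1 (1 + (?c + (1 + ?c * (2 * d + 1)))) (elim_state d (x # xs))"
    proof (rule spec_bind[OF spec_operation[of _ 1]])
      fix z \<sigma>2 k2 assume e2: "extends k1 \<sigma>1 k2 \<sigma>2" and "reads \<sigma>2 k2 z (op_value F \<sigma>1 Zero)"
      then have z: "\<sigma>2 z = \<zero>" by (simp add: reads_def)
      have D2: "reads \<sigma>2 k2 (D i) (dot d (X i) x)" if "i \<in> set ms" for i
        using D that reads_extends[OF _ e2] by blast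
      have X2: "reads_vec d \<sigma>2 k2 (V i) (X i)" if "i \<in> set ms" for i
        by (rule reads_vec_extends[OF reads_vec_extends[OF X[OF that] e1] e2])
      show "spec F (bind_tree (find_nonzero z D ms) (\<lambda>q. ?branch D q)) \<sigma>2 k2 (?c + (1 + ?c * (2 * d + 1))) (elim_state d (x # xs))"
      proof (rule spec_bind[OF spec_find_nonzero[where \<sigma> = \<sigma>2 and z = z, OF z]])
        fix q \<sigma>3 k3
        assume "extends k2 \<sigma>2 k3 \<sigma>3" and "\<sigma>3 = \<sigma>2 \<and> k3 = k2 \<and>
           (case q of None \<Rightarrow> \<forall>a\<in>set ms. \<sigma>2 (D a) = \<zero> | Some a \<Rightarrow> a \<in> set ms \<and> \<sigma>2 (D a) \<noteq> \<zero>)"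
        then have q: "\<sigma>3 = \<sigma>2" "k3 = k2"
          "case q of None \<Rightarrow> \<forall>a\<in>set ms. \<sigma>2 (D a) = \<zero> | Some a \<Rightarrow> a \<in> set ms \<and> \<sigma>2 (D a) \<noteq> \<zero>" by auto
        show "spec F (?branch D q) \<sigma>3 k3 (1 + ?c * (2 * d + 1)) (elim_state d (x # xs))"
        proof (cases q)
          case None
          have "null_basis d (x # xs) ms X"
            using q(3) None D2 by (intro null_basis_skip[OF nb x(1) xs]) (auto simp: reads_def)
          then show ?thesis
            using None q(1,2) X2 by (auto intro!: spec_Return simp: elim_state_def)
        next
          case (Some p)
          have p: "p \<in> set ms" "dot d (X p) x \<noteq> \<zero>" using q(3) Some D2 by (auto simp: reads_def)
          define cp where "cp = inv (dot d (X p) x)"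
          have dpc: "dot d (X p) x \<in> carrier F" using cX[OF p(1)] xp by auto
          have cost: "1 + length (remove1 p ms) * (1 + d * 2) \<le> 1 + ?c * (2 * d + 1)"
            by (intro add_left_mono mult_le_mono) (auto simp: length_remove1)
          have "spec F (?elim D p) \<sigma>2 k2 (1 + length (remove1 p ms) * (1 + d * 2)) (elim_state d (x # xs))"
          proof (rule spec_bind[OF spec_operation[of _ 1]])
            fix vi \<sigma>4 k4 assume e4: "extends k2 \<sigma>2 k4 \<sigma>4" and "reads \<sigma>4 k4 vi (op_value F \<sigma>2 (Inverse (D p)))"
            then have vi: "reads \<sigma>4 k4 vi cp"
              using D2[OF p(1)] p(2) by (simp add: reads_def cp_def)
            have D4: "reads \<sigma>4 k4 (D i) (dot d (X i) x)" if "i \<in> set ms" for i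
              by (rule reads_extends[OF D2[OF that] e4])
            have X4: "reads_vec d \<sigma>4 k4 (V i) (X i)" if "i \<in> set ms" for i
              by (rule reads_vec_extends[OF X2[OF that] e4])
            define X' where "X' i j = X i j \<ominus> (dot d (X i) x \<otimes> cp) \<otimes> X p j" for i j
            have tab: "spec F (?upd D p vi)
               \<sigma>4 k4 (length (remove1 p ms) * (1 + d * 2))
               (\<lambda>V' \<sigma>' k'. \<forall>i\<in>set (remove1 p ms). reads_vec d \<sigma>' k' (V' i) (X' i))"
            proof (rule spec_tabulate)
              fix i \<sigma>5 k5 assume i: "i \<in> set (remove1 p ms)" and e5: "extends k4 \<sigma>4 k5 \<sigma>5"
              have im: "i \<in> set ms" using i by (meson set_remove1_subset subsetD)
              show "spec F (bind_tree (operation (Mult (D i) vi)) (\<lambda>t.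
                 ?row p t i))
                 \<sigma>5 k5 (1 + d * 2) (\<lambda>v \<sigma>' k'. reads_vec d \<sigma>' k' v (X' i))"
              proof (rule spec_bind[OF spec_operation[of _ 1]])
                fix t \<sigma>6 k6 assume e6: "extends k5 \<sigma>5 k6 \<sigma>6" and "reads \<sigma>6 k6 t (op_value F \<sigma>5 (Mult (D i) vi))"
                then have t: "reads \<sigma>6 k6 t (dot d (X i) x \<otimes> cp)"
                  using reads_extends[OF D4[OF im] e5] reads_extends[OF vi e5] by (simp add: reads_def)
                have X6: "reads_vec d \<sigma>6 k6 (V i) (X i)" if "i \<in> set ms" for i
                  by (rule reads_vec_extends[OF reads_vec_extends[OF X4[OF that] e5] e6])
                have "spec F (?row p t i)
                  \<sigma>6 k6 (d * 2) (\<lambda>g \<sigma>' k'. \<forall>j\<in>set [0..<d]. reads \<sigma>' k' (g j) (X' i j))"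
                proof (rule spec_tabulate)
                  fix j \<sigma>7 k7 assume "j \<in> set [0..<d]" and e7: "extends k6 \<sigma>6 k7 \<sigma>7"
                  then have j: "j < d" by simp
                  have 7: "reads \<sigma>7 k7 t (dot d (X i) x \<otimes> cp)" "reads \<sigma>7 k7 (V p j) (X p j)" "reads \<sigma>7 k7 (V i j) (X i j)"
                    using t X6[OF p(1)] X6[OF im] j reads_extends[OF _ e7] by blast+
                  show "spec F (bind_tree (operation (Mult t (V p j))) (\<lambda>a. operation (Sub (V i j) a))) \<sigma>7 k7 2
                     (\<lambda>a \<sigma>' k'. reads \<sigma>' k' a (X' i j))"
                  proof (rule spec_bind[OF spec_operation[of _ 1]])
                    fix a \<sigma>8 k8 assume e8: "extends k7 \<sigma>7 k8 \<sigma>8" and a: "reads \<sigma>8 k8 a (op_value F \<sigma>7 (Mult t (V p j)))"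
                    have "op_value F \<sigma>8 (Sub (V i j) a) = X' i j"
                      using a 7 reads_extends[OF 7(3) e8] by (simp add: reads_def X'_def)
                    then show "spec F (operation (Sub (V i j) a)) \<sigma>8 k8 1 (\<lambda>a \<sigma>' k'. reads \<sigma>' k' a (X' i j))"
                      using spec_operation[of "Sub (V i j) a" 1 F \<sigma>8 k8] by simp
                  qed auto
                qed (auto intro: reads_extends)
                then show "spec F (?row p t i)
                  \<sigma>6 k6 (d * 2) (\<lambda>v \<sigma>' k'. reads_vec d \<sigma>' k' v (X' i))"
                  by (rule spec_mono) auto
              qed auto
            qed (auto intro: reads_extends)
            show "spec F (bind_tree (?upd D p vi) (\<lambda>V'.
               Return (remove1 p ms, V'))) \<sigma>4 k4 (length (remove1 p ms) * (1 + d * 2)) (elim_state d (x # xs))"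
            proof (rule spec_bind[OF tab])
              fix V' \<sigma>5 k5 assume "\<forall>i\<in>set (remove1 p ms). reads_vec d \<sigma>5 k5 (V' i) (X' i)"
              moreover have "null_basis d (x # xs) (remove1 p ms) X'"
                by (rule null_basis_pivot[OF nb x(1) xs p]) (simp add: X'_def cp_def)
              ultimately show "spec F (Return (remove1 p ms, V')) \<sigma>5 k5 0 (elim_state d (x # xs))"
                by (intro spec_Return) (auto simp: elim_state_def)
            qed simp
          qed auto
          then have "spec F (?elim D p) \<sigma>2 k2 (1 + ?c * (2 * d + 1)) (elim_state d (x # xs))"
            by (rule spec_mono) (use cost in auto)
          then show ?thesis by (simp add: Some q(1,2))
        qed
      qed simp
    qed auto
  qed
qed

text \<open>The summand 2 pays for the constants \<one> and \<zero> that all initial unit vectors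
  share.\<close>

lemma spec_elim:
  assumes "list_all2 (reads_vec d \<sigma> k) vs xs" "set xs \<subseteq> vecs F d"
  shows "spec F (elim d vs) \<sigma> k (2 + length xs * (4 * d * d + 3 * d + 2)) (elim_state d xs)"
  using assms
proof (induction vs arbitrary: xs)
  case Nil
  then have xs: "xs = []" by simp
  show ?case
    unfolding elim.simps xs
  proof (rule spec_bind[OF spec_operation[of _ 1], where ?c2.0 = 1])
    fix u \<sigma>1 k1 assume u: "reads \<sigma>1 k1 u (op_value F \<sigma> One)"
    show "spec F (bind_tree (operation Zero) (\<lambda>z. Return ([0..<d], \<lambda>i j. if i = j then u else z))) \<sigma>1 k1 1
       (elim_state d [])"
    proof (rule spec_bind[OF spec_operation[of _ 1], where ?c2.0 = 0])
      fix z \<sigma>2 k2 assume e: "extends k1 \<sigma>1 k2 \<sigma>2" and z: "reads \<sigma>2 k2 z (op_value F \<sigma>1 Zero)"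
      show "spec F (Return ([0..<d], \<lambda>i j. if i = j then u else z)) \<sigma>2 k2 0 (elim_state d [])"
        using null_basis_Nil[of d] reads_extends[OF u e] z
        by (intro spec_Return) (auto simp: elim_state_def)
    qed auto
  qed auto
next
  case (Cons v vs)
  then obtain y ys where xs: "xs = y # ys" by (cases xs) auto
  have IH: "spec F (elim d vs) \<sigma> k (2 + length ys * (4 * d * d + 3 * d + 2)) (elim_state d ys)"
    using Cons xs by simp
  show ?case
    unfolding elim.simps xs
  proof (rule spec_bind[OF IH, where ?c2.0 = "4 * d * d + 3 * d + 2"])
    fix mV \<sigma>1 k1 assume e: "extends k \<sigma> k1 \<sigma>1" and st: "elim_state d ys mV \<sigma>1 k1"
    obtain ms V where mV: "mV = (ms, V)" by (cases mV)
    show "spec F (elim_step d v mV) \<sigma>1 k1 (4 * d * d + 3 * d + 2) (elim_state d (y # ys))"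
      unfolding mV
      by (rule spec_elim_step) (use st mV Cons.prems xs reads_extends[OF _ e] in auto)
  qed simp
qed

lemma spec_null_vector:
  assumes "list_all2 (reads_vec d \<sigma> k) vs xs" "set xs \<subseteq> vecs F d" "length xs < d"
  shows "spec F (null_vector d vs) \<sigma> k (2 + length xs * (4 * d * d + 3 * d + 2))
    (\<lambda>v \<sigma>' k'. \<exists>h\<in>pvec d. reads_vec d \<sigma>' k' v h \<and> (\<exists>i<d. h i \<noteq> \<zero>) \<and> (\<forall>x\<in>set xs. dot d h x = \<zero>))"
  unfolding null_vector_def
proof (rule spec_bind[OF spec_elim[OF assms(1,2)], where ?c2.0 = 0])
  fix mV \<sigma>' k' assume st: "elim_state d xs mV \<sigma>' k'"
  obtain ms V where mV: "mV = (ms, V)" by (cases mV)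
  obtain X where X: "null_basis d xs ms X" "\<forall>i\<in>set ms. reads_vec d \<sigma>' k' (V i) (X i)"
    using st by (auto simp: elim_state_def mV)
  note nz = null_basis_nonzero[OF X(1) assms(3)]
  show "spec F (case mV of (ms, V) \<Rightarrow> Return (V (hd ms))) \<sigma>' k' 0
     (\<lambda>v \<sigma>' k'. \<exists>h\<in>pvec d. reads_vec d \<sigma>' k' v h \<and> (\<exists>i<d. h i \<noteq> \<zero>) \<and> (\<forall>x\<in>set xs. dot d h x = \<zero>))"
    unfolding mV prod.case
    by (rule spec_Return, rule bexI[of _ "X (hd ms)"]) (use nz X(2) in auto)
qed simp

end

text \<open>For programs of many phases the execution is unrolled with named intermediate stores
  instead of nesting \<open>spec_bind\<close>.\<close>

lemma specE:
  assumes "spec F t \<sigma> k c \<Phi>"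
  obtains x \<sigma>' k' c' where "exec F t \<sigma> k = (x, \<sigma>', k', c')" "c' \<le> c" "extends k \<sigma> k' \<sigma>'" "\<Phi> x \<sigma>' k'"
  using assms by (auto simp: spec_def split: prod.splits)

text \<open>An arbitrary enumeration. Ordering edges and sets of edges involves no field elements
  and is free in the cost model.\<close>

definition list_of :: "'a set \<Rightarrow> 'a list" where
  "list_of A = (SOME xs. set xs = A \<and> distinct xs)"

lemma list_of: "finite A \<Longrightarrow> set (list_of A) = A \<and> distinct (list_of A)"
  unfolding list_of_def by (rule someI_ex) (rule finite_distinct_list)

lemma length_list_of: "finite A \<Longrightarrow> length (list_of A) = card A"
  using list_of[of A] distinct_card[of "list_of A"] by simp

subsection \<open>Rate reduction\<close>

text \<open>Both special columns are found in this way, as a nonzero coordinate of a vector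
  orthogonal to the \<open>m\<close> rows of a matrix with \<open>m + 1\<close> columns.\<close>

definition null_pivot :: "nat \<Rightarrow> (nat \<Rightarrow> 'x) list \<Rightarrow> nat list \<Rightarrow> ('x, nat option) comp_tree" where
  "null_pivot d vs cs =
     bind_tree (null_vector d vs) (\<lambda>v. bind_tree (operation Zero) (\<lambda>z. find_nonzero z v cs))"

text \<open>The listed vectors are the first \<open>m\<close> rows of \<open>Q\<close>. If their
  null vector vanishes on the first \<open>w\<close> coordinates, any of these indices may be
  dropped, and 0 is taken.\<close>

definition drop_chosen :: "nat \<Rightarrow> nat \<Rightarrow> (('v, 'e) address, nat) comp_tree" where
  "drop_chosen m w =
     bind_tree (null_pivot (Suc m) (map (\<lambda>i j. QEntry i j) [0..<m]) [0..<w])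
       (\<lambda>q. Return (case q of None \<Rightarrow> 0 | Some i \<Rightarrow> i))"

definition functionals :: "nat \<Rightarrow> nat list \<Rightarrow> 'e set list \<Rightarrow> (('v, 'e) address, 'e set \<Rightarrow> nat \<Rightarrow> ('v, 'e) address) comp_tree" where
  "functionals m js As =
     tabulate As (\<lambda>A. null_vector (Suc m) (map (\<lambda>j i. QEntry i j) js @ map Global (list_of A)))"

text \<open>The initial \<open>S A\<close> is minus the last coefficient of the functional, the
  contribution of the entry -1 of \<open>(l, -1)\<close>.\<close>

definition choose_ell :: "nat \<Rightarrow> 'a list \<Rightarrow> ('a \<Rightarrow> nat \<Rightarrow> 'x) \<Rightarrow> ('x, nat \<Rightarrow> 'x) comp_tree" where
  "choose_ell m As H =
     bind_tree (operation Zero) (\<lambda>z.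
     bind_tree (tabulate As (\<lambda>A. operation (Sub z (H A m)))) (\<lambda>S.
     bind_tree (ell_prog m As H z S) (\<lambda>(l, S'). Return l)))"

definition new_kernel :: "nat \<Rightarrow> 'v \<Rightarrow> 'e list \<Rightarrow> (nat \<Rightarrow> ('v, 'e) address) \<Rightarrow>
    (('v, 'e) address, nat \<Rightarrow> 'e \<Rightarrow> ('v, 'e) address) comp_tree" where
  "new_kernel m s es l = tabulate [0..<m] (\<lambda>i. tabulate es (\<lambda>e.
     bind_tree (operation (Mult (l i) (Kernel s (Imag m) e))) (\<lambda>t. operation (Add (Kernel s (Imag i) e) t))))"

definition new_columns :: "nat \<Rightarrow> (nat \<Rightarrow> ('v, 'e) address) \<Rightarrow>
    (('v, 'e) address, nat \<Rightarrow> nat \<Rightarrow> ('v, 'e) address) comp_tree" where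
  "new_columns m l = tabulate [0..<m] (\<lambda>i. tabulate [0..<Suc m] (\<lambda>j.
     bind_tree (operation (Mult (l i) (QEntry m j))) (\<lambda>t. operation (Add (QEntry i j) t))))"

definition drop_other :: "nat \<Rightarrow> nat list \<Rightarrow> (nat \<Rightarrow> nat \<Rightarrow> 'x) \<Rightarrow> ('x, nat) comp_tree" where
  "drop_other m cs P =
     bind_tree (null_pivot (Suc m) (map P [0..<m]) cs) (\<lambda>q. Return (the q))"

text \<open>\<open>js\<close> holds the chosen columns and \<open>cs\<close> all the others. The
  chosen ones come first in \<open>col\<close>, because the message occupies the first
  \<open>w - 1\<close> coordinates of the new code. For \<open>m = 0\<close> there are no entries to
  compute and the returned addresses are placeholders.\<close>

definition reduce_rate :: "('v, 'e) rate_reduction_algorithm" where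
  "reduce_rate G s T w r \<A> = (let m = w + r - 1; As = list_of \<A> in
     if m = 0 then Return \<lparr>chosen = {}, ell_at = \<lambda>_. Temp 0, kernel_at = \<lambda>_ _. Temp 0,
       column = id, Q_at = \<lambda>_ _. Temp 0\<rparr>
     else
       bind_tree (drop_chosen m w) (\<lambda>i0. let js = filter (\<lambda>j. j \<noteq> i0) [0..<w]; cs = i0 # [w..<Suc m] in
       bind_tree (functionals m js As) (\<lambda>H.
       bind_tree (choose_ell m As H) (\<lambda>l.
       bind_tree (new_kernel m s (list_of (out_arcs G s)) l) (\<lambda>K.
       bind_tree (new_columns m l) (\<lambda>P.
       bind_tree (drop_other m cs P) (\<lambda>i1. let col = (\<lambda>j. (js @ filter (\<lambda>j. j \<noteq> i1) cs) ! j) in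
       Return \<lparr>chosen = set js, ell_at = l, kernel_at = K, column = col, Q_at = \<lambda>i j. P i (col j)\<rparr>)))))))"

section \<open>Correctness and cost of the choice of \<open>l\<close>\<close>

context coeff_field begin

lemma spec_add_mult:
  assumes "reads \<sigma> k x a" "reads \<sigma> k y b" "reads \<sigma> k z c" and "t = c \<oplus> a \<otimes> b"
  shows "spec F (bind_tree (operation (Mult x y)) (\<lambda>t. operation (Add z t))) \<sigma> k 2 (\<lambda>u \<sigma>' k'. reads \<sigma>' k' u t)"
proof (rule spec_bind[OF spec_operation[of _ 1], where ?c2.0 = 1])
  fix u \<sigma>1 k1 assume e: "extends k \<sigma> k1 \<sigma>1" and "reads \<sigma>1 k1 u (op_value F \<sigma> (Mult x y))"
  then have "op_value F \<sigma>1 (Add z u) = t"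
    using assms reads_extends[OF assms(3) e] by (simp add: reads_def)
  then show "spec F (operation (Add z u)) \<sigma>1 k1 1 (\<lambda>u \<sigma>' k'. reads \<sigma>' k' u t)"
    using spec_operation[of "Add z u" 1 F \<sigma>1 k1] by simp
qed auto

text \<open>Fewer addresses than field elements leave some value free, so the default \<zero> of
  \<open>Fresh\<close> for an exhausted field is not taken.\<close>

lemma spec_fresh:
  assumes "finite (carrier F)" "length xs < card (carrier F)"
  shows "spec F (operation (Fresh xs)) \<sigma> k (length xs + 1)
    (\<lambda>b \<sigma>' k'. \<exists>\<beta>\<in>carrier F. reads \<sigma>' k' b \<beta> \<and> (\<forall>x\<in>set xs. \<sigma> x \<noteq> \<beta>))"
proof -
  have "card (\<sigma> ` set xs) \<le> length xs" by (meson card_image_le card_length finite_set order_trans)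
  then have "card (\<sigma> ` set xs) < card (carrier F)" using assms(2) by simp
  then have ns: "\<not> carrier F \<subseteq> \<sigma> ` set xs" by (meson card_mono finite_imageI finite_set not_le)
  then have "op_value F \<sigma> (Fresh xs) = (SOME a. a \<in> carrier F - \<sigma> ` set xs)" by simp
  moreover have "(SOME a. a \<in> carrier F - \<sigma> ` set xs) \<in> carrier F - \<sigma> ` set xs"
    by (rule someI_ex) (use ns in blast)
  ultimately have b: "op_value F \<sigma> (Fresh xs) \<in> carrier F - \<sigma> ` set xs" by (simp only:)
  show ?thesis
  proof (rule spec_mono[OF spec_operation[of _ "length xs + 1"]])
    fix x \<sigma>' k' assume "reads \<sigma>' k' x (op_value F \<sigma> (Fresh xs))"
    then show "\<exists>\<beta>\<in>carrier F. reads \<sigma>' k' x \<beta> \<and> (\<forall>x\<in>set xs. \<sigma> x \<noteq> \<beta>)"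
      using b by (metis DiffD1 DiffD2 imageI)
  qed simp_all
qed

text \<open>Per coordinate and set: three operations for the excluded value, one for marking it in
  \<open>Fresh\<close>, two for the update; the remaining 1 per coordinate is the constant part of
  \<open>Fresh\<close>. The coefficient \<open>h A m\<close> counts as fixed from the beginning,
  since the last entry of \<open>(l, -1)\<close> is given.\<close>

lemma spec_ell_prog:
  assumes fin: "finite (carrier F)" and len: "length as < card (carrier F)"
    and h: "\<And>A. A \<in> set as \<Longrightarrow> h A \<in> pvec (Suc m)"
    and H: "\<And>A. A \<in> set as \<Longrightarrow> reads_vec (Suc m) \<sigma> k (H A) (h A)"
    and z: "reads \<sigma> k z \<zero>" and S0: "\<And>A. A \<in> set as \<Longrightarrow> reads \<sigma> k (S0 A) (\<ominus> h A m)"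
  shows "p \<le> m \<Longrightarrow> spec F (ell_prog p as H z S0) \<sigma> k (p * (6 * length as + 1)) (\<lambda>lS \<sigma>' k'. case lS of (l, S) \<Rightarrow>
    \<exists>x\<in>pvec p. reads_vec p \<sigma>' k' l x \<and> (\<forall>A\<in>set as. reads \<sigma>' k' (S A) (dot p (h A) x \<ominus> h A m) \<and>
      (h A m \<noteq> \<zero> \<or> (\<exists>i<p. h A i \<noteq> \<zero>) \<longrightarrow> dot p (h A) x \<ominus> h A m \<noteq> \<zero>)))"
    (is "_ \<Longrightarrow> spec F _ \<sigma> k _ (?post p)")
proof (induction p)
  case 0
  have "h A m \<in> carrier F" if "A \<in> set as" for A using h[OF that] by auto
  then show ?case
    unfolding ell_prog.simps using S0
    by (intro spec_Return) (auto simp: a_minus_def)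
next
  case (Suc p)
  let ?n = "length as"
  have p: "p < m" using Suc.prems by simp
  have hp: "h A p \<in> carrier F" "h A m \<in> carrier F" "h A \<in> pvec p" "h A \<in> pvec (Suc p)" if "A \<in> set as" for A
    using h[OF that] p by auto
  have IH: "spec F (ell_prog p as H z S0) \<sigma> k (p * (6 * ?n + 1)) (?post p)"
    by (rule Suc.IH) (use p in simp)
  obtain lS \<sigma>1 k1 c1 where e1: "exec F (ell_prog p as H z S0) \<sigma> k = (lS, \<sigma>1, k1, c1)"
    "c1 \<le> p * (6 * ?n + 1)" "extends k \<sigma> k1 \<sigma>1"
    and post1: "?post p lS \<sigma>1 k1"
    by (rule specE[OF IH])
  obtain l S where lS: "lS = (l, S)" by (cases lS)
  obtain x where x: "x \<in> pvec p" "reads_vec p \<sigma>1 k1 l x"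
    and S: "\<And>A. A \<in> set as \<Longrightarrow> reads \<sigma>1 k1 (S A) (dot p (h A) x \<ominus> h A m)"
    and nz: "\<And>A. A \<in> set as \<Longrightarrow> h A m \<noteq> \<zero> \<or> (\<exists>i<p. h A i \<noteq> \<zero>) \<Longrightarrow> dot p (h A) x \<ominus> h A m \<noteq> \<zero>"
    using post1 unfolding lS by auto
  let ?E = "\<lambda>A. bind_tree (operation (Inverse (H A p))) (\<lambda>i. bind_tree (operation (Mult (S A) i)) (\<lambda>t. operation (Sub z t)))"
  let ?U = "\<lambda>b A. bind_tree (operation (Mult (H A p) b)) (\<lambda>t. operation (Add (S A) t))"
  define sv where "sv A = dot p (h A) x \<ominus> h A m" for A
  have sv: "sv A \<in> carrier F" if "A \<in> set as" for A
    using hp[OF that] x(1) by (simp add: sv_def)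
  \<comment> \<open>The root of \<open>sv A + h A p * b\<close> in \<open>b\<close>. For a zero
    coefficient, \<open>Inverse\<close> returns \<zero> and the excluded value is \<zero>; this
    exclusion is harmless, as still only one value per set is avoided.\<close>
  define ev where "ev A = \<zero> \<ominus> sv A \<otimes> (if h A p = \<zero> then \<zero> else inv (h A p))" for A
  have H1: "reads \<sigma>1 k1 (H A p) (h A p)" if "A \<in> set as" for A
    using H[OF that] p reads_extends[OF _ e1(3)] by auto
  have z1: "reads \<sigma>1 k1 z \<zero>" by (rule reads_extends[OF z e1(3)])
  have "spec F (tabulate as ?E) \<sigma>1 k1 (?n * 3)
       (\<lambda>E \<sigma>' k'. \<forall>A\<in>set as. reads \<sigma>' k' (E A) (ev A))"
  proof (rule spec_tabulate)
    fix A \<sigma>' k' assume A: "A \<in> set as" and e: "extends k1 \<sigma>1 k' \<sigma>'"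
    show "spec F (?E A)
      \<sigma>' k' 3 (\<lambda>a \<sigma>' k'. reads \<sigma>' k' a (ev A))"
    proof (rule spec_bind[OF spec_operation[of _ 1], where ?c2.0 = 2])
      fix i \<sigma>2 k2 assume e2: "extends k' \<sigma>' k2 \<sigma>2" and i: "reads \<sigma>2 k2 i (op_value F \<sigma>' (Inverse (H A p)))"
      have i': "reads \<sigma>2 k2 i (if h A p = \<zero> then \<zero> else inv (h A p))"
        using i reads_extends[OF H1[OF A] e] by (simp add: reads_def)
      have S2: "reads \<sigma>2 k2 (S A) (sv A)"
        using reads_extends[OF reads_extends[OF S[OF A] e] e2] by (simp add: sv_def)
      have z2: "reads \<sigma>2 k2 z \<zero>" by (rule reads_extends[OF reads_extends[OF z1 e] e2])
      show "spec F (bind_tree (operation (Mult (S A) i)) (\<lambda>t. operation (Sub z t))) \<sigma>2 k2 2 (\<lambda>a \<sigma>' k'. reads \<sigma>' k' a (ev A))"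
      proof (rule spec_bind[OF spec_operation[of _ 1], where ?c2.0 = 1])
        fix t \<sigma>3 k3 assume e3: "extends k2 \<sigma>2 k3 \<sigma>3" and t: "reads \<sigma>3 k3 t (op_value F \<sigma>2 (Mult (S A) i))"
        have "op_value F \<sigma>3 (Sub z t) = ev A"
          using t i' S2 reads_extends[OF z2 e3] by (simp add: reads_def ev_def)
        then show "spec F (operation (Sub z t)) \<sigma>3 k3 1 (\<lambda>a \<sigma>' k'. reads \<sigma>' k' a (ev A))"
          using spec_operation[of "Sub z t" 1 F \<sigma>3 k3] by simp
      qed auto
    qed auto
  qed (auto intro: reads_extends)
  then obtain E \<sigma>2 k2 c2 where e2: "exec F (tabulate as ?E) \<sigma>1 k1 = (E, \<sigma>2, k2, c2)"
     "c2 \<le> ?n * 3" "extends k1 \<sigma>1 k2 \<sigma>2" and E: "\<forall>A\<in>set as. reads \<sigma>2 k2 (E A) (ev A)"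
    by (rule specE)
  have fr: "length (map E as) < card (carrier F)" using len by simp
  obtain b \<sigma>3 k3 c3 where e3: "exec F (operation (Fresh (map E as))) \<sigma>2 k2 = (b, \<sigma>3, k3, c3)"
     "c3 \<le> length (map E as) + 1" "extends k2 \<sigma>2 k3 \<sigma>3"
     and b: "\<exists>\<beta>\<in>carrier F. reads \<sigma>3 k3 b \<beta> \<and> (\<forall>x\<in>set (map E as). \<sigma>2 x \<noteq> \<beta>)"
    by (rule specE[OF spec_fresh[OF fin fr]])
  obtain \<beta> where \<beta>: "\<beta> \<in> carrier F" "reads \<sigma>3 k3 b \<beta>" "\<And>A. A \<in> set as \<Longrightarrow> ev A \<noteq> \<beta>"
    using b E by (auto simp: reads_def)
  have e13: "extends k1 \<sigma>1 k3 \<sigma>3" by (rule extends_trans[OF e2(3) e3(3)])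
  have "spec F (tabulate as (?U b)) \<sigma>3 k3 (?n * 2)
     (\<lambda>S' \<sigma>' k'. \<forall>A\<in>set as. reads \<sigma>' k' (S' A) (sv A \<oplus> h A p \<otimes> \<beta>))"
  proof (rule spec_tabulate)
    fix A \<sigma>' k' assume A: "A \<in> set as" and e: "extends k3 \<sigma>3 k' \<sigma>'"
    show "spec F (?U b A) \<sigma>' k' 2
      (\<lambda>u \<sigma>' k'. reads \<sigma>' k' u (sv A \<oplus> h A p \<otimes> \<beta>))"
    proof (rule spec_add_mult)
      show "reads \<sigma>' k' (H A p) (h A p)" by (rule reads_extends[OF reads_extends[OF H1[OF A] e13] e])
      show "reads \<sigma>' k' b \<beta>" by (rule reads_extends[OF \<beta>(2) e])
      show "reads \<sigma>' k' (S A) (sv A)"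
        using reads_extends[OF reads_extends[OF S[OF A] e13] e] by (simp add: sv_def)
    qed simp
  qed (auto intro: reads_extends)
  then obtain S' \<sigma>4 k4 c4 where e4: "exec F (tabulate as (?U b)) \<sigma>3 k3 = (S', \<sigma>4, k4, c4)"
     "c4 \<le> ?n * 2" "extends k3 \<sigma>3 k4 \<sigma>4" and S': "\<forall>A\<in>set as. reads \<sigma>4 k4 (S' A) (sv A \<oplus> h A p \<otimes> \<beta>)"
    by (rule specE)
  have e: "exec F (ell_prog (Suc p) as H z S0) \<sigma> k = ((l(p := b), S'), \<sigma>4, k4, c4 + c3 + c2 + c1)"
    using e3(1) by (auto simp: exec_bind_tree e1(1) lS e2(1) e4(1) Let_def)
  have ext: "extends k \<sigma> k4 \<sigma>4"
    by (rule extends_trans[OF e1(3) extends_trans[OF e13 e4(3)]])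
  define x' where "x' = x(p := \<beta>)"
  have x': "x' \<in> pvec (Suc p)" using x(1) \<beta>(1) by (auto simp: x'_def less_Suc_eq)
  have rd: "reads_vec (Suc p) \<sigma>4 k4 (l(p := b)) x'"
    using reads_extends[OF \<beta>(2) e4(3)] x(2) reads_extends[OF _ extends_trans[OF e13 e4(3)]]
    by (auto simp: x'_def less_Suc_eq)
  have val: "dot (Suc p) (h A) x' \<ominus> h A m = sv A \<oplus> h A p \<otimes> \<beta>" if A: "A \<in> set as" for A
  proof -
    have "dot p (h A) x' = dot p (h A) x" by (rule dot_cong) (auto simp: x'_def)
    then have "dot (Suc p) (h A) x' = dot p (h A) x \<oplus> h A p \<otimes> \<beta>"
      using dot_Suc[OF hp(4)[OF A] x'] by (simp add: x'_def)
    then show ?thesis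
      using hp[OF A] x(1) \<beta>(1) by (simp add: sv_def a_minus_def a_ac)
  qed
  \<comment> \<open>A zero coefficient leaves the value as it was. With a nonzero one, vanishing
    would identify \<beta> with the excluded value \<open>ev A\<close>.\<close>
  have nonzero: "sv A \<oplus> h A p \<otimes> \<beta> \<noteq> \<zero>"
    if A: "A \<in> set as" and ex: "h A m \<noteq> \<zero> \<or> (\<exists>i<Suc p. h A i \<noteq> \<zero>)" for A
  proof (cases "h A p = \<zero>")
    case True
    then have "h A m \<noteq> \<zero> \<or> (\<exists>i<p. h A i \<noteq> \<zero>)" using ex less_Suc_eq by auto
    then show ?thesis using nz[OF A] True \<beta>(1) sv[OF A] by (simp add: sv_def)
  next
    case False
    then have U: "h A p \<in> Units F" using hp(1)[OF A] by (simp add: field_Units)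
    show ?thesis
    proof
      assume "sv A \<oplus> h A p \<otimes> \<beta> = \<zero>"
      then have "sv A = \<ominus> (h A p \<otimes> \<beta>)" using sv[OF A] hp(1)[OF A] \<beta>(1) by (intro sum_zero_eq_neg) auto
      then have "ev A = \<ominus> (\<ominus> (h A p \<otimes> \<beta>) \<otimes> inv (h A p))"
        using False U hp(1)[OF A] \<beta>(1) by (simp add: ev_def a_minus_def)
      also have "\<dots> = \<beta>"
        using U hp(1)[OF A] \<beta>(1) by (simp add: l_minus m_comm[of "h A p" \<beta>] m_assoc)
      finally show False using \<beta>(3)[OF A] by simp
    qed
  qed
  have cost: "c4 + c3 + c2 + c1 \<le> Suc p * (6 * ?n + 1)"
    using e1(2) e2(2) e3(2) e4(2) by (simp add: algebra_simps)
  show ?case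
    unfolding spec_def e prod.case
    by (intro conjI bexI[OF _ x'] ballI impI) ((rule cost ext rd)+, (use S' val nonzero in auto)+)
qed

text \<open>The extra \<open>length as + 1\<close> pays for the constant \<zero> and the initial
  values \<open>S\<close>.\<close>

lemma spec_choose_ell:
  assumes fin: "finite (carrier F)" and len: "length as < card (carrier F)"
    and h: "\<And>A. A \<in> set as \<Longrightarrow> h A \<in> pvec (Suc m)" "\<And>A. A \<in> set as \<Longrightarrow> \<exists>i<Suc m. h A i \<noteq> \<zero>"
    and H: "\<And>A. A \<in> set as \<Longrightarrow> reads_vec (Suc m) \<sigma> k (H A) (h A)"
  shows "spec F (choose_ell m as H) \<sigma> k (m * (6 * length as + 1) + length as + 1) (\<lambda>l \<sigma>' k'.
    \<exists>x\<in>pvec m. reads_vec m \<sigma>' k' l x \<and> (\<forall>A\<in>set as. dot m (h A) x \<noteq> h A m))"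
    (is "spec F _ \<sigma> k _ ?post")
  unfolding choose_ell_def
proof (rule spec_bind[OF spec_operation[of _ 1], where ?c2.0 = "m * (6 * length as + 1) + length as"])
  fix z \<sigma>1 k1 assume e1: "extends k \<sigma> k1 \<sigma>1" and "reads \<sigma>1 k1 z (op_value F \<sigma> Zero)"
  then have z: "reads \<sigma>1 k1 z \<zero>" by simp
  have hm: "h A m \<in> carrier F" "h A \<in> pvec m" if "A \<in> set as" for A using h(1)[OF that] by auto
  have H1: "reads_vec (Suc m) \<sigma>1 k1 (H A) (h A)" if "A \<in> set as" for A
    by (rule reads_vec_extends[OF H[OF that] e1])
  have tab: "spec F (tabulate as (\<lambda>A. operation (Sub z (H A m)))) \<sigma>1 k1 (length as)
     (\<lambda>S \<sigma>' k'. \<forall>A\<in>set as. reads \<sigma>' k' (S A) (\<ominus> h A m))"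
  proof (rule spec_tabulate[where c = 1])
    fix A \<sigma>' k' assume A: "A \<in> set as" and e: "extends k1 \<sigma>1 k' \<sigma>'"
    have "reads \<sigma>' k' (H A m) (h A m)" "reads \<sigma>' k' z \<zero>"
      using H1[OF A] z reads_extends[OF _ e] by auto
    then have "op_value F \<sigma>' (Sub z (H A m)) = \<ominus> h A m"
      using hm[OF A] by (simp add: reads_def a_minus_def)
    then show "spec F (operation (Sub z (H A m))) \<sigma>' k' 1 (\<lambda>a \<sigma>' k'. reads \<sigma>' k' a (\<ominus> h A m))"
      using spec_operation[of "Sub z (H A m)" 1 F \<sigma>' k'] by simp
  qed (auto intro: reads_extends)
  show "spec F (bind_tree (tabulate as (\<lambda>A. operation (Sub z (H A m)))) (\<lambda>S.
     bind_tree (ell_prog m as H z S) (\<lambda>(l, S'). Return l))) \<sigma>1 k1 (m * (6 * length as + 1) + length as)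
     ?post"
  proof (rule spec_bind[OF tab, where ?c2.0 = "m * (6 * length as + 1)"])
    fix S \<sigma>2 k2 assume e2: "extends k1 \<sigma>1 k2 \<sigma>2" and S: "\<forall>A\<in>set as. reads \<sigma>2 k2 (S A) (\<ominus> h A m)"
    have H2: "reads_vec (Suc m) \<sigma>2 k2 (H A) (h A)" if "A \<in> set as" for A
      by (rule reads_vec_extends[OF H1[OF that] e2])
    note ell = spec_ell_prog[OF fin len h(1) H2 reads_extends[OF z e2] S[rule_format] order_refl]
    show "spec F (bind_tree (ell_prog m as H z S) (\<lambda>(l, S'). Return l)) \<sigma>2 k2 (m * (6 * length as + 1))
      ?post"
    proof (rule spec_bind[OF ell, where ?c2.0 = 0])
      fix lS \<sigma>3 k3
      assume "extends k2 \<sigma>2 k3 \<sigma>3" and "case lS of (l, S) \<Rightarrow> \<exists>x\<in>pvec m. reads_vec m \<sigma>3 k3 l x \<and>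
        (\<forall>A\<in>set as. reads \<sigma>3 k3 (S A) (dot m (h A) x \<ominus> h A m) \<and>
        (h A m \<noteq> \<zero> \<or> (\<exists>i<m. h A i \<noteq> \<zero>) \<longrightarrow> dot m (h A) x \<ominus> h A m \<noteq> \<zero>))"
      then obtain l S' x where lS: "lS = (l, S')" and x: "x \<in> pvec m" "reads_vec m \<sigma>3 k3 l x"
        "\<And>A. A \<in> set as \<Longrightarrow> h A m \<noteq> \<zero> \<or> (\<exists>i<m. h A i \<noteq> \<zero>) \<Longrightarrow> dot m (h A) x \<ominus> h A m \<noteq> \<zero>"
        by (auto split: prod.splits)
      have "dot m (h A) x \<noteq> h A m" if A: "A \<in> set as" for A
      proof -
        have "h A m \<noteq> \<zero> \<or> (\<exists>i<m. h A i \<noteq> \<zero>)" using h(2)[OF A] less_Suc_eq by auto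
        then show ?thesis using x(3)[OF A] hm[OF A] by (auto simp: a_minus_def r_neg)
      qed
      then show "spec F (case lS of (l, S') \<Rightarrow> Return l) \<sigma>3 k3 0
        ?post"
        unfolding lS prod.case using x(1,2) by (intro spec_Return) blast
    qed auto
  qed simp
qed auto

end

text \<open>The bound of \<open>spec_null_vector\<close> for \<open>m\<close> vectors of length
  \<open>Suc m\<close>, the only case that occurs.\<close>

definition null_cost :: "nat \<Rightarrow> nat" where
  "null_cost m = 2 + m * (4 * Suc m * Suc m + 3 * Suc m + 2)"

section \<open>Correctness and cost of the remaining phases\<close>

context coeff_field begin

lemma spec_null_pivot:
  assumes "list_all2 (reads_vec (Suc m) \<sigma> k) vs xs" "set xs \<subseteq> vecs F (Suc m)" "length xs = m"
    and cs: "set cs \<subseteq> {..<Suc m}"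
  shows "spec F (null_pivot (Suc m) vs cs) \<sigma> k (null_cost m + 1 + length cs) (\<lambda>q \<sigma>' k'.
    \<exists>h\<in>pvec (Suc m). (\<exists>i<Suc m. h i \<noteq> \<zero>) \<and> (\<forall>x\<in>set xs. dot (Suc m) h x = \<zero>) \<and>
      (case q of None \<Rightarrow> \<forall>a\<in>set cs. h a = \<zero> | Some a \<Rightarrow> a \<in> set cs \<and> h a \<noteq> \<zero>))"
proof -
  have len: "length xs < Suc m" using assms(3) by simp
  obtain v \<sigma>1 k1 c1 where e1: "exec F (null_vector (Suc m) vs) \<sigma> k = (v, \<sigma>1, k1, c1)"
    and c1: "c1 \<le> 2 + length xs * (4 * Suc m * Suc m + 3 * Suc m + 2)" and x1: "extends k \<sigma> k1 \<sigma>1"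
    and v: "\<exists>h\<in>pvec (Suc m). reads_vec (Suc m) \<sigma>1 k1 v h \<and> (\<exists>i<Suc m. h i \<noteq> \<zero>) \<and> (\<forall>x\<in>set xs. dot (Suc m) h x = \<zero>)"
    by (rule specE[OF spec_null_vector[OF assms(1,2) len]])
  obtain z \<sigma>2 k2 c2 where e2: "exec F (operation Zero) \<sigma>1 k1 = (z, \<sigma>2, k2, c2)" and c2: "c2 \<le> 1"
    and x2: "extends k1 \<sigma>1 k2 \<sigma>2" and z: "reads \<sigma>2 k2 z (op_value F \<sigma>1 Zero)"
    by (rule specE[OF spec_operation[of Zero 1 F \<sigma>1 k1]]) auto
  have z0: "\<sigma>2 z = \<zero>" using z by (simp add: reads_def)
  obtain q \<sigma>3 k3 c3 where e3: "exec F (find_nonzero z v cs) \<sigma>2 k2 = (q, \<sigma>3, k3, c3)" and c3: "c3 \<le> length cs"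
    and x3: "extends k2 \<sigma>2 k3 \<sigma>3" and q: "\<sigma>3 = \<sigma>2 \<and> k3 = k2 \<and>
      (case q of None \<Rightarrow> \<forall>a\<in>set cs. \<sigma>2 (v a) = \<zero> | Some a \<Rightarrow> a \<in> set cs \<and> \<sigma>2 (v a) \<noteq> \<zero>)"
    by (rule specE[OF spec_find_nonzero[where \<sigma> = \<sigma>2 and z = z, OF z0]])
  obtain h where h: "h \<in> pvec (Suc m)" "reads_vec (Suc m) \<sigma>1 k1 v h" "\<exists>i<Suc m. h i \<noteq> \<zero>"
    "\<forall>x\<in>set xs. dot (Suc m) h x = \<zero>" using v by blast
  have hv: "\<sigma>2 (v a) = h a" if "a \<in> set cs" for a
    using reads_vec_extends[OF h(2) x2] that cs by (auto simp: reads_def)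
  have piv: "case q of None \<Rightarrow> \<forall>a\<in>set cs. h a = \<zero> | Some a \<Rightarrow> a \<in> set cs \<and> h a \<noteq> \<zero>"
    using q hv by (auto split: option.splits)
  have e: "exec F (null_pivot (Suc m) vs cs) \<sigma> k = (q, \<sigma>3, k3, c3 + c2 + c1)"
    by (simp add: null_pivot_def exec_bind_tree e1 e2 e3)
  have c: "c3 + c2 + c1 \<le> null_cost m + 1 + length cs"
    using c1 c2 c3 assms(3) by (simp add: null_cost_def)
  have x: "extends k \<sigma> k3 \<sigma>3" by (rule extends_trans[OF x1 extends_trans[OF x2 x3]])
  show ?thesis
    unfolding spec_def e prod.case
    by (intro conjI c x bexI[OF _ h(1)] h(3,4) piv)
qed

lemma reads_input:
  "reads \<sigma> k (QEntry i j) (\<sigma> (QEntry i j))" "reads \<sigma> k (Global e i) (\<sigma> (Global e i))"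
  "reads \<sigma> k (Kernel v d e) (\<sigma> (Kernel v d e))"
  by (simp_all add: reads_def)

lemma dot_restrict: "dot n x (restrict f {..<n}) = dot n x f"
  by (rule dot_cong) auto

lemma spec_drop_chosen:
  assumes Q: "Q \<in> Units (mat_monoid F (Suc m))" and w: "1 \<le> w" "w \<le> Suc m"
    and \<sigma>: "\<And>i j. \<sigma> (QEntry i j) = Q (i, j)"
  shows "spec F (drop_chosen m w) \<sigma> k (null_cost m + 1 + w) (\<lambda>i0 \<sigma>' k'. i0 < w \<and>
    \<not> lin_dep_family F m (\<lambda>i. restrict (mat_col (Suc m) Q i) {..<m}) ({..<w} - {i0}))"
proof -
  note cQ = units_entry[OF Q]
  let ?xs = "map (\<lambda>i. \<lambda>j\<in>{..<Suc m}. Q (i, j)) [0..<m]"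
  have rd: "list_all2 (reads_vec (Suc m) \<sigma> k) (map (\<lambda>i j. QEntry i j) [0..<m]) ?xs"
    using reads_input(1)[of \<sigma> k] \<sigma> by (simp add: list_all2_conv_all_nth)
  have xs: "set ?xs \<subseteq> vecs F (Suc m)" using cQ by (auto split: if_splits)
  have ws: "set [0..<w] \<subseteq> {..<Suc m}" using w by auto
  show ?thesis
    unfolding drop_chosen_def
  proof (rule spec_bind[OF spec_null_pivot[OF rd xs _ ws], where ?c2.0 = 0])
    fix q \<sigma>' k'
    assume "\<exists>h\<in>pvec (Suc m). (\<exists>i<Suc m. h i \<noteq> \<zero>) \<and> (\<forall>x\<in>set ?xs. dot (Suc m) h x = \<zero>) \<and>
      (case q of None \<Rightarrow> \<forall>a\<in>set [0..<w]. h a = \<zero> | Some a \<Rightarrow> a \<in> set [0..<w] \<and> h a \<noteq> \<zero>)"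
    then obtain h where h: "h \<in> pvec (Suc m)" "\<exists>i<Suc m. h i \<noteq> \<zero>" "\<forall>x\<in>set ?xs. dot (Suc m) h x = \<zero>"
      "case q of None \<Rightarrow> \<forall>a\<in>set [0..<w]. h a = \<zero> | Some a \<Rightarrow> a \<in> set [0..<w] \<and> h a \<noteq> \<zero>" by blast
    define i0 where "i0 = (case q of None \<Rightarrow> 0 | Some i \<Rightarrow> i)"
    have i0: "i0 < w" "h i0 \<noteq> \<zero> \<or> (\<forall>i<w. h i = \<zero>)"
      using h(4) w(1) by (auto simp: i0_def split: option.splits)
    have "dot (Suc m) (\<lambda>j. Q (i, j)) h = \<zero>" if "i < m" for i
      using h(3) that dot_comm[OF h(1), of "\<lambda>j. Q (i, j)"] cQ by (auto simp: dot_restrict)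
    then have "\<not> lin_dep_family F m (\<lambda>i. restrict (mat_col (Suc m) Q i) {..<m}) ({..<w} - {i0})"
      by (intro chosen_independent[OF Q h(1,2) _ w(2) i0(2,1)])
    then show "spec F (Return (case q of None \<Rightarrow> 0 | Some i \<Rightarrow> i)) \<sigma>' k' 0 (\<lambda>i0 \<sigma>' k'. i0 < w \<and>
      \<not> lin_dep_family F m (\<lambda>i. restrict (mat_col (Suc m) Q i) {..<m}) ({..<w} - {i0}))"
      using i0(1) by (intro spec_Return) (simp add: i0_def)
  qed simp_all
qed

text \<open>The premise \<open>ex\<close> excludes the answer \<open>None\<close> of the search, so
  that \<open>the\<close> in \<open>drop_other\<close> is justified; it is discharged by
  \<open>dropped_column_exists\<close>.\<close>

lemma spec_drop_other:
  assumes Q: "\<And>i j. i < Suc m \<Longrightarrow> j < Suc m \<Longrightarrow> Q (i, j) \<in> carrier F" and l: "l \<in> pvec m"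
    and P: "\<And>i. i < m \<Longrightarrow> reads_vec (Suc m) \<sigma> k (P i) (\<lambda>j. Q (i, j) \<oplus> l i \<otimes> Q (m, j))"
    and cs: "set cs \<subseteq> {..<Suc m}"
    and ex: "\<And>h. h \<in> pvec (Suc m) \<Longrightarrow> \<exists>i<Suc m. h i \<noteq> \<zero> \<Longrightarrow>
      (\<And>i. i < m \<Longrightarrow> dot (Suc m) (\<lambda>j. Q (i, j)) h \<oplus> l i \<otimes> dot (Suc m) (\<lambda>j. Q (m, j)) h = \<zero>) \<Longrightarrow>
      \<exists>i\<in>set cs. h i \<noteq> \<zero>"
  shows "spec F (drop_other m cs P) \<sigma> k (null_cost m + 1 + length cs) (\<lambda>i1 \<sigma>' k'. i1 \<in> set cs \<and>
    (\<exists>h\<in>pvec (Suc m). h i1 \<noteq> \<zero> \<and>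
      (\<forall>i<m. dot (Suc m) (\<lambda>j. Q (i, j)) h \<oplus> l i \<otimes> dot (Suc m) (\<lambda>j. Q (m, j)) h = \<zero>)))"
proof -
  let ?xs = "map (\<lambda>i. \<lambda>j\<in>{..<Suc m}. Q (i, j) \<oplus> l i \<otimes> Q (m, j)) [0..<m]"
  have li: "l i \<in> carrier F" if "i < m" for i using l that by auto
  have rd: "list_all2 (reads_vec (Suc m) \<sigma> k) (map P [0..<m]) ?xs"
    using P by (simp add: list_all2_conv_all_nth)
  have xs: "set ?xs \<subseteq> vecs F (Suc m)" using Q li by (auto split: if_splits)
  show ?thesis
    unfolding drop_other_def
  proof (rule spec_bind[OF spec_null_pivot[OF rd xs _ cs], where ?c2.0 = 0])
    fix q \<sigma>' k'
    assume "\<exists>h\<in>pvec (Suc m). (\<exists>i<Suc m. h i \<noteq> \<zero>) \<and> (\<forall>x\<in>set ?xs. dot (Suc m) h x = \<zero>) \<and>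
      (case q of None \<Rightarrow> \<forall>a\<in>set cs. h a = \<zero> | Some a \<Rightarrow> a \<in> set cs \<and> h a \<noteq> \<zero>)"
    then obtain h where h: "h \<in> pvec (Suc m)" "\<exists>i<Suc m. h i \<noteq> \<zero>" "\<forall>x\<in>set ?xs. dot (Suc m) h x = \<zero>"
      "case q of None \<Rightarrow> \<forall>a\<in>set cs. h a = \<zero> | Some a \<Rightarrow> a \<in> set cs \<and> h a \<noteq> \<zero>" by blast
    have 0: "dot (Suc m) (\<lambda>j. Q (i, j)) h \<oplus> l i \<otimes> dot (Suc m) (\<lambda>j. Q (m, j)) h = \<zero>" if i: "i < m" for i
    proof -
      have p: "(\<lambda>j. Q (i, j)) \<in> pvec (Suc m)" "(\<lambda>j. Q (m, j)) \<in> pvec (Suc m)"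
        "(\<lambda>j. l i \<otimes> Q (m, j)) \<in> pvec (Suc m)" using Q li i by auto
      have "dot (Suc m) h (\<lambda>j. Q (i, j) \<oplus> l i \<otimes> Q (m, j)) = \<zero>"
        using h(3) i by (auto simp: dot_restrict)
      then show ?thesis
        using dot_add_right[OF p(1,3) h(1)] dot_smult_right[OF li[OF i] p(2) h(1)]
          dot_comm[OF h(1) p(1)] dot_comm[OF h(1) p(2)] by simp
    qed
    then obtain i1 where "q = Some i1" using ex[OF h(1,2)] h(4) by (cases q) auto
    then show "spec F (Return (the q)) \<sigma>' k' 0 (\<lambda>i1 \<sigma>' k'. i1 \<in> set cs \<and>
      (\<exists>h\<in>pvec (Suc m). h i1 \<noteq> \<zero> \<and>
      (\<forall>i<m. dot (Suc m) (\<lambda>j. Q (i, j)) h \<oplus> l i \<otimes> dot (Suc m) (\<lambda>j. Q (m, j)) h = \<zero>)))"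
      using h 0 by (intro spec_Return) auto
  qed simp_all
qed

lemma spec_new_kernel:
  assumes l: "reads_vec m \<sigma> k l x"
  shows "spec F (new_kernel m s es l) \<sigma> k (m * (length es * 2)) (\<lambda>K \<sigma>' k'. \<forall>i<m. \<forall>e\<in>set es.
    reads \<sigma>' k' (K i e) (\<sigma> (Kernel s (Imag i) e) \<oplus> x i \<otimes> \<sigma> (Kernel s (Imag m) e)))"
proof -
  let ?val = "\<lambda>i e. \<sigma> (Kernel s (Imag i) e) \<oplus> x i \<otimes> \<sigma> (Kernel s (Imag m) e)"
  have "spec F (new_kernel m s es l) \<sigma> k (m * (length es * 2))
     (\<lambda>K \<sigma>' k'. \<forall>i\<in>set [0..<m]. \<forall>e\<in>set es. reads \<sigma>' k' (K i e) (?val i e))"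
    unfolding new_kernel_def
  proof (rule spec_tabulate)
    fix i \<sigma>1 k1 assume i: "i \<in> set [0..<m]" and e1: "extends k \<sigma> k1 \<sigma>1"
    show "spec F (tabulate es (\<lambda>e. bind_tree (operation (Mult (l i) (Kernel s (Imag m) e)))
       (\<lambda>t. operation (Add (Kernel s (Imag i) e) t)))) \<sigma>1 k1 (length es * 2)
       (\<lambda>g \<sigma>' k'. \<forall>e\<in>set es. reads \<sigma>' k' (g e) (?val i e))"
    proof (rule spec_tabulate)
      fix e \<sigma>2 k2 assume "extends k1 \<sigma>1 k2 \<sigma>2"
      then have e2: "extends k \<sigma> k2 \<sigma>2" by (rule extends_trans[OF e1])
      show "spec F (bind_tree (operation (Mult (l i) (Kernel s (Imag m) e)))
       (\<lambda>t. operation (Add (Kernel s (Imag i) e) t))) \<sigma>2 k2 2 (\<lambda>u \<sigma>' k'. reads \<sigma>' k' u (?val i e))"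
        using l i reads_extends[OF _ e2] by (intro spec_add_mult[OF _ _ _ refl] reads_extends[OF reads_input(3) e2]) auto
    qed (auto intro: reads_extends)
  qed (auto intro: reads_extends)
  then show ?thesis by (rule spec_mono) auto
qed

lemma spec_new_columns:
  assumes l: "reads_vec m \<sigma> k l x"
  shows "spec F (new_columns m l) \<sigma> k (m * (Suc m * 2)) (\<lambda>P \<sigma>' k'. \<forall>i<m.
    reads_vec (Suc m) \<sigma>' k' (P i) (\<lambda>j. \<sigma> (QEntry i j) \<oplus> x i \<otimes> \<sigma> (QEntry m j)))"
proof -
  let ?val = "\<lambda>i j. \<sigma> (QEntry i j) \<oplus> x i \<otimes> \<sigma> (QEntry m j)"
  have "spec F (new_columns m l) \<sigma> k (m * (Suc m * 2))
     (\<lambda>P \<sigma>' k'. \<forall>i\<in>set [0..<m]. \<forall>j\<in>set [0..<Suc m]. reads \<sigma>' k' (P i j) (?val i j))"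
    unfolding new_columns_def
  proof (rule spec_tabulate)
    fix i \<sigma>1 k1 assume i: "i \<in> set [0..<m]" and e1: "extends k \<sigma> k1 \<sigma>1"
    show "spec F (tabulate [0..<Suc m] (\<lambda>j. bind_tree (operation (Mult (l i) (QEntry m j)))
       (\<lambda>t. operation (Add (QEntry i j) t)))) \<sigma>1 k1 (Suc m * 2)
       (\<lambda>g \<sigma>' k'. \<forall>j\<in>set [0..<Suc m]. reads \<sigma>' k' (g j) (?val i j))"
    proof (rule spec_tabulate)
      fix j \<sigma>2 k2 assume "extends k1 \<sigma>1 k2 \<sigma>2"
      then have e2: "extends k \<sigma> k2 \<sigma>2" by (rule extends_trans[OF e1])
      show "spec F (bind_tree (operation (Mult (l i) (QEntry m j)))
       (\<lambda>t. operation (Add (QEntry i j) t))) \<sigma>2 k2 2 (\<lambda>u \<sigma>' k'. reads \<sigma>' k' u (?val i j))"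
        using l i reads_extends[OF _ e2] by (intro spec_add_mult[OF _ _ _ refl] reads_extends[OF reads_input(1) e2]) auto
    qed (auto intro: reads_extends)
  qed (auto intro: reads_extends)
  then show ?thesis by (rule spec_mono) (auto simp: less_Suc_eq)
qed

end

text \<open>\<open>js\<close> and \<open>cs\<close> partition the indices up to \<open>m\<close>, so
  deleting \<open>i1\<close> from \<open>cs\<close> leaves an enumeration of all columns but one
  that begins with the chosen ones. The case \<open>i1 = i0\<close> is possible.\<close>

lemma column_list:
  fixes w m i0 i1 :: nat
  defines "js \<equiv> filter (\<lambda>j. j \<noteq> i0) [0..<w]" and "cs \<equiv> i0 # [w..<Suc m]"
  assumes i0: "i0 < w" and w: "w \<le> Suc m" and i1: "i1 \<in> set cs"
  shows "set js = {..<w} - {i0}" "length js = w - 1" "set cs \<subseteq> {..<Suc m}" "length cs = Suc m - w + 1"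
    and "bij_betw ((!) (js @ filter (\<lambda>j. j \<noteq> i1) cs)) {..<m} ({..<Suc m} - {i1})"
    and "(!) (js @ filter (\<lambda>j. j \<noteq> i1) cs) ` {..<w - 1} = {..<w} - {i0}"
proof -
  show js: "set js = {..<w} - {i0}" by (auto simp: js_def)
  have dj: "distinct js" by (simp add: js_def)
  show len: "length js = w - 1"
    using distinct_card[OF dj] js i0 by simp
  show cs: "set cs \<subseteq> {..<Suc m}" "length cs = Suc m - w + 1" using i0 w by (auto simp: cs_def)
  let ?cols = "js @ filter (\<lambda>j. j \<noteq> i1) cs"
  have d: "distinct ?cols" using dj i0 by (auto simp: js cs_def)
  have s: "set ?cols = {..<Suc m} - {i1}"
    using i0 w i1 by (auto simp: js cs_def)
  have "i1 < Suc m" using i1 cs by auto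
  then have "length ?cols = m" using distinct_card[OF d] s by simp
  then show "bij_betw ((!) ?cols) {..<m} ({..<Suc m} - {i1})"
    using bij_betw_nth[OF d, of "{..<m}" "{..<Suc m} - {i1}"] s by simp
  have "(!) ?cols ` {..<w - 1} = (!) js ` {..<length js}"
    unfolding len[symmetric] by (rule image_cong) (auto simp: nth_append)
  also have "\<dots> = set js" by (auto simp: set_conv_nth)
  finally show "(!) ?cols ` {..<w - 1} = {..<w} - {i0}" using js by simp
qed

text \<open>Here \<open>a\<close> is the number of primary sets and \<open>b\<close> that of the
  arcs leaving \<open>s\<close>. One null vector costs at most 26 times \<open>m ^ 3\<close>, from
  the coefficients 4, 11, 9 and 2 of \<open>null_cost\<close>; \<open>1 \<le> a\<close> absorbs the
  two pivot searches. The estimates add up to at most 98 times \<open>m ^ 3 * a\<close> plus twice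
  \<open>m * b\<close>, and 200 is a round constant above that.\<close>

lemma cost_bound:
  assumes m: "1 \<le> m" and n: "w + r = Suc m" and a: "1 \<le> a"
  shows "(null_cost m + 1 + w) + a * null_cost m + (m * (6 * a + 1) + a + 1) + m * (b * 2) + m * (Suc m * 2)
     + (null_cost m + 1 + (Suc m - w + 1)) \<le> 200 * (m ^ 3 * a + m * b)"
proof -
  have m2: "m \<le> m * m" using m by simp
  have m3: "m * m \<le> m ^ 3" using m by (simp add: power3_eq_cube)
  have nc: "null_cost m \<le> 26 * m ^ 3"
  proof -
    have "null_cost m = 4 * m ^ 3 + 11 * (m * m) + 9 * m + 2"
      by (simp add: null_cost_def power3_eq_cube algebra_simps)
    then show ?thesis using m m2 m3 by linarith
  qed
  have ma: "m * a \<le> m ^ 3 * a" using order_trans[OF m2 m3] by (rule mult_right_mono) simp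
  have X: "m ^ 3 \<le> m ^ 3 * a" and A: "a \<le> m * a" using a m by auto
  have aN: "a * null_cost m \<le> 26 * (m ^ 3 * a)" using mult_left_mono[OF nc, of a] by (simp add: mult_ac)
  have eqs: "m * (6 * a + 1) = 6 * (m * a) + m" "m * (b * 2) = 2 * (m * b)" "m * (Suc m * 2) = 2 * (m * m) + 2 * m"
    by (simp_all add: algebra_simps)
  \<comment> \<open>All products are replaced by variables, which leaves a linear problem.\<close>
  have linear: "N + 1 + w + aN + (Y + a + 1) + W + V + (N + 1 + (d + 1)) \<le> 200 * (Xa + Z)"
    if "aN \<le> 26 * Xa" "Y = 6 * ma + m" "W = 2 * Z" "V = 2 * mm + 2 * m" "N \<le> 26 * X" "ma \<le> Xa" "X \<le> Xa"
      "a \<le> ma" "m \<le> mm" "mm \<le> X" "1 \<le> m" "d \<le> Suc m" "w \<le> Suc m" for N aN Y W V Xa X ma mm Z d :: nat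
  proof -
    have u: "mm \<le> Xa" using that(7,10) by (rule order_trans[rotated])
    have v: "m \<le> Xa" using that(9) u by (rule order_trans)
    have "a \<le> Xa" using that(8,6) by (rule order_trans)
    moreover have "N \<le> 26 * Xa" using that(5,7) by linarith
    moreover have "Y \<le> 7 * Xa" using that(2,6) v by linarith
    moreover have "V \<le> 4 * Xa" using that(4) u v by linarith
    moreover have "1 \<le> Xa" using that(11) v by (rule order_trans)
    moreover have "d \<le> 1 + Xa" "w \<le> 1 + Xa" using that(12,13) v by linarith+
    ultimately show ?thesis using that(1,3) by (simp add: distrib_left)
  qed
  show ?thesis
    by (rule linear[where X = "m ^ 3" and ma = "m * a" and mm = "m * m", OF aN eqs nc ma X A m2 m3 m])
      (use n in auto)
qed

section \<open>The whole reduction: correctness, cost and security of the result\<close>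

context coded_network begin

lemma spec_functionals:
  fixes \<sigma> :: "('v, 'e) address \<Rightarrow> 'f"
  assumes C: "linear_code F (Suc m) C" and Q: "\<And>i j. i < Suc m \<Longrightarrow> j < Suc m \<Longrightarrow> Q (i, j) \<in> carrier F"
    and js: "set js \<subseteq> {..<Suc m}" and As: "\<And>A. A \<in> set As \<Longrightarrow> finite A \<and> length js + card A = m"
    and \<sigma>: "\<And>i j. \<sigma> (QEntry i j) = Q (i, j)" "\<And>e i. \<sigma> (Global e i) = global_kernel F (Suc m) C e i"
  shows "spec F (functionals m js As) \<sigma> k (length As * null_cost m) (\<lambda>H \<sigma>' k'. \<forall>A\<in>set As.
    \<exists>h\<in>pvec (Suc m). reads_vec (Suc m) \<sigma>' k' (H A) h \<and> (\<exists>i<Suc m. h i \<noteq> \<zero>) \<and>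
      (\<forall>j\<in>set js. dot (Suc m) h (\<lambda>k. Q (k, j)) = \<zero>) \<and>
      (\<forall>e\<in>A. dot (Suc m) h (global_kernel F (Suc m) C e) = \<zero>))"
    (is "spec F _ \<sigma> k _ (\<lambda>H \<sigma>' k'. \<forall>A\<in>set As. ?post A (H A) \<sigma>' k')")
  unfolding functionals_def
proof (rule spec_tabulate)
  fix A \<sigma>1 k1 assume A: "A \<in> set As" and e1: "extends k \<sigma> k1 \<sigma>1"
  let ?vs = "map (\<lambda>j i. QEntry i j) js @ map Global (list_of A)"
  let ?xs = "map (mat_col (Suc m) Q) js @ map (global_kernel F (Suc m) C) (list_of A)"
  have rd: "reads \<sigma>1 k1 (QEntry i j) (Q (i, j))" "reads \<sigma>1 k1 (Global e i) (global_kernel F (Suc m) C e i)" for i j e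
    using reads_extends[OF reads_input(1) e1] reads_extends[OF reads_input(2) e1] \<sigma> by metis+
  have lo: "set (list_of A) = A" "length (list_of A) = card A"
    using list_of length_list_of As[OF A] by blast+
  have "list_all2 (reads_vec (Suc m) \<sigma>1 k1) ?vs ?xs"
    using rd by (intro list_all2_appendI) (auto simp: list_all2_conv_all_nth mat_col_def)
  moreover have "set ?xs \<subseteq> vecs F (Suc m)"
    using global_kernel_closed[OF C] js Q by (auto intro!: mat_col_vecs)
  moreover have "length ?xs = m" using As[OF A] lo by simp
  ultimately have "spec F (null_vector (Suc m) ?vs) \<sigma>1 k1 (2 + length ?xs * (4 * Suc m * Suc m + 3 * Suc m + 2))
     (\<lambda>v \<sigma>' k'. \<exists>h\<in>pvec (Suc m). reads_vec (Suc m) \<sigma>' k' v h \<and> (\<exists>i<Suc m. h i \<noteq> \<zero>) \<and> (\<forall>x\<in>set ?xs. dot (Suc m) h x = \<zero>))"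
    by (intro spec_null_vector) auto
  then show "spec F (null_vector (Suc m) ?vs) \<sigma>1 k1 (null_cost m) (?post A)"
  proof (rule spec_mono)
    show "2 + length ?xs * (4 * Suc m * Suc m + 3 * Suc m + 2) \<le> null_cost m"
      using \<open>length ?xs = m\<close> by (simp add: null_cost_def)
    fix v :: "nat \<Rightarrow> ('v, 'e) address" and \<sigma>' k'
    assume "\<exists>h\<in>pvec (Suc m). reads_vec (Suc m) \<sigma>' k' v h \<and> (\<exists>i<Suc m. h i \<noteq> \<zero>) \<and> (\<forall>x\<in>set ?xs. dot (Suc m) h x = \<zero>)"
    then obtain h where h: "h \<in> pvec (Suc m)" "reads_vec (Suc m) \<sigma>' k' v h" "\<exists>i<Suc m. h i \<noteq> \<zero>"
      "\<And>x. x \<in> set ?xs \<Longrightarrow> dot (Suc m) h x = \<zero>" by blast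
    have "dot (Suc m) h (\<lambda>k. Q (k, j)) = \<zero>" if "j \<in> set js" for j
      using h(4)[of "mat_col (Suc m) Q j"] that by (simp add: dot_mat_col)
    moreover have "dot (Suc m) h (global_kernel F (Suc m) C e) = \<zero>" if "e \<in> A" for e
      using h(4)[of "global_kernel F (Suc m) C e"] that lo(1) by simp
    ultimately show "?post A v \<sigma>' k'" using h(1-3) by blast
  qed
next
  fix A and v :: "nat \<Rightarrow> ('v, 'e) address" and \<sigma>1 k1 \<sigma>2 k2
  assume "?post A v \<sigma>1 k1" and e: "extends k1 \<sigma>1 k2 \<sigma>2"
  then show "?post A v \<sigma>2 k2"
    using reads_vec_extends[OF _ e] by blast
qed simp

text \<open>Besides the stored output it records, for every primary set, a functional that does not
  vanish at \<open>(l, -1)\<close>. Security of the new code follows from this record without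
  returning to the program.\<close>

definition reduction_correct where
  "reduction_correct m w r C Q out \<sigma> k \<longleftrightarrow> (\<exists>x\<in>pvec m. \<exists>i1. reads_vec m \<sigma> k (ell_at out) x \<and>
     (\<forall>i<m. \<forall>e\<in>out_arcs G s. reads \<sigma> k (kernel_at out i e) (C s (Imag i) e \<oplus> x i \<otimes> C s (Imag m) e)) \<and>
     (\<forall>i<m. \<forall>j<m. reads \<sigma> k (Q_at out i j) (Q (i, column out j) \<oplus> x i \<otimes> Q (m, column out j))) \<and>
     bij_betw (column out) {..<m} ({..<Suc m} - {i1}) \<and> column out ` {..<w - 1} = chosen out \<and>
     chosen out \<subseteq> {..<w} \<and> card (chosen out) = w - 1 \<and>
     \<not> lin_dep_family F m (\<lambda>i. restrict (mat_col (Suc m) Q i) {..<m}) (chosen out) \<and>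
     (\<lambda>(i, j)\<in>{..<m} \<times> {..<m}. Q (i, column out j) \<oplus> x i \<otimes> Q (m, column out j)) \<in> Units (mat_monoid F m) \<and>
     (\<forall>A\<in>primary_sets r. \<exists>h\<in>pvec (Suc m). (\<forall>j\<in>chosen out. dot (Suc m) h (\<lambda>k. Q (k, j)) = \<zero>) \<and>
        (\<forall>e\<in>A. dot (Suc m) h (global_kernel F (Suc m) C e) = \<zero>) \<and> dot m h x \<noteq> h m))"

text \<open>A primary set cutting off the empty set of edges.\<close>

lemma primary_set_exists:
  assumes "r \<le> card (out_arcs G s)"
  shows "primary_sets r \<noteq> {}"
  using exists_primary_set_cutting[of "{}" r] assms by auto

lemma spec_reduce_rate:
  assumes fin: "finite (carrier F)" and n: "w + r = Suc m" and w: "1 \<le> w" and r: "r \<le> card (out_arcs G s)"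
    and q: "card (primary_sets r) < card (carrier F)" and C: "linear_code F (Suc m) C"
    and Q: "Q \<in> Units (mat_monoid F (Suc m))" and m: "1 \<le> m"
  shows "spec F (reduce_rate G s T w r (primary_sets r)) (input_store F (Suc m) C Q) 0
    (200 * (m ^ 3 * card (primary_sets r) + m * card (out_arcs G s))) (reduction_correct m w r C Q)"
proof -
  note cQ = units_entry[OF Q]
  have wn: "w \<le> Suc m" using n by simp
  let ?\<sigma> = "input_store F (Suc m) C Q" and ?As = "list_of (primary_sets r)" and ?es = "list_of (out_arcs G s)"
  have As: "set ?As = primary_sets r" "length ?As = card (primary_sets r)"
    using list_of length_list_of finite_primary_sets by blast+
  have fo: "finite (out_arcs G s)" by (rule finite_subset[OF _ finite_arcs]) auto
  have es: "set ?es = out_arcs G s" "length ?es = card (out_arcs G s)"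
    using list_of[OF fo] length_list_of[OF fo] by blast+
  have \<sigma>: "?\<sigma> (QEntry i j) = Q (i, j)" "?\<sigma> (Global e i) = global_kernel F (Suc m) C e i"
    "?\<sigma> (Kernel v d e) = C v d e" for i j e v d
    by (simp_all add: input_store_def)

  obtain i0 \<sigma>1 k1 c1 where e1: "exec F (drop_chosen m w) ?\<sigma> 0 = (i0, \<sigma>1, k1, c1)"
    and c1: "c1 \<le> null_cost m + 1 + w" and x1: "extends 0 ?\<sigma> k1 \<sigma>1"
    and i0': "i0 < w \<and> \<not> lin_dep_family F m (\<lambda>i. restrict (mat_col (Suc m) Q i) {..<m}) ({..<w} - {i0})"
    by (rule specE[OF spec_drop_chosen[where \<sigma> = ?\<sigma>, OF Q w wn \<sigma>(1)]])
  have i0: "i0 < w" using i0' by blast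
  define js where "js = filter (\<lambda>j. j \<noteq> i0) [0..<w]"
  define cs where "cs = i0 # [w..<Suc m]"
  have i0cs: "i0 \<in> set cs" by (simp add: cs_def)
  note cols = column_list[OF i0 wn, folded js_def cs_def]
  have js: "set js = {..<w} - {i0}" "length js = w - 1" using cols(1,2)[OF i0cs] .
  have cs: "set cs \<subseteq> {..<Suc m}" "length cs = Suc m - w + 1" using cols(3,4)[OF i0cs] .
  have \<sigma>1: "\<sigma>1 (QEntry i j) = Q (i, j)" "\<sigma>1 (Global e i) = global_kernel F (Suc m) C e i" for i j e
    using x1 \<sigma> by (auto simp: extends_def)

  \<comment> \<open>\<open>w - 1\<close> columns and \<open>r\<close> kernels make exactly
    \<open>m\<close> vectors, one fewer than the dimension, so a nonzero functional kills them
    all.\<close>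
  have fA: "finite A \<and> length js + card A = m" if "A \<in> set ?As" for A
    using that As(1) js(2) n w finite_subset[OF _ finite_arcs, of A] by (auto simp: primary_sets_def)
  have jsn: "set js \<subseteq> {..<Suc m}" unfolding js(1) using wn by auto
  obtain H \<sigma>2 k2 c2 where e2: "exec F (functionals m js ?As) \<sigma>1 k1 = (H, \<sigma>2, k2, c2)"
    and c2: "c2 \<le> length ?As * null_cost m" and x2: "extends k1 \<sigma>1 k2 \<sigma>2"
    and H: "\<forall>A\<in>set ?As. \<exists>h\<in>pvec (Suc m). reads_vec (Suc m) \<sigma>2 k2 (H A) h \<and> (\<exists>i<Suc m. h i \<noteq> \<zero>) \<and>
      (\<forall>j\<in>set js. dot (Suc m) h (\<lambda>k. Q (k, j)) = \<zero>) \<and>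
      (\<forall>e\<in>A. dot (Suc m) h (global_kernel F (Suc m) C e) = \<zero>)"
    by (rule specE[OF spec_functionals[where \<sigma> = \<sigma>1 and k = k1, OF C cQ jsn fA \<sigma>1]])
  obtain h where "\<forall>A\<in>set ?As. h A \<in> pvec (Suc m) \<and> reads_vec (Suc m) \<sigma>2 k2 (H A) (h A) \<and>
      (\<exists>i<Suc m. h A i \<noteq> \<zero>) \<and> (\<forall>j\<in>set js. dot (Suc m) (h A) (\<lambda>k. Q (k, j)) = \<zero>) \<and>
      (\<forall>e\<in>A. dot (Suc m) (h A) (global_kernel F (Suc m) C e) = \<zero>)"
    using bchoice[OF H[unfolded Bex_def]] by (rule exE)
  then have h: "\<And>A. A \<in> set ?As \<Longrightarrow> h A \<in> pvec (Suc m)"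
    "\<And>A. A \<in> set ?As \<Longrightarrow> reads_vec (Suc m) \<sigma>2 k2 (H A) (h A)"
    "\<And>A. A \<in> set ?As \<Longrightarrow> \<exists>i<Suc m. h A i \<noteq> \<zero>"
    "\<And>A. A \<in> set ?As \<Longrightarrow> \<forall>j\<in>set js. dot (Suc m) (h A) (\<lambda>k. Q (k, j)) = \<zero>"
    "\<And>A. A \<in> set ?As \<Longrightarrow> \<forall>e\<in>A. dot (Suc m) (h A) (global_kernel F (Suc m) C e) = \<zero>"
    by - ((drule (1) bspec, elim conjE, assumption)+)

  have lenA: "length ?As < card (carrier F)" using q As(2) by simp
  obtain l \<sigma>3 k3 c3 where e3: "exec F (choose_ell m ?As H) \<sigma>2 k2 = (l, \<sigma>3, k3, c3)"
    and c3: "c3 \<le> m * (6 * length ?As + 1) + length ?As + 1" and x3: "extends k2 \<sigma>2 k3 \<sigma>3"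
    and l: "\<exists>x\<in>pvec m. reads_vec m \<sigma>3 k3 l x \<and> (\<forall>A\<in>set ?As. dot m (h A) x \<noteq> h A m)"
    by (rule specE[OF spec_choose_ell[OF fin lenA h(1,3,2)]])
  obtain x where x: "x \<in> pvec m" "reads_vec m \<sigma>3 k3 l x" "\<And>A. A \<in> set ?As \<Longrightarrow> dot m (h A) x \<noteq> h A m"
    using l by blast
  have x03: "extends 0 ?\<sigma> k3 \<sigma>3" by (rule extends_trans[OF x1 extends_trans[OF x2 x3]])

  obtain K \<sigma>4 k4 c4 where e4: "exec F (new_kernel m s ?es l) \<sigma>3 k3 = (K, \<sigma>4, k4, c4)"
    and c4: "c4 \<le> m * (length ?es * 2)" and x4: "extends k3 \<sigma>3 k4 \<sigma>4"
    and K: "\<forall>i<m. \<forall>e\<in>set ?es. reads \<sigma>4 k4 (K i e) (\<sigma>3 (Kernel s (Imag i) e) \<oplus> x i \<otimes> \<sigma>3 (Kernel s (Imag m) e))"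
    by (rule specE[OF spec_new_kernel[OF x(2)]])
  have \<sigma>3: "\<sigma>3 (Kernel v d e) = C v d e" for v d e
    using x03 \<sigma> by (auto simp: extends_def)
  have l4: "reads_vec m \<sigma>4 k4 l x" by (rule reads_vec_extends[OF x(2) x4])
  have x04: "extends 0 ?\<sigma> k4 \<sigma>4" by (rule extends_trans[OF x03 x4])

  obtain P \<sigma>5 k5 c5 where e5: "exec F (new_columns m l) \<sigma>4 k4 = (P, \<sigma>5, k5, c5)"
    and c5: "c5 \<le> m * (Suc m * 2)" and x5: "extends k4 \<sigma>4 k5 \<sigma>5"
    and P': "\<forall>i<m. reads_vec (Suc m) \<sigma>5 k5 (P i) (\<lambda>j. \<sigma>4 (QEntry i j) \<oplus> x i \<otimes> \<sigma>4 (QEntry m j))"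
    by (rule specE[OF spec_new_columns[OF l4]])
  have P: "reads_vec (Suc m) \<sigma>5 k5 (P i) (\<lambda>j. Q (i, j) \<oplus> x i \<otimes> Q (m, j))" if "i < m" for i
    using P' that x04 \<sigma>(1) by (auto simp: extends_def)

  \<comment> \<open>One primary set suffices here: its functional forces a nonzero coordinate of
    \<open>z\<close> outside the chosen columns.\<close>
  have other: "\<exists>i\<in>set cs. z i \<noteq> \<zero>"
    if z: "z \<in> pvec (Suc m)" "\<exists>i<Suc m. z i \<noteq> \<zero>"
      and z0: "\<And>i. i < m \<Longrightarrow> dot (Suc m) (\<lambda>j. Q (i, j)) z \<oplus> x i \<otimes> dot (Suc m) (\<lambda>j. Q (m, j)) z = \<zero>" for z
  proof -
    obtain A where A: "A \<in> set ?As" using primary_set_exists[OF r] As(1) by blast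
    have "\<exists>i<Suc m. i \<notin> set js \<and> z i \<noteq> \<zero>"
      using dropped_column_exists[OF Q x(1) z z0 h(1)[OF A] _ x(3)[OF A], of "set js"] h(4)[OF A] by blast
    then obtain i where i: "i < Suc m" "i \<notin> set js" "z i \<noteq> \<zero>" by blast
    have "i \<in> set cs" using i(1,2) unfolding js(1) cs_def by (cases "i = i0") auto
    then show ?thesis using i(3) by blast
  qed
  obtain i1 \<sigma>6 k6 c6 where e6: "exec F (drop_other m cs P) \<sigma>5 k5 = (i1, \<sigma>6, k6, c6)"
    and c6: "c6 \<le> null_cost m + 1 + length cs" and x6: "extends k5 \<sigma>5 k6 \<sigma>6"
    and i1': "i1 \<in> set cs \<and> (\<exists>z\<in>pvec (Suc m). z i1 \<noteq> \<zero> \<and>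
      (\<forall>i<m. dot (Suc m) (\<lambda>j. Q (i, j)) z \<oplus> x i \<otimes> dot (Suc m) (\<lambda>j. Q (m, j)) z = \<zero>))"
    by (rule specE[OF spec_drop_other[OF cQ x(1) P cs(1) other]])
  obtain z where i1: "i1 \<in> set cs" and z: "z \<in> pvec (Suc m)" "z i1 \<noteq> \<zero>"
      "\<And>i. i < m \<Longrightarrow> dot (Suc m) (\<lambda>j. Q (i, j)) z \<oplus> x i \<otimes> dot (Suc m) (\<lambda>j. Q (m, j)) z = \<zero>"
    using i1' by blast
  have i1n: "i1 < Suc m" using i1 cs(1) by auto
  define col where "col = (!) (js @ filter (\<lambda>j. j \<noteq> i1) cs)"
  have col: "bij_betw col {..<m} ({..<Suc m} - {i1})" "col ` {..<w - 1} = {..<w} - {i0}"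
    unfolding col_def using cols(5,6)[OF i1] .
  have col_lt: "col j < Suc m" if "j < m" for j using col(1) that by (auto simp: bij_betw_def)
  define out :: "('v, 'e) reduction" where
    "out = \<lparr>chosen = set js, ell_at = l, kernel_at = K, column = col, Q_at = \<lambda>i j. P i (col j)\<rparr>"
  have m0: "w + r - 1 = m" using n by simp
  have "exec F (reduce_rate G s T w r (primary_sets r)) ?\<sigma> 0 = (out, \<sigma>6, k6, c6 + c5 + c4 + c3 + c2 + c1)"
  proof -
    have mne: "m \<noteq> 0" using m by simp
    show ?thesis
      unfolding reduce_rate_def Let_def m0 if_not_P[OF mne] exec_bind_tree e1 prod.case js_def[symmetric] cs_def[symmetric]
        e2 e3 e4 e5 e6 exec.simps(1) out_def col_def add_0 ..
  qed
  moreover have "c6 + c5 + c4 + c3 + c2 + c1 \<le> 200 * (m ^ 3 * card (primary_sets r) + m * card (out_arcs G s))"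
  proof -
    have "1 \<le> card (primary_sets r)"
      using primary_set_exists[OF r] finite_primary_sets[of r] by (simp add: Suc_le_eq card_gt_0_iff)
    from cost_bound[OF m n this, of "card (out_arcs G s)"]
    show ?thesis using c1 c2 c3 c4 c5 c6 unfolding As(2) es(2) cs(2) by linarith
  qed
  moreover have x06: "extends 0 ?\<sigma> k6 \<sigma>6" by (rule extends_trans[OF x04 extends_trans[OF x5 x6]])
  moreover have "reduction_correct m w r C Q out \<sigma>6 k6"
    unfolding reduction_correct_def
  proof (intro bexI[OF _ x(1)] exI[of _ i1] conjI)
    have x46: "extends k4 \<sigma>4 k6 \<sigma>6" by (rule extends_trans[OF x5 x6])
    show "reads_vec m \<sigma>6 k6 (ell_at out) x"
      using reads_vec_extends[OF l4 x46] by (simp add: out_def)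
    show "\<forall>i<m. \<forall>e\<in>out_arcs G s. reads \<sigma>6 k6 (kernel_at out i e) (C s (Imag i) e \<oplus> x i \<otimes> C s (Imag m) e)"
      using K es(1) reads_extends[OF _ x46] by (simp add: out_def \<sigma>3)
    show "\<forall>i<m. \<forall>j<m. reads \<sigma>6 k6 (Q_at out i j) (Q (i, column out j) \<oplus> x i \<otimes> Q (m, column out j))"
      using P col_lt reads_extends[OF _ x6] by (simp add: out_def)
    show "bij_betw (column out) {..<m} ({..<Suc m} - {i1})" "column out ` {..<w - 1} = chosen out"
      using col js(1) by (simp_all add: out_def)
    show "chosen out \<subseteq> {..<w}" "card (chosen out) = w - 1"
      using js i0 by (auto simp: out_def)
    show "\<not> lin_dep_family F m (\<lambda>i. restrict (mat_col (Suc m) Q i) {..<m}) (chosen out)"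
      using i0' js(1) by (simp add: out_def)
    have xi: "x i \<in> carrier F" if "i < m" for i using x(1) that by auto
    show "(\<lambda>(i, j)\<in>{..<m} \<times> {..<m}. Q (i, column out j) \<oplus> x i \<otimes> Q (m, column out j)) \<in> Units (mat_monoid F m)"
    proof (rule remaining_columns_unit[OF fin Q x(1) z(1,2) i1n z(3) col(1)])
      show "(\<lambda>(i, j)\<in>{..<m} \<times> {..<m}. Q (i, column out j) \<oplus> x i \<otimes> Q (m, column out j)) \<in> carrier (mat_monoid F m)"
        using cQ col_lt xi by (auto simp: mat_monoid_def out_def)
    qed (auto simp: out_def)
    show "\<forall>A\<in>primary_sets r. \<exists>h\<in>pvec (Suc m). (\<forall>j\<in>chosen out. dot (Suc m) h (\<lambda>k. Q (k, j)) = \<zero>) \<and>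
        (\<forall>e\<in>A. dot (Suc m) h (global_kernel F (Suc m) C e) = \<zero>) \<and> dot m h x \<noteq> h m"
    proof
      fix A assume "A \<in> primary_sets r"
      then have A: "A \<in> set ?As" using As(1) by simp
      show "\<exists>h\<in>pvec (Suc m). (\<forall>j\<in>chosen out. dot (Suc m) h (\<lambda>k. Q (k, j)) = \<zero>) \<and>
        (\<forall>e\<in>A. dot (Suc m) h (global_kernel F (Suc m) C e) = \<zero>) \<and> dot m h x \<noteq> h m"
        using h(4,5)[OF A] x(3)[OF A] by (intro bexI[OF _ h(1)[OF A]]) (simp add: out_def)
    qed
  qed
  ultimately show ?thesis by (simp add: spec_def)
qed

text \<open>For \<open>n = 1\<close> the claimed bound is \<open>0\<close>, so that the program must not perform any operation.\<close>

lemma spec_reduce_rate_0: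
  assumes n: "w + r = 1" and w: "1 \<le> w"
  shows "spec F (reduce_rate G s T w r (primary_sets r)) \<sigma> 0 0 (reduction_correct 0 w r C Q)"
proof -
  have wr: "w = 1" "r = 0" using n w by auto
  have A: "A = {}" if "A \<in> primary_sets 0" for A
    using that finite_subset[OF _ finite_arcs, of A] by (auto simp: primary_sets_def)
  have U: "(\<lambda>(i, j)\<in>{..<0} \<times> {..<0}. f i j) \<in> Units (mat_monoid F 0)" for f :: "nat \<Rightarrow> nat \<Rightarrow> 'f"
    by (auto simp: Units_def mat_monoid_def mat_mult_def)
  \<comment> \<open>In dimension 1 the vector \<open>(l, -1)\<close> is just -1 and \<open>A\<close>
    is empty, so any nonzero functional will do.\<close>
  have A': "\<forall>A\<in>primary_sets 0. \<exists>h\<in>pvec (Suc 0). (\<forall>j\<in>{}. dot (Suc 0) h (\<lambda>k. Q (k, j)) = \<zero>) \<and>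
      (\<forall>e\<in>A. dot (Suc 0) h (global_kernel F (Suc 0) C e) = \<zero>) \<and> dot 0 h (\<lambda>_. \<zero>) \<noteq> h 0"
    using A by (intro ballI bexI[of _ "\<lambda>_. \<one>"]) auto
  let ?out = "\<lparr>chosen = {}, ell_at = \<lambda>_. Temp 0, kernel_at = \<lambda>_ _. Temp 0, column = id, Q_at = \<lambda>_ _. Temp 0\<rparr>
    :: ('v, 'e) reduction"
  have "reduction_correct 0 1 0 C Q ?out \<sigma> 0"
    unfolding reduction_correct_def
    by (intro bexI[of _ "\<lambda>_. \<zero>"] exI[of _ 0] conjI U)
      (use A' in \<open>auto simp: lin_dep_family_def bij_betw_def\<close>)
  then show ?thesis
    unfolding reduce_rate_def wr Let_def by (simp add: spec_Return)
qed

text \<open>\<open>dual_secure_reduced\<close> is applied to each primary set with its own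
  functional \<open>h\<close>; only \<open>l\<close>, \<open>col\<close> and \<open>Q'\<close> are
  common to all sets. Decodability comes from \<open>reduced_injective\<close>.\<close>

lemma slnc_reduced:
  assumes fin: "finite (carrier F)" and n: "w + r = Suc m" and w: "1 \<le> w" and r: "r \<le> card (out_arcs G s)"
    and C: "linear_code F (Suc m) C" and dec: "decodable F (Suc m) C"
    and Q: "Q \<in> Units (mat_monoid F (Suc m))"
    and sec: "\<And>A. A \<in> primary_sets r \<Longrightarrow> dual_secure (Suc m) w C Q A"
    and l: "l \<in> pvec m" and col: "inj_on col {..<m}" "col ` {..<w - 1} \<subseteq> {..<w}"
    and Q': "Q' \<in> Units (mat_monoid F m)"
      "\<And>i j. i < m \<Longrightarrow> j < m \<Longrightarrow> Q' (i, j) = Q (i, col j) \<oplus> l i \<otimes> Q (m, col j)"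
    and h: "\<And>A. A \<in> primary_sets r \<Longrightarrow> \<exists>h\<in>pvec (Suc m).
      (\<forall>j\<in>col ` {..<w - 1}. dot (Suc m) h (\<lambda>k. Q (k, j)) = \<zero>) \<and>
      (\<forall>e\<in>A. dot (Suc m) h (global_kernel F (Suc m) C e) = \<zero>) \<and> dot m h l \<noteq> h m"
  shows "slnc F (w - 1) r (code_mult F m (inv\<^bsub>mat_monoid F m\<^esub> Q') (code_mult F (Suc m) (id_append F m l) C))"
proof -
  note cQ = units_entry[OF Q]
  have Lc: "id_append F m l (i, j) \<in> carrier F" if "i < m" "j < Suc m" for i j
    by (rule id_append_closed[OF l that])
  have m: "w - 1 + r = m" using n w by simp
  show ?thesis
  proof (rule slnc_code_mult_inv[of "w - 1" r, unfolded m, OF fin _ r Q'(1)])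
    show "linear_code F m (code_mult F (Suc m) (id_append F m l) C)"
      by (rule code_mult_closed[OF C]) (rule Lc)
    show "y i = \<zero>" if "t \<in> T" "y \<in> pvec m"
      "\<And>e. e \<in> in_arcs G t \<Longrightarrow> dot m y (global_kernel F m (code_mult F (Suc m) (id_append F m l) C) e) = \<zero>" "i < m" for t y i
      by (rule reduced_injective[OF fin C dec l that])
    fix A assume A: "A \<in> primary_sets r"
    obtain g where g: "g \<in> pvec (Suc m)" "\<forall>j\<in>col ` {..<w - 1}. dot (Suc m) g (\<lambda>k. Q (k, j)) = \<zero>"
      "\<forall>e\<in>A. dot (Suc m) g (global_kernel F (Suc m) C e) = \<zero>" "dot m g l \<noteq> g m"
      using h[OF A] by blast
    show "dual_secure m (w - 1) (code_mult F (Suc m) (id_append F m l) C) Q' A"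
    proof (rule dual_secure_reduced[OF C l _ sec[OF A] g(1) _ _ g(4)])
      show "Q (i, j) \<in> carrier F" if "i < Suc m" "j < Suc m" for i j by (rule cQ[OF that])
      show "inj_on col {..<w - 1}" by (rule inj_on_subset[OF col(1)]) (use n in auto)
      show "Q' (i, j) = Q (i, col j) \<oplus> l i \<otimes> Q (m, col j)" if "i < m" "j < w - 1" for i j
        using Q'(2) that m by simp
    qed (use g col(2) n m in auto)
  qed
qed

lemma slnc_given:
  assumes "finite (carrier F)" "r \<le> card (out_arcs G s)" "linear_code F (w + r) C" "decodable F (w + r) C"
    "Q \<in> Units (mat_monoid F (w + r))" "\<And>A. A \<in> primary_sets r \<Longrightarrow> dual_secure (w + r) w C Q A"
  shows "slnc F w r (code_mult F (w + r) (inv\<^bsub>mat_monoid F (w + r)\<^esub> Q) C)"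
  by (rule slnc_code_mult_inv[OF assms(1,3,2,5) _ assms(6)])
    (use decodable_injective[OF assms(1,3,4)] in blast)

lemma dual_secure_of_trivial_intersection:
  assumes C: "linear_code F (w + r) C" and Q: "Q \<in> Units (mat_monoid F (w + r))" and A: "A \<in> primary_sets r"
    and triv: "module.span F (vec_sp F (w + r)) (mat_col (w + r) Q ` {..<w}) \<inter>
         module.span F (vec_sp F (w + r)) (global_kernel F (w + r) C ` A) = {\<zero>\<^bsub>vec_sp F (w + r)\<^esub>}"
  shows "dual_secure (w + r) w C Q A"
proof -
  have "finite A" using A finite_subset[OF _ finite_arcs] by (auto simp: primary_sets_def)
  moreover have "global_kernel F (w + r) C ` A \<subseteq> vecs F (w + r)" using global_kernel_closed[OF C] by blast
  ultimately show ?thesis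
    unfolding dual_secure_def using dual_security[OF Q _ _ _ triv] by auto
qed

end

theorem mainTheorem3:
  shows "\<exists>(alg :: ('v, 'e) rate_reduction_algorithm) (c :: nat).
    \<forall>G s T (F :: 'f ring) w r (C :: ('v, 'e, 'f) code) Q.
      network G s T \<and> field F \<and> finite (carrier F) \<and>
      1 \<le> w \<and> w + r \<le> network.C_min G s T \<and>
      card (network.primary_sets G s r) < card (carrier F) \<and>
      network.linear_code G s T F (w + r) C \<and>
      network.decodable G s T F (w + r) C \<and>
      Q \<in> Units (mat_monoid F (w + r)) \<and>
      (\<forall>A\<in>network.primary_sets G s r.
         module.span F (vec_sp F (w + r)) (mat_col (w + r) Q ` {..<w}) \<inter>
         module.span F (vec_sp F (w + r)) (network.global_kernel G s F (w + r) C ` A) =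
         {\<zero>\<^bsub>vec_sp F (w + r)\<^esub>})
      \<longrightarrow>
      network.slnc G s T F w r
        (network.code_mult s F (w + r) (inv\<^bsub>mat_monoid F (w + r)\<^esub> Q) C) \<and>
      (let n = w + r; m = n - 1; \<A> = network.primary_sets G s r;
           (out, \<sigma>, cost) = run F (alg G s T w r \<A>) (network.input_store G s F n C Q) 0;
           l = (\<lambda>i\<in>{..<m}. \<sigma> (ell_at out i));
           L = id_append F m l;
           C' = network.code_mult s F n L C;
           Q' = (\<lambda>(i, j)\<in>{..<m} \<times> {..<m}. \<sigma> (Q_at out i j));
           J = chosen out
       in l \<in> vecs F m \<and>
          (\<forall>i<m. \<forall>e\<in>out_arcs G s. \<sigma> (kernel_at out i e) = C' s (Imag i) e) \<and>
          inj_on (column out) {..<m} \<and> column out ` {..<m} \<subseteq> {..<n} \<and>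
          (\<forall>j<m. mat_col m Q' j = mat_col m (mat_mult F m n n L Q) (column out j)) \<and>
          Q' \<in> Units (mat_monoid F m) \<and>
          network.slnc G s T F (w - 1) r (network.code_mult s F m (inv\<^bsub>mat_monoid F m\<^esub> Q') C') \<and>
          (\<forall>v\<in>verts G - ({s} \<union> T). \<forall>d\<in>network.In G s m v. \<forall>e\<in>out_arcs G v.
             network.code_mult s F m (inv\<^bsub>mat_monoid F m\<^esub> Q') C' v d e =
             network.code_mult s F n (inv\<^bsub>mat_monoid F n\<^esub> Q) C v d e) \<and>
          J \<subseteq> {..<w} \<and> card J = w - 1 \<and>
          \<not> lin_dep_family F m (\<lambda>i. restrict (mat_col n Q i) {..<m}) J \<and>
          cost \<le> c * ((n - 1) ^ 3 * card \<A>
                      + (n - 1) * (card (network.dependent_sets G s F w r C Q J))\<^sup>2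
                      + (n - 1) * card (out_arcs G s)))"
proof (rule exI[of _ reduce_rate], rule exI[of _ 200], intro allI impI, elim conjE, goal_cases)
  case (1 G s T F w r C Q)
  note net = 1(1) and fld = 1(2) and fin = 1(3) and w = 1(4) and wr = 1(5) and q = 1(6) and C = 1(7)
    and dec = 1(8) and Q = 1(9) and triv = 1(10)
  interpret coded_network G s T F
    using net fld by (simp add: coded_network_def coeff_field_def)
  define m where "m = w + r - 1"
  have n: "w + r = Suc m" using w by (simp add: m_def)
  have r: "r \<le> card (out_arcs G s)" using wr C_min_le_out_arcs w by linarith
  have sec: "dual_secure (w + r) w C Q A" if "A \<in> primary_sets r" for A
    using dual_secure_of_trivial_intersection[OF C Q that] triv that by blast
  note C' = C[unfolded n] and dec' = dec[unfolded n] and Q' = Q[unfolded n] and sec' = sec[unfolded n]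
  \<comment> \<open>\<open>n = 1\<close> is separate because \<open>cost_bound\<close> starts at
    \<open>m = 1\<close>.\<close>
  have spec: "spec F (reduce_rate G s T w r (primary_sets r)) (input_store F (Suc m) C Q) 0
      (200 * (m ^ 3 * card (primary_sets r) + m * card (out_arcs G s))) (reduction_correct m w r C Q)"
  proof (cases "m = 0")
    case True
    then show ?thesis using spec_reduce_rate_0[OF _ w, of r] n by simp
  next
    case False
    then show ?thesis by (intro spec_reduce_rate[OF fin n w r q C' Q']) simp
  qed
  obtain out \<sigma> k cost where ex: "exec F (reduce_rate G s T w r (primary_sets r)) (input_store F (Suc m) C Q) 0 = (out, \<sigma>, k, cost)"
    and cost: "cost \<le> 200 * (m ^ 3 * card (primary_sets r) + m * card (out_arcs G s))"
    and "extends 0 (input_store F (Suc m) C Q) k \<sigma>" and correct: "reduction_correct m w r C Q out \<sigma> k"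
    by (rule specE[OF spec])
  have run: "run F (reduce_rate G s T w r (primary_sets r)) (input_store F (Suc m) C Q) 0 = (out, \<sigma>, cost)"
    by (simp add: run_exec ex)
  obtain x i1 where x: "x \<in> pvec m" "reads_vec m \<sigma> k (ell_at out) x"
    and K: "\<forall>i<m. \<forall>e\<in>out_arcs G s. reads \<sigma> k (kernel_at out i e) (C s (Imag i) e \<oplus>\<^bsub>F\<^esub> x i \<otimes>\<^bsub>F\<^esub> C s (Imag m) e)"
    and P: "\<forall>i<m. \<forall>j<m. reads \<sigma> k (Q_at out i j) (Q (i, column out j) \<oplus>\<^bsub>F\<^esub> x i \<otimes>\<^bsub>F\<^esub> Q (m, column out j))"
    and col: "bij_betw (column out) {..<m} ({..<Suc m} - {i1})" "column out ` {..<w - 1} = chosen out"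
    and J: "chosen out \<subseteq> {..<w}" "card (chosen out) = w - 1"
      "\<not> lin_dep_family F m (\<lambda>i. restrict (mat_col (Suc m) Q i) {..<m}) (chosen out)"
    and U: "(\<lambda>(i, j)\<in>{..<m} \<times> {..<m}. Q (i, column out j) \<oplus>\<^bsub>F\<^esub> x i \<otimes>\<^bsub>F\<^esub> Q (m, column out j)) \<in> Units (mat_monoid F m)"
    and h: "\<forall>A\<in>primary_sets r. \<exists>h\<in>pvec (Suc m). (\<forall>j\<in>chosen out. dot (Suc m) h (\<lambda>k. Q (k, j)) = \<zero>\<^bsub>F\<^esub>) \<and>
        (\<forall>e\<in>A. dot (Suc m) h (global_kernel F (Suc m) C e) = \<zero>\<^bsub>F\<^esub>) \<and> dot m h x \<noteq> h m"
    using correct unfolding reduction_correct_def by (elim bexE exE conjE) (rule that)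
  note cQ = units_entry[OF Q']
  \<comment> \<open>The restriction of the stored values to the indices below \<open>m\<close>,
    which makes \<open>l\<close> an element of \<open>vecs F m\<close>. It agrees there with
    \<open>x\<close>, which may take other values elsewhere.\<close>
  define l where "l = (\<lambda>i\<in>{..<m}. \<sigma> (ell_at out i))"
  have l_x: "l i = x i" if "i < m" for i using x(2) that by (simp add: l_def reads_def)
  have l: "l \<in> vecs F m" using x(1) l_x by (auto simp: l_def reads_def Pi_iff)
  have lp: "l \<in> pvec m" by (rule vecs_pvec[OF l])
  define Q1 where "Q1 = (\<lambda>(i, j)\<in>{..<m} \<times> {..<m}. \<sigma> (Q_at out i j))"
  have Q1: "Q1 (i, j) = Q (i, column out j) \<oplus>\<^bsub>F\<^esub> l i \<otimes>\<^bsub>F\<^esub> Q (m, column out j)" if "i < m" "j < m" for i j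
    using P that l_x by (simp add: Q1_def reads_def)
  have Q1_unit: "Q1 \<in> Units (mat_monoid F m)"
  proof -
    have "Q1 = (\<lambda>(i, j)\<in>{..<m} \<times> {..<m}. Q (i, column out j) \<oplus>\<^bsub>F\<^esub> x i \<otimes>\<^bsub>F\<^esub> Q (m, column out j))"
      by (rule mat_eqI[of _ m m]) (use Q1 l_x in \<open>auto simp: Q1_def\<close>)
    then show ?thesis using U by simp
  qed
  have inj: "inj_on (column out) {..<m}" and col_lt: "column out ` {..<m} \<subseteq> {..<Suc m}"
    using col(1) by (auto simp: bij_betw_def)
  have hl: "\<exists>h\<in>pvec (Suc m). (\<forall>j\<in>column out ` {..<w - 1}. dot (Suc m) h (\<lambda>k. Q (k, j)) = \<zero>\<^bsub>F\<^esub>) \<and>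
        (\<forall>e\<in>A. dot (Suc m) h (global_kernel F (Suc m) C e) = \<zero>\<^bsub>F\<^esub>) \<and> dot m h l \<noteq> h m"
    if "A \<in> primary_sets r" for A
  proof -
    have "dot m h l = dot m h x" for h by (rule dot_cong) (use l_x in auto)
    then show ?thesis using h that col(2) by simp
  qed
  show ?case
    unfolding Let_def n diff_Suc_1 run prod.case l_def[symmetric] Q1_def[symmetric]
  proof (intro conjI)
    show "slnc F w r (code_mult F (Suc m) (inv\<^bsub>mat_monoid F (Suc m)\<^esub> Q) C)"
      using slnc_given[OF fin r C dec Q sec] by (simp add: n)
    show "l \<in> vecs F m" by (rule l)
    show "\<forall>i<m. \<forall>e\<in>out_arcs G s. \<sigma> (kernel_at out i e) = code_mult F (Suc m) (id_append F m l) C s (Imag i) e"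
    proof (intro allI impI ballI)
      fix i e assume i: "i < m" and e: "e \<in> out_arcs G s"
      have "(\<lambda>j. C s (Imag j) e) \<in> pvec (Suc m)"
        using linear_code_carrier[OF C', of e "Imag j" for j] e by (auto simp: In_def)
      then show "\<sigma> (kernel_at out i e) = code_mult F (Suc m) (id_append F m l) C s (Imag i) e"
        using K i e l_x by (simp add: code_mult_source dot_id_append_row[OF lp _ i] reads_def)
    qed
    show "inj_on (column out) {..<m}" "column out ` {..<m} \<subseteq> {..<Suc m}" by (rule inj col_lt)+
    show "\<forall>j<m. mat_col m Q1 j = mat_col m (mat_mult F m (Suc m) (Suc m) (id_append F m l) Q) (column out j)"
    proof (intro allI impI)
      fix j assume j: "j < m"
      then have cj: "column out j < Suc m" using col_lt by auto
      have "(\<lambda>k. Q (k, column out j)) \<in> pvec (Suc m)" using cQ cj by auto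
      then show "mat_col m Q1 j = mat_col m (mat_mult F m (Suc m) (Suc m) (id_append F m l) Q) (column out j)"
        unfolding mat_col_def
        by (intro restrict_ext) (use j cj in \<open>simp add: Q1 mat_mult_entry dot_id_append_row[OF lp]\<close>)
    qed
    show "Q1 \<in> Units (mat_monoid F m)" by (rule Q1_unit)
    show "slnc F (w - 1) r (code_mult F m (inv\<^bsub>mat_monoid F m\<^esub> Q1) (code_mult F (Suc m) (id_append F m l) C))"
    proof (rule slnc_reduced[OF fin n w r C' dec' Q' sec' lp inj _ Q1_unit Q1 hl])
      show "column out ` {..<w - 1} \<subseteq> {..<w}" using col(2) J(1) by simp
    qed
    show "\<forall>v\<in>verts G - ({s} \<union> T). \<forall>d\<in>In m v. \<forall>e\<in>out_arcs G v.
        code_mult F m (inv\<^bsub>mat_monoid F m\<^esub> Q1) (code_mult F (Suc m) (id_append F m l) C) v d e =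
        code_mult F (Suc m) (inv\<^bsub>mat_monoid F (Suc m)\<^esub> Q) C v d e"
      by (auto simp: code_mult_def)
    show "chosen out \<subseteq> {..<w}" "card (chosen out) = w - 1"
      "\<not> lin_dep_family F m (\<lambda>i. restrict (mat_col (Suc m) Q i) {..<m}) (chosen out)" by (rule J)+
    show "cost \<le> 200 * (m ^ 3 * card (primary_sets r) +
        m * (card (dependent_sets F w r C Q (chosen out)))\<^sup>2 + m * card (out_arcs G s))"
      by (rule order_trans[OF cost]) simp
  qed
qed

end
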